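(* Let $\Gamma$ be a nontrivial group, $K=\bigoplus_{\mathbf{Q}_2}\Gamma$, $\overline K=\prod_{\mathbf{Q}_2}\Gamma$, and $G=K\rtimes V$ the untwisted permutational restricted wreath product (with $V$ acting by $(v\cdot a)(x)=a(v^{-1}x)$), viewed inside $\overline G=\overline K\rtimes V$. Let $Q=\big(Z\Gamma\times N_{\overline K}(G)/Z\Gamma\big)\rtimes_\sigma\big(\mathrm{Stab}_N(\mathbf{Q}_2)\times\mathrm{Aut}(\Gamma)\big)$ with $\sigma(\varphi,\beta)(\zeta,f)=(\beta(\zeta),\ \overline\beta(f)^\varphi\cdot\beta(\zeta)^{\mu_\varphi})$. Then the map $\Xi:Q\to\mathrm{Aut}(G)$, $(\zeta,f,\varphi,\beta)\mapsto E_\zeta\circ\mathrm{ad}(f)\circ A_{\varphi,\beta}$ is a surjective group morphism whose kernel is $\{(e,\overline g,e,\mathrm{ad}(g^{-1})):\ g\in\Gamma\}$, where $\overline g$ is the class of the constant map $\mathbf{Q}_2\to\Gamma$ with value $g$ and $\mathrm{ad}(g^{-1})(h)=g^{-1}hg$.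
   Context: Cantor space $\mathfrak C=\{0,1\}^{\mathbf N}$; for a finite word $m$, $C_m=\{m\cdot x\}$. Thompson's group $V$: homeomorphisms $v$ of $\mathfrak C$ such that for two partitions $\mathfrak C=\bigsqcup_k C_{m_k}=\bigsqcup_k C_{m'_k}$, $v(m_kx)=m'_kx$; slope $v'(x)=2^{|m_k|-|m'_k|}$ for $x\in C_{m_k}$ (chain rule holds). $\mathbf{Q}_2\subset\mathfrak C$: eventually-zero sequences, identified with dyadic rationals in $[0,1)$ via $x\mapsto\sum_{n\ge1}x_n2^{-n}$; $0$ is the zero sequence. $\nu$ is the dyadic valuation: $\nu(0)=0$ and $\nu(2^k p/q)=k$ for $p,q$ odd. $N_{H(\mathfrak C)}(V)=\{\varphi\in\mathrm{Homeo}(\mathfrak C):\varphi V\varphi^{-1}=V\}$ and $\mathrm{Stab}_N(\mathbf{Q}_2)=\{\varphi\in N_{H(\mathfrak C)}(V):\varphi(\mathbf{Q}_2)=\mathbf{Q}_2\}$. Notation: for $f:\mathbf{Q}_2\to\Gamma$, $f^v(x)=f(v^{-1}x)$, $f^\varphi(x)=f(\varphi^{-1}x)$, $\overline\beta(f)(x)=\beta(f(x))$; $\mathrm{ad}_\varphi(v)=\varphi v\varphi^{-1}$. $Z\Gamma$ is the centre of $\Gamma$, also identified with constant $Z\Gamma$-valued maps in $\overline K$. $N_{\overline K}(G)=\{f\in\overline K: fGf^{-1}=G\}$ (conjugation inside $\overline G$). Automorphisms of $G$: $A_{\varphi,\beta}(av)=\overline\beta(a)^\varphi\,\mathrm{ad}_\varphi(v)$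 for $(\varphi,\beta)\in\mathrm{Stab}_N(\mathbf{Q}_2)\times\mathrm{Aut}(\Gamma)$; $\mathrm{ad}(f)(av)=favf^{-1}$ for $f\in N_{\overline K}(G)$ (factoring through $N_{\overline K}(G)/Z\Gamma$); $E_\zeta(av)=a\cdot\zeta^{p_v}\cdot v$ for $\zeta\in Z\Gamma$, where $p_v(x)=\log_2(v'(v^{-1}x))-\nu(x)+\nu(v^{-1}x)$ and $\zeta^{p_v}(x)=\zeta^{p_v(x)}$. For $\varphi\in\mathrm{Stab}_N(\mathbf{Q}_2)$, $\mu_\varphi:\mathbf{Q}_2\to\mathbf Z$ is $\mu_\varphi(x)=\log_2\big((\varphi^{-1}v\varphi)'(\varphi^{-1}0)\big)-\log_2(v'(0))-\nu(\varphi^{-1}x)+\nu(x)$ for any $v\in V$ with $v0=x$ (independent of $v$), and $\beta(\zeta)^{\mu_\varphi}(x)=\beta(\zeta)^{\mu_\varphi(x)}$. $\sigma$ is an action by automorphisms of $\mathrm{Stab}_N(\mathbf{Q}_2)\times\mathrm{Aut}(\Gamma)$ on $Z\Gamma\times N_{\overline K}(G)/Z\Gamma$. *)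

theory Defs
  imports "HOL-Algebra.Algebra"
begin

type_synonym cantor = "nat \<Rightarrow> bool"

definition prepend :: "bool list \<Rightarrow> cantor \<Rightarrow> cantor" where
  "prepend m x = (\<lambda>i. if i < length m then m ! i else x (i - length m))"

definition cyl :: "bool list \<Rightarrow> cantor set" where
  "cyl m = range (prepend m)"

definition cantor_cont :: "(cantor \<Rightarrow> cantor) \<Rightarrow> bool" where
  "cantor_cont f \<longleftrightarrow> (\<forall>x n. \<exists>m. \<forall>y. (\<forall>i<m. y i = x i) \<longrightarrow> (\<forall>i<n. f y i = f x i))"

definition Homeo :: "(cantor \<Rightarrow> cantor) set" where
  "Homeo = {f. bij f \<and> cantor_cont f \<and> cantor_cont (the_inv f)}"

definition is_partition :: "bool list list \<Rightarrow> bool" where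
  "is_partition ms \<longleftrightarrow> (\<forall>x. \<exists>!k. k < length ms \<and> x \<in> cyl (ms ! k))"

definition ThompsonV :: "(cantor \<Rightarrow> cantor) set" where
  "ThompsonV = {v \<in> Homeo. \<exists>ms ms'. length ms = length ms' \<and> is_partition ms \<and> is_partition ms'
      \<and> (\<forall>k < length ms. \<forall>x. v (prepend (ms ! k) x) = prepend (ms' ! k) x)}"

text \<open>log_2 of the slope v'(x): |m| - |m'| where x in C_m and v(m y) = m' y.\<close>
definition log_slope :: "(cantor \<Rightarrow> cantor) \<Rightarrow> cantor \<Rightarrow> int" where
  "log_slope v x = (SOME d. \<exists>m m'. x \<in> cyl m \<and> (\<forall>y. v (prepend m y) = prepend m' y)
                       \<and> d = int (length m) - int (length m'))"

definition zero_seq :: cantor where "zero_seq = (\<lambda>_. False)"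

definition Q2 :: "cantor set" where "Q2 = {x. finite {i. x i}}"

text \<open>x maps to sum_{n>=1} x_n 2^{-n}; with 0-based indices bit i has weight 2^{-(i+1)}.\<close>
definition cantor_value :: "cantor \<Rightarrow> rat" where
  "cantor_value x = (\<Sum>i\<in>{i. x i}. 1 / 2 ^ (Suc i))"

definition dyadic_val :: "rat \<Rightarrow> int" where
  "dyadic_val q = (if q = 0 then 0 else
     (THE k. \<exists>a b :: int. odd a \<and> odd b \<and> q = power_int 2 k * of_int a / of_int b))"

definition nu :: "cantor \<Rightarrow> int" where "nu x = dyadic_val (cantor_value x)"

definition NormV :: "(cantor \<Rightarrow> cantor) set" where
  "NormV = {\<phi> \<in> Homeo. (\<lambda>v. \<phi> \<circ> v \<circ> the_inv \<phi>) ` ThompsonV = ThompsonV}"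

definition StabN :: "(cantor \<Rightarrow> cantor) set" where
  "StabN = {\<phi> \<in> NormV. \<phi> ` Q2 = Q2}"

definition centre :: "('g, 'm) monoid_scheme \<Rightarrow> 'g set" where
  "centre \<Gamma> = {z \<in> carrier \<Gamma>. \<forall>g \<in> carrier \<Gamma>. z \<otimes>\<^bsub>\<Gamma>\<^esub> g = g \<otimes>\<^bsub>\<Gamma>\<^esub> z}"

text \<open>Maps Q2 -> Gamma, represented as functions on the Cantor space equal to 1 off Q2.\<close>
definition Kbar :: "('g, 'm) monoid_scheme \<Rightarrow> (cantor \<Rightarrow> 'g) set" where
  "Kbar \<Gamma> = {a. (\<forall>x\<in>Q2. a x \<in> carrier \<Gamma>) \<and> (\<forall>x. x \<notin> Q2 \<longrightarrow> a x = \<one>\<^bsub>\<Gamma>\<^esub>)}"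

definition Kfin :: "('g, 'm) monoid_scheme \<Rightarrow> (cantor \<Rightarrow> 'g) set" where
  "Kfin \<Gamma> = {a \<in> Kbar \<Gamma>. finite {x. a x \<noteq> \<one>\<^bsub>\<Gamma>\<^esub>}}"

definition kmul :: "('g, 'm) monoid_scheme \<Rightarrow> (cantor \<Rightarrow> 'g) \<Rightarrow> (cantor \<Rightarrow> 'g) \<Rightarrow> (cantor \<Rightarrow> 'g)" where
  "kmul \<Gamma> a b = (\<lambda>x. a x \<otimes>\<^bsub>\<Gamma>\<^esub> b x)"

definition kone :: "('g, 'm) monoid_scheme \<Rightarrow> (cantor \<Rightarrow> 'g)" where
  "kone \<Gamma> = (\<lambda>_. \<one>\<^bsub>\<Gamma>\<^esub>)"

definition kconst :: "('g, 'm) monoid_scheme \<Rightarrow> 'g \<Rightarrow> (cantor \<Rightarrow> 'g)" where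
  "kconst \<Gamma> g = (\<lambda>x. if x \<in> Q2 then g else \<one>\<^bsub>\<Gamma>\<^esub>)"

definition wreath :: "('g, 'm) monoid_scheme \<Rightarrow> (cantor \<Rightarrow> 'g) set
                       \<Rightarrow> ((cantor \<Rightarrow> 'g) \<times> (cantor \<Rightarrow> cantor)) monoid" where
  "wreath \<Gamma> A = \<lparr>carrier = A \<times> ThompsonV,
     monoid.mult = (\<lambda>(a, v) (b, w). (kmul \<Gamma> a (\<lambda>x. b (the_inv v x)), v \<circ> w)),
     one = (kone \<Gamma>, id)\<rparr>"

abbreviation Gw :: "('g, 'm) monoid_scheme \<Rightarrow> ((cantor \<Rightarrow> 'g) \<times> (cantor \<Rightarrow> cantor)) monoid" where
  "Gw \<Gamma> \<equiv> wreath \<Gamma> (Kfin \<Gamma>)"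

abbreviation Gbar :: "('g, 'm) monoid_scheme \<Rightarrow> ((cantor \<Rightarrow> 'g) \<times> (cantor \<Rightarrow> cantor)) monoid" where
  "Gbar \<Gamma> \<equiv> wreath \<Gamma> (Kbar \<Gamma>)"

definition adK :: "('g, 'm) monoid_scheme \<Rightarrow> (cantor \<Rightarrow> 'g)
     \<Rightarrow> (cantor \<Rightarrow> 'g) \<times> (cantor \<Rightarrow> cantor) \<Rightarrow> (cantor \<Rightarrow> 'g) \<times> (cantor \<Rightarrow> cantor)" where
  "adK \<Gamma> f g = (f, id) \<otimes>\<^bsub>Gbar \<Gamma>\<^esub> g \<otimes>\<^bsub>Gbar \<Gamma>\<^esub> ((\<lambda>x. inv\<^bsub>\<Gamma>\<^esub> (f x)), id)"

definition NKbar :: "('g, 'm) monoid_scheme \<Rightarrow> (cantor \<Rightarrow> 'g) set" where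
  "NKbar \<Gamma> = {f \<in> Kbar \<Gamma>. adK \<Gamma> f ` carrier (Gw \<Gamma>) = carrier (Gw \<Gamma>)}"

definition A_aut :: "('g, 'm) monoid_scheme \<Rightarrow> (cantor \<Rightarrow> cantor) \<Rightarrow> ('g \<Rightarrow> 'g)
     \<Rightarrow> (cantor \<Rightarrow> 'g) \<times> (cantor \<Rightarrow> cantor) \<Rightarrow> (cantor \<Rightarrow> 'g) \<times> (cantor \<Rightarrow> cantor)" where
  "A_aut \<Gamma> \<phi> \<beta> = (\<lambda>(a, v). ((\<lambda>x. if x \<in> Q2 then \<beta> (a (the_inv \<phi> x)) else \<one>\<^bsub>\<Gamma>\<^esub>),
                               \<phi> \<circ> v \<circ> the_inv \<phi>))"

definition p_cocycle :: "(cantor \<Rightarrow> cantor) \<Rightarrow> cantor \<Rightarrow> int" where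
  "p_cocycle v x = log_slope v (the_inv v x) - nu x + nu (the_inv v x)"

definition zpow :: "('g, 'm) monoid_scheme \<Rightarrow> 'g \<Rightarrow> (cantor \<Rightarrow> int) \<Rightarrow> (cantor \<Rightarrow> 'g)" where
  "zpow \<Gamma> z p = (\<lambda>x. if x \<in> Q2 then z [^]\<^bsub>\<Gamma>\<^esub> p x else \<one>\<^bsub>\<Gamma>\<^esub>)"

definition E_aut :: "('g, 'm) monoid_scheme \<Rightarrow> 'g
     \<Rightarrow> (cantor \<Rightarrow> 'g) \<times> (cantor \<Rightarrow> cantor) \<Rightarrow> (cantor \<Rightarrow> 'g) \<times> (cantor \<Rightarrow> cantor)" where
  "E_aut \<Gamma> \<zeta> = (\<lambda>(a, v). (kmul \<Gamma> a (zpow \<Gamma> \<zeta> (p_cocycle v)), v))"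

definition mu :: "(cantor \<Rightarrow> cantor) \<Rightarrow> cantor \<Rightarrow> int" where
  "mu \<phi> x = (let v = (SOME v. v \<in> ThompsonV \<and> v zero_seq = x) in
      log_slope (the_inv \<phi> \<circ> v \<circ> \<phi>) (the_inv \<phi> zero_seq) - log_slope v zero_seq
      - nu (the_inv \<phi> x) + nu x)"

text \<open>Class of f in N_Kbar(G)/Z Gamma (Z Gamma = constant central maps).\<close>
definition zcls :: "('g, 'm) monoid_scheme \<Rightarrow> (cantor \<Rightarrow> 'g) \<Rightarrow> (cantor \<Rightarrow> 'g) set" where
  "zcls \<Gamma> f = {kmul \<Gamma> f (kconst \<Gamma> z) | z. z \<in> centre \<Gamma>}"

definition rep :: "(cantor \<Rightarrow> 'g) set \<Rightarrow> (cantor \<Rightarrow> 'g)" where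
  "rep F = (SOME f. f \<in> F)"

definition sigma2 :: "('g, 'm) monoid_scheme \<Rightarrow> (cantor \<Rightarrow> cantor) \<Rightarrow> ('g \<Rightarrow> 'g) \<Rightarrow> 'g
     \<Rightarrow> (cantor \<Rightarrow> 'g) \<Rightarrow> (cantor \<Rightarrow> 'g)" where
  "sigma2 \<Gamma> \<phi> \<beta> \<zeta> f = kmul \<Gamma> (\<lambda>x. if x \<in> Q2 then \<beta> (f (the_inv \<phi> x)) else \<one>\<^bsub>\<Gamma>\<^esub>)
                                (zpow \<Gamma> (\<beta> \<zeta>) (mu \<phi>))"

type_synonym ('g) qelt = "'g \<times> (cantor \<Rightarrow> 'g) set \<times> (cantor \<Rightarrow> cantor) \<times> ('g \<Rightarrow> 'g)"

text \<open>Q = (Z Gamma x N/Z Gamma) semidirect_sigma (Stab_N(Q2) x Aut Gamma), with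
  (n1,h1)(n2,h2) = (n1 . sigma(h1)(n2), h1 h2).\<close>
definition Qgrp :: "('g, 'm) monoid_scheme \<Rightarrow> 'g qelt monoid" where
  "Qgrp \<Gamma> = \<lparr>carrier = centre \<Gamma> \<times> (zcls \<Gamma> ` NKbar \<Gamma>) \<times> StabN \<times> auto \<Gamma>,
     monoid.mult = (\<lambda>(\<zeta>1, F1, \<phi>1, \<beta>1) (\<zeta>2, F2, \<phi>2, \<beta>2).
        (\<zeta>1 \<otimes>\<^bsub>\<Gamma>\<^esub> \<beta>1 \<zeta>2,
         zcls \<Gamma> (kmul \<Gamma> (rep F1) (sigma2 \<Gamma> \<phi>1 \<beta>1 \<zeta>2 (rep F2))),
         \<phi>1 \<circ> \<phi>2,
         compose (carrier \<Gamma>) \<beta>1 \<beta>2)),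
     one = (\<one>\<^bsub>\<Gamma>\<^esub>, zcls \<Gamma> (kone \<Gamma>), id, (\<lambda>x \<in> carrier \<Gamma>. x))\<rparr>"

definition Xi :: "('g, 'm) monoid_scheme \<Rightarrow> 'g qelt
     \<Rightarrow> ((cantor \<Rightarrow> 'g) \<times> (cantor \<Rightarrow> cantor) \<Rightarrow> (cantor \<Rightarrow> 'g) \<times> (cantor \<Rightarrow> cantor))" where
  "Xi \<Gamma> = (\<lambda>(\<zeta>, F, \<phi>, \<beta>).
      restrict (E_aut \<Gamma> \<zeta> \<circ> adK \<Gamma> (rep F) \<circ> A_aut \<Gamma> \<phi> \<beta>) (carrier (Gw \<Gamma>)))"

end

theory Submission
  imports Defs
begin

text \<open>
  \<open>V\<close> acts faithfully on \<open>Q2\<close> and every injective finite partial map of \<open>Q2\<close> extends to an element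
  of \<open>V\<close>. Multiplicativity of \<open>\<Xi>\<close> comes down to the identity
  \<open>p_{\<phi>\<^sup>-\<^sup>1 v \<phi>}(\<phi>\<^sup>-\<^sup>1 x) = p_v(x) + \<mu>_\<phi>(x) - \<mu>_\<phi>(v\<^sup>-\<^sup>1 x)\<close>, that is, to the fact that conjugation by
  \<open>\<phi>\<close> preserves slopes at fixed points.

  For surjectivity, let \<open>\<theta>\<close> be an automorphism of \<open>G\<close>. High transitivity forces \<open>\<theta>(K) = K\<close>, and the
  automorphism induced on \<open>V\<close> permutes the stabilisers \<open>V\<^sub>x\<close>, because \<open>\<theta>(\<Gamma>\<^sub>x)\<close> consists of maps
  whose finite supports are invariant under the image of \<open>V\<^sub>x\<close>. The resulting permutation of \<open>Q2\<close>
  is uniformly continuous, since cylinders are the sets moved by involutions of \<open>V\<close>; it extends to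
  \<open>\<phi> \<in> Stab_N(Q2)\<close>, and no reconstruction theorem of Rubin type is needed. After composing with
  \<open>A_\<phi>\<^sup>-\<^sup>1\<close> we have \<open>\<theta>(v) = c_v v\<close>. The value \<open>c_u(0)\<close> for \<open>u\<close> fixing \<open>0\<close> is central and depends only on
  the germ of \<open>u\<close>, hence is \<open>\<zeta>\<close> to the power of the logarithmic slope, and \<open>c\<close> divided by \<open>\<zeta>\<^sup>p\<close> is the
  coboundary of some \<open>f\<close>.
\<close>

section \<open>Words, cylinders and the group \<open>V\<close>\<close>

text \<open>The valuation terms in \<open>p_cocycle\<close> are what make \<open>E_aut\<close> land
  in G. The slope alone is a cocycle on Q2 with infinite support. Where v exchanges a prefix m for
  m', a point m y with y nonzero has its valuation changed by exactly the difference of lengths,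
  which cancels the slope; only finitely many points m' 000... can survive. At a fixed point the
  correction vanishes and p is the logarithmic slope, so no ad(f) can absorb a nontrivial \<zeta>.

  The function \<open>mu\<close> appears because conjugation by \<phi> preserves slopes only at
  fixed points; elsewhere the defect is a coboundary, and \<open>mu\<close> is a primitive of it
  (valuations included), obtained by transport from 0.

  Elements of Q carry classes modulo central constants, and \<open>Xi\<close> picks representatives.
  The computations use \<open>Xmap\<close>, which takes an actual map f, and the choice is shown to
  be invisible.

  In the surjectivity proof an automorphism and its inverse are treated symmetrically, so that a
  construction for one is inverted by the same construction for the other.\<close>

lemma the_inv_f [simp]: "bij f \<Longrightarrow> the_inv f (f x) = x"
  by (simp add: bij_is_inj the_inv_f_f)

lemma f_the_inv [simp]: "bij f \<Longrightarrow> f (the_inv f x) = x"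
  by (simp add: bij_def f_the_inv_into_f)

lemma bij_the_inv [simp]: "bij f \<Longrightarrow> bij (the_inv f)"
  by (metis bij_betw_the_inv_into)

lemma the_inv_comp_f [simp]: "bij f \<Longrightarrow> the_inv f \<circ> f = id" "bij f \<Longrightarrow> f \<circ> the_inv f = id"
  by (auto simp: fun_eq_iff)

lemma the_inv_eq: "bij f \<Longrightarrow> f x = y \<Longrightarrow> the_inv f y = x"
  by auto

lemma the_inv_unique: "f \<circ> g = id \<Longrightarrow> g \<circ> f = id \<Longrightarrow> the_inv f = g"
  by (metis bij_betw_def comp_apply ext id_apply o_bij the_inv_f_f)

lemma the_inv_the_inv [simp]: "bij f \<Longrightarrow> the_inv (the_inv f) = f"
  by (simp add: the_inv_unique)

lemma the_inv_comp: "bij f \<Longrightarrow> bij g \<Longrightarrow> the_inv (f \<circ> g) = the_inv g \<circ> the_inv f"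
  by (rule the_inv_unique) (auto simp: fun_eq_iff)

lemma the_inv_id [simp]: "the_inv id = id"
  by (rule the_inv_unique) auto

lemma the_inv_eq_iff: "bij f \<Longrightarrow> the_inv f y = x \<longleftrightarrow> y = f x"
  by auto

section \<open>Words, prefix replacement and uniform depth\<close>

definition pre :: "nat \<Rightarrow> cantor \<Rightarrow> bool list" where
  "pre n x = map x [0..<n]"

definition shift :: "nat \<Rightarrow> cantor \<Rightarrow> cantor" where
  "shift n x = (\<lambda>i. x (i + n))"

text \<open>The local form of an element of V. Both words are kept explicit because the slope is
  read off from their lengths.\<close>

definition affine :: "(cantor \<Rightarrow> cantor) \<Rightarrow> bool list \<Rightarrow> bool list \<Rightarrow> bool" where
  "affine v m m' \<longleftrightarrow> (\<forall>y. v (prepend m y) = prepend m' y)"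

lemma length_pre [simp]: "length (pre n x) = n"
  by (simp add: pre_def)

lemma prepend_pre_shift [simp]: "prepend (pre n x) (shift n x) = x"
  by (auto simp: prepend_def pre_def shift_def)

lemma prepend_append: "prepend (m @ n) y = prepend m (prepend n y)"
  by (auto simp: prepend_def nth_append fun_eq_iff)

lemma prepend_Nil [simp]: "prepend [] y = y"
  by (simp add: prepend_def)

lemma pre_prepend [simp]: "pre (length m) (prepend m y) = m"
  by (auto simp: pre_def prepend_def intro: nth_equalityI)

lemma shift_prepend [simp]: "shift (length m) (prepend m y) = y"
  by (auto simp: shift_def prepend_def)

lemma prepend_eqD: "prepend m y = prepend n z \<Longrightarrow> length m = length n \<Longrightarrow> m = n \<and> y = z"
  by (metis pre_prepend shift_prepend)

lemma prepend_inj [simp]: "prepend m y = prepend m z \<longleftrightarrow> y = z"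
  by (metis shift_prepend)

lemma cyl_iff: "x \<in> cyl m \<longleftrightarrow> pre (length m) x = m"
  by (metis cyl_def imageE pre_prepend prepend_pre_shift rangeI)

lemma prepend_in_cyl [simp]: "prepend m y \<in> cyl m"
  by (simp add: cyl_iff)

lemma in_cyl_pre [simp]: "x \<in> cyl (pre n x)"
  by (simp add: cyl_iff)

lemma cylE: assumes "x \<in> cyl m" obtains y where "x = prepend m y"
  using assms by (auto simp: cyl_def)

lemma pre_eq_iff: "pre n x = pre n y \<longleftrightarrow> (\<forall>i<n. x i = y i)"
  by (auto simp: pre_def)

lemma take_pre: "n \<le> k \<Longrightarrow> take n (pre k x) = pre n x"
  by (auto simp: pre_def take_map)

lemma cyl_le: assumes "x \<in> cyl m" "length m \<le> n" obtains t where "pre n x = m @ t"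
  using assms by (metis append_take_drop_id cyl_iff take_pre)

lemma cyl_append: "prepend m y \<in> cyl n \<Longrightarrow> length n \<le> length m \<Longrightarrow> \<exists>t. m = n @ t"
  by (metis cyl_le pre_prepend)

lemma affine_append: "affine v m m' \<Longrightarrow> affine v (m @ t) (m' @ t)"
  by (simp add: affine_def prepend_append)

lemma affine_comp: "affine w m m' \<Longrightarrow> affine v m' m'' \<Longrightarrow> affine (v \<circ> w) m m''"
  by (simp add: affine_def)

lemma affine_inv: "bij v \<Longrightarrow> affine v m m' \<Longrightarrow> affine (the_inv v) m' m"
  by (auto simp: affine_def intro: the_inv_eq)

lemma affine_id: "affine id m m"
  by (simp add: affine_def)

text \<open>If p were shorter than q, the first free digit of y would be forced to equal a fixed
  letter of q; the two constant sequences rule this out.\<close>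

lemma prepend_ext:
  assumes "\<And>y :: cantor. prepend p y = prepend q y"
  shows "p = q"
proof -
  have *: "\<not> length p < length q" if eq: "\<And>y :: cantor. prepend p y = prepend q y" for p q
  proof
    assume lt: "length p < length q"
    have a: "y 0 = q ! length p" for y :: cantor
      using fun_cong[OF eq[of y], of "length p"] lt by (simp add: prepend_def)
    have "(\<lambda>_. True) (0::nat) = (\<lambda>_. False) (0::nat)"
      using a[of "\<lambda>_. True"] a[of "\<lambda>_. False"] by metis
    then show False by simp
  qed
  have "length p = length q" using *[of p q] *[of q p] assms by force
  then show ?thesis using assms prepend_eqD by blast
qed

lemma affine_unique: "affine v m m' \<Longrightarrow> affine v m n' \<Longrightarrow> m' = n'"
  by (metis affine_def prepend_ext)

text \<open>Two cylinders around x are nested, and on the smaller one the image word is forced by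
  the pair on the larger one.\<close>

lemma affine_compare:
  assumes "affine v m m'" "affine v n n'" "x \<in> cyl m" "x \<in> cyl n" "length m \<le> length n"
  obtains t where "n = m @ t" "n' = m' @ t"
proof -
  obtain t where t: "n = m @ t"
    using assms(3,4,5) by (metis cyl_iff cyl_le)
  with affine_append[OF assms(1), of t] assms(2) have "n' = m' @ t"
    by (metis affine_unique)
  with t that show ?thesis by blast
qed

text \<open>Replacement pairs at x differ by a common suffix on both words, which leaves the
  difference of lengths unchanged, so the \<open>SOME\<close> in \<open>log_slope\<close> has only
  one possible value.\<close>

lemma log_slope_eq:
  assumes "affine v m m'" "x \<in> cyl m"
  shows "log_slope v x = int (length m) - int (length m')"
  unfolding log_slope_def
proof (rule some_equality)
  show "\<exists>ma m'a. x \<in> cyl ma \<and> (\<forall>y. v (prepend ma y) = prepend m'a y) \<and>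
      int (length m) - int (length m') = int (length ma) - int (length m'a)"
    using assms affine_def by blast
next
  fix d assume "\<exists>m m'. x \<in> cyl m \<and> (\<forall>y. v (prepend m y) = prepend m' y) \<and> d = int (length m) - int (length m')"
  then obtain n n' where n: "x \<in> cyl n" "affine v n n'" "d = int (length n) - int (length n')"
    by (auto simp: affine_def)
  show "d = int (length m) - int (length m')"
  proof (cases "length m \<le> length n")
    case True
    then show ?thesis using affine_compare[OF assms(1) n(2) assms(2) n(1)] n(3) by force
  next
    case False
    then show ?thesis using affine_compare[OF n(2) assms(1) n(1) assms(2)] n(3) by force
  qed
qed

text \<open>The word replacing the first N letters may be empty, so N + n digits of input are what
  guarantees n digits of output.\<close>

lemma affine_uniform_cont:
  assumes "\<And>m. length m = N \<Longrightarrow> \<exists>m'. affine v m m'"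
  assumes "\<forall>i<N+n. y i = x i" "i < n"
  shows "v y i = v x i"
proof -
  obtain m' where "affine v (pre N x) m'" using assms(1) by force
  moreover have "pre N y = pre N x" using assms(2) by (simp add: pre_eq_iff)
  ultimately have "v x = prepend m' (shift N x)" "v y = prepend m' (shift N y)"
    unfolding affine_def by (metis prepend_pre_shift)+
  then show ?thesis using assms(2,3) by (auto simp: prepend_def shift_def)
qed

definition words :: "nat \<Rightarrow> bool list list" where
  "words N = List.n_lists N [False, True]"

lemma words: "distinct (words N)" "set (words N) = {m. length m = N}"
  by (auto simp: words_def distinct_n_lists set_n_lists)

text \<open>A finite partition into cylinders refines to all words of one length N. Conversely, a
  bijection with one uniform depth is continuous in both directions, and its image words form a
  partition because the cylinders are matched by v. A single number thus replaces the two lists of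
  words.\<close>

lemma ThompsonV_iff:
  "v \<in> ThompsonV \<longleftrightarrow> bij v \<and> (\<exists>N. \<forall>m. length m = N \<longrightarrow> (\<exists>m'. affine v m m'))" (is "?l \<longleftrightarrow> ?r")
proof
  assume ?l
  then obtain ms ms' where b: "bij v" and p: "is_partition ms"
    and a: "\<forall>k < length ms. affine v (ms ! k) (ms' ! k)"
    by (auto simp: ThompsonV_def Homeo_def affine_def)
  \<comment> \<open>The sum of the word lengths is a crude depth that is at least every single
    length.\<close>
  have "\<exists>m'. affine v m m'" if m: "length m = sum_list (map length ms)" for m
  proof -
    obtain k where k: "k < length ms" "prepend m zero_seq \<in> cyl (ms ! k)"
      using p unfolding is_partition_def by metis
    have "length (ms ! k) \<le> sum_list (map length ms)"
      using k(1) by (simp add: member_le_sum_list)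
    with k(2) m obtain t where "m = ms ! k @ t"
      using cyl_append by metis
    with a k show ?thesis using affine_append by blast
  qed
  with b show ?r by blast
next
  assume ?r
  then obtain N where b: "bij v" and N: "\<And>m. length m = N \<Longrightarrow> \<exists>m'. affine v m m'" by blast
  then obtain f where f: "\<And>m. length m = N \<Longrightarrow> affine v m (f m)" by metis
  have c: "cantor_cont v"
    unfolding cantor_cont_def
  proof (intro allI)
    fix x n
    have "\<forall>y. (\<forall>i<N+n. y i = x i) \<longrightarrow> (\<forall>i<n. v y i = v x i)"
      using affine_uniform_cont[OF N] by blast
    then show "\<exists>m. \<forall>y. (\<forall>i<m. y i = x i) \<longrightarrow> (\<forall>i<n. v y i = v x i)" by blast
  qed
  have ci: "cantor_cont (the_inv v)"
    unfolding cantor_cont_def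
  proof (intro allI)
    fix x n
    define z where "z = the_inv v x"
    define p where "p = pre N z"
    have a: "affine v p (f p)" by (simp add: f p_def)
    have x: "x = prepend (f p) (shift N z)"
      using a b by (metis affine_def f_the_inv p_def prepend_pre_shift z_def)
    \<comment> \<open>Near x the inverse exchanges \<open>f p\<close> for \<open>p\<close>: it has
      to recognise the prefix \<open>f p\<close> and then reads at most n letters of the
      tail.\<close>
    have "\<forall>y. (\<forall>i<length (f p) + n. y i = x i) \<longrightarrow> (\<forall>i<n. the_inv v y i = the_inv v x i)"
    proof (intro allI impI)
      fix y i assume y: "\<forall>i<length (f p) + n. y i = x i" and i: "i < n"
      have "pre (length (f p)) y = f p"
        using y x by (metis pre_eq_iff pre_prepend trans_less_add1)
      then have yp: "y = prepend (f p) (shift (length (f p)) y)"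
        by (metis prepend_pre_shift)
      then have "the_inv v y = prepend p (shift (length (f p)) y)"
        using a b by (metis affine_def the_inv_f)
      moreover have "the_inv v x = prepend p (shift N z)"
        by (simp add: p_def flip: z_def)
      moreover have "shift (length (f p)) y i = shift N z i" if "i < n" for i
      proof -
        have "shift (length (f p)) y i = shift (length (f p)) x i" using y that by (simp add: shift_def)
        also have "\<dots> = shift N z i" by (subst x) simp
        finally show ?thesis .
      qed
      ultimately show "the_inv v y i = the_inv v x i" using i by (auto simp: prepend_def)
    qed
    then show "\<exists>m. \<forall>y. (\<forall>i<m. y i = x i) \<longrightarrow> (\<forall>i<n. the_inv v y i = the_inv v x i)" by blast
  qed
  let ?ms = "words N"
  let ?ms' = "map f (words N)"
  have len: "length (?ms ! k) = N" if "k < length ?ms" for k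
    using that words(2) nth_mem by blast
  have p: "\<exists>!k. k < length ?ms \<and> x \<in> cyl (?ms ! k)" for x
  proof -
    have "pre N x \<in> set ?ms" by (simp add: words)
    then obtain k where k: "k < length ?ms" "?ms ! k = pre N x" by (auto simp: in_set_conv_nth)
    show ?thesis
    proof (rule ex1I[of _ k])
      fix l assume "l < length ?ms \<and> x \<in> cyl (?ms ! l)"
      then show "l = k" using k len by (metis cyl_iff nth_eq_iff_index_eq words(1))
    qed (simp add: k)
  qed
  then have p1: "is_partition ?ms" by (simp add: is_partition_def)
  have *: "x \<in> cyl (?ms' ! k) \<longleftrightarrow> the_inv v x \<in> cyl (?ms ! k)" if "k < length ?ms" for x k
  proof -
    have a: "affine v (?ms ! k) (?ms' ! k)" using f len that by simp
    show ?thesis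
    proof
      assume "x \<in> cyl (?ms' ! k)"
      then obtain y where "x = prepend (?ms' ! k) y" by (rule cylE)
      then show "the_inv v x \<in> cyl (?ms ! k)"
        using affine_inv[OF b a] unfolding affine_def by simp
    next
      assume "the_inv v x \<in> cyl (?ms ! k)"
      then obtain y where "the_inv v x = prepend (?ms ! k) y" by (rule cylE)
      then have "x = v (prepend (?ms ! k) y)" using f_the_inv[OF b, of x] by simp
      then show "x \<in> cyl (?ms' ! k)" using a unfolding affine_def by simp
    qed
  qed
  have p2: "is_partition ?ms'"
    unfolding is_partition_def
  proof
    fix x
    have "(k < length ?ms' \<and> x \<in> cyl (?ms' ! k)) = (k < length ?ms \<and> the_inv v x \<in> cyl (?ms ! k))" for k
      using * by auto
    then show "\<exists>!k. k < length ?ms' \<and> x \<in> cyl (?ms' ! k)" using p[of "the_inv v x"] by presburger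
  qed
  show ?l unfolding ThompsonV_def Homeo_def
  proof (rule CollectI, rule conjI, goal_cases)
    case 2
    show ?case
    proof (rule exI[of _ ?ms], rule exI[of _ ?ms'], intro conjI)
    show "\<forall>k<length ?ms. \<forall>x. v (prepend (?ms ! k) x) = prepend (?ms' ! k) x"
        using f len by (simp add: affine_def)
    qed (use p1 p2 in simp_all)
  qed (use b c ci in simp)
qed

lemma V_bij [simp]: "v \<in> ThompsonV \<Longrightarrow> bij v"
  by (simp add: ThompsonV_iff)

lemma V_id [simp]: "id \<in> ThompsonV"
  unfolding ThompsonV_iff using affine_id by auto

text \<open>The definition by two partitions is symmetric in its two lists, unlike the criterion
  \<open>ThompsonV_iff\<close>, so inverses are taken there.\<close>

lemma V_inv [simp]: assumes "v \<in> ThompsonV" shows "the_inv v \<in> ThompsonV"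
proof -
  from assms obtain ms ms' where v: "v \<in> Homeo" "length ms = length ms'" "is_partition ms" "is_partition ms'"
    "\<forall>k < length ms. affine v (ms ! k) (ms' ! k)"
    by (auto simp: ThompsonV_def affine_def)
  then have "the_inv v \<in> Homeo" "\<forall>k < length ms. affine (the_inv v) (ms' ! k) (ms ! k)"
    by (auto simp: Homeo_def affine_inv)
  with v have "the_inv v \<in> Homeo \<and> (\<exists>ms ms'. length ms = length ms' \<and> is_partition ms \<and> is_partition ms'
      \<and> (\<forall>k < length ms. affine (the_inv v) (ms ! k) (ms' ! k)))"
    by metis
  then show ?thesis by (simp add: ThompsonV_def affine_def)
qed

text \<open>Depth M + N suffices: w consumes M letters, and the N letters left behind its image word
  make that word long enough for v.\<close>

lemma V_comp [simp]: assumes "v \<in> ThompsonV" "w \<in> ThompsonV" shows "v \<circ> w \<in> ThompsonV"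
proof -
  obtain N M where N: "\<forall>m. length m = N \<longrightarrow> (\<exists>m'. affine v m m')"
    and M: "\<forall>m. length m = M \<longrightarrow> (\<exists>m'. affine w m m')"
    using assms by (auto simp: ThompsonV_iff)
  have "\<exists>m'. affine (v \<circ> w) m m'" if m: "length m = M + N" for m
  proof -
    obtain m1 where m1: "affine w (take M m) m1" using M m by force
    then have w: "affine w m (m1 @ drop M m)"
      by (metis affine_append append_take_drop_id)
    let ?k = "m1 @ drop M m"
    obtain k where "affine v (take N ?k) k" using N m by force
    then have "affine v ?k (k @ drop N ?k)" by (metis affine_append append_take_drop_id)
    with w show ?thesis using affine_comp by blast
  qed
  then show ?thesis using assms unfolding ThompsonV_iff using bij_comp by blast
qed

lemma V_affine:
  assumes "v \<in> ThompsonV"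
  obtains N where "\<And>n x. N \<le> n \<Longrightarrow> \<exists>m'. affine v (pre n x) m'"
proof -
  obtain N where N: "\<And>m. length m = N \<Longrightarrow> (\<exists>m'. affine v m m')"
    using assms by (auto simp: ThompsonV_iff)
  have "\<exists>m'. affine v (pre n x) m'" if "N \<le> n" for n x
    using N that by (metis affine_append cyl_le in_cyl_pre length_pre)
  with that show ?thesis by blast
qed

lemma affine_at: "affine v (pre n x) m' \<Longrightarrow> v x = prepend m' (shift n x)"
  by (metis affine_def prepend_pre_shift)

lemma V_comp_assoc_inv: "v \<in> ThompsonV \<Longrightarrow> the_inv v \<circ> (v \<circ> w) = w" "v \<in> ThompsonV \<Longrightarrow> v \<circ> (the_inv v \<circ> w) = w"
  by (auto simp: fun_eq_iff)

section \<open>Slopes: chain rule and locality\<close>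

lemma log_slope_comp:
  assumes "v \<in> ThompsonV" "w \<in> ThompsonV"
  shows "log_slope (v \<circ> w) x = log_slope v (w x) + log_slope w x"
proof -
  obtain N where N: "\<And>n x. N \<le> n \<Longrightarrow> \<exists>m'. affine v (pre n x) m'" using V_affine assms(1) by blast
  obtain M where M: "\<And>n x. M \<le> n \<Longrightarrow> \<exists>m'. affine w (pre n x) m'" using V_affine assms(2) by blast
  obtain m where m: "affine w (pre M x) m" using M by blast
  \<comment> \<open>These N letters survive behind the image word of w, so v is a prefix replacement
    there.\<close>
  let ?t = "pre N (shift M x)"
  have x: "pre (M + N) x = pre M x @ ?t"
    by (rule nth_equalityI) (auto simp: pre_def shift_def nth_append)
  have w: "affine w (pre (M+N) x) (m @ ?t)" using affine_append m x by presburger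
  have "pre (length (m @ ?t)) (w x) = m @ ?t" using affine_at[OF w] by (metis pre_prepend)
  then obtain k where v: "affine v (m @ ?t) k" using N[of "length (m @ ?t)" "w x"] by auto
  have "log_slope w x = int (M + N) - int (length (m @ ?t))"
    using log_slope_eq[OF w] by simp
  moreover have "log_slope v (w x) = int (length (m @ ?t)) - int (length k)"
    using log_slope_eq[OF v] affine_at[OF w] by simp
  moreover have "log_slope (v \<circ> w) x = int (M + N) - int (length k)"
    using log_slope_eq[OF affine_comp[OF w v]] by simp
  ultimately show ?thesis by simp
qed

lemma log_slope_id [simp]: "log_slope id x = 0"
  using log_slope_eq[OF affine_id, of x "[]"] by (simp add: cyl_iff pre_def)

lemma log_slope_inv: assumes "v \<in> ThompsonV" shows "log_slope (the_inv v) x = - log_slope v (the_inv v x)"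
  using log_slope_comp[of v "the_inv v" x] assms by simp

text \<open>Slope one at a fixed point gives an image word of the same length as the chosen prefix
  of x; both are prefixes of x, hence equal.\<close>

lemma id_near:
  assumes "v \<in> ThompsonV" "v x = x" "log_slope v x = 0"
  obtains n where "\<And>y. pre n y = pre n x \<Longrightarrow> v y = y"
proof -
  obtain n m' where n: "affine v (pre n x) m'" using V_affine assms(1) by (metis order_refl)
  have "length m' = n" using log_slope_eq[OF n in_cyl_pre] assms(3) by simp
  moreover have "x = prepend m' (shift n x)" using affine_at[OF n] assms(2) by simp
  ultimately have "m' = pre n x" by (metis pre_prepend)
  with n have "v y = y" if "pre n y = pre n x" for y
    using that by (metis affine_at prepend_pre_shift)
  with that show ?thesis by blast
qed

lemma log_slope_cong:
  assumes "v \<in> ThompsonV" "w \<in> ThompsonV" "\<And>y. pre n y = pre n x \<Longrightarrow> v y = w y"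
  shows "log_slope v x = log_slope w x"
proof -
  obtain N where N: "\<And>n x. N \<le> n \<Longrightarrow> \<exists>m'. affine v (pre n x) m'" using V_affine assms(1) by blast
  then obtain m' where m': "affine v (pre (max N n) x) m'" by fastforce
  have "v (prepend (pre (max N n) x) y) = w (prepend (pre (max N n) x) y)" for y
  proof (rule assms(3))
    show "pre n (prepend (pre (max N n) x) y) = pre n x"
      by (metis length_pre max.cobounded2 pre_prepend take_pre)
  qed
  then have "affine w (pre (max N n) x) m'" using m' by (simp add: affine_def)
  then show ?thesis using log_slope_eq[OF m'] log_slope_eq by simp
qed

section \<open>The dense invariant set Q2\<close>

lemma Q2_iff: "x \<in> Q2 \<longleftrightarrow> (\<exists>n. \<forall>i\<ge>n. \<not> x i)"
  unfolding Q2_def finite_nat_set_iff_bounded by (simp add: Ball_def) (metis not_le)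

lemma prepend_Q2 [simp]: "prepend m y \<in> Q2 \<longleftrightarrow> y \<in> Q2"
  unfolding Q2_iff
proof
  assume "\<exists>n. \<forall>i\<ge>n. \<not> prepend m y i"
  then obtain n where n: "\<And>i. n \<le> i \<Longrightarrow> \<not> prepend m y i" by blast
  have "\<not> y i" if "n \<le> i" for i
    using n[of "i + length m"] that by (simp add: prepend_def)
  then show "\<exists>n. \<forall>i\<ge>n. \<not> y i" by blast
next
  assume "\<exists>n. \<forall>i\<ge>n. \<not> y i"
  then obtain n where n: "\<And>i. n \<le> i \<Longrightarrow> \<not> y i" by blast
  then have "\<not> prepend m y i" if "n + length m \<le> i" for i
    using that by (simp add: prepend_def)
  then show "\<exists>n. \<forall>i\<ge>n. \<not> prepend m y i" by blast
qed

lemma shift_Q2 [simp]: "shift n x \<in> Q2 \<longleftrightarrow> x \<in> Q2"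
  by (metis prepend_Q2 prepend_pre_shift)

lemma zero_Q2 [simp]: "zero_seq \<in> Q2"
  by (simp add: Q2_def zero_seq_def)

lemma V_Q2 [simp]: assumes "v \<in> ThompsonV" shows "v x \<in> Q2 \<longleftrightarrow> x \<in> Q2"
  by (metis V_affine affine_at assms order_refl prepend_Q2 shift_Q2)

lemma Q2_dense: "\<exists>y\<in>Q2. pre n y = pre n x"
  by (metis length_pre pre_prepend prepend_Q2 zero_Q2)

lemma cont_eq:
  assumes "cantor_cont f" "cantor_cont g" "\<And>x. x \<in> Q2 \<Longrightarrow> f x = g x"
  shows "f = g"
proof (rule ext, rule ext)
  fix x i
  obtain n where n: "\<forall>y. (\<forall>j<n. y j = x j) \<longrightarrow> (\<forall>j<Suc i. f y j = f x j)"
    using assms(1) unfolding cantor_cont_def by blast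
  obtain m where m: "\<forall>y. (\<forall>j<m. y j = x j) \<longrightarrow> (\<forall>j<Suc i. g y j = g x j)"
    using assms(2) unfolding cantor_cont_def by blast
  obtain y where y: "y \<in> Q2" "pre (max n m) y = pre (max n m) x" using Q2_dense by blast
  from y(2) have "\<forall>j<n. y j = x j" "\<forall>j<m. y j = x j" by (simp_all add: pre_eq_iff)
  then have "f y i = f x i" "g y i = g x i" using n m by blast+
  with assms(3)[OF y(1)] show "f x i = g x i" by simp
qed

lemma cont_comp: assumes "cantor_cont f" "cantor_cont g" shows "cantor_cont (f \<circ> g)"
  unfolding cantor_cont_def
proof (intro allI)
  fix x n
  obtain m where m: "\<forall>y. (\<forall>i<m. y i = g x i) \<longrightarrow> (\<forall>i<n. f y i = f (g x) i)"
    using assms(1) unfolding cantor_cont_def by blast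
  obtain k where k: "\<forall>y. (\<forall>i<k. y i = x i) \<longrightarrow> (\<forall>i<m. g y i = g x i)"
    using assms(2) unfolding cantor_cont_def by blast
  have "\<forall>y. (\<forall>i<k. y i = x i) \<longrightarrow> (\<forall>i<n. (f \<circ> g) y i = (f \<circ> g) x i)"
    using m k unfolding comp_apply by blast
  then show "\<exists>m. \<forall>y. (\<forall>i<m. y i = x i) \<longrightarrow> (\<forall>i<n. (f \<circ> g) y i = (f \<circ> g) x i)" by blast
qed

lemma V_Homeo: "v \<in> ThompsonV \<Longrightarrow> v \<in> Homeo"
  using ThompsonV_def by blast

lemma V_cont [simp]: "v \<in> ThompsonV \<Longrightarrow> cantor_cont v"
  using V_Homeo Homeo_def by blast

lemma V_faithful:
  assumes "v \<in> ThompsonV" "w \<in> ThompsonV" "\<And>x. x \<in> Q2 \<Longrightarrow> v x = w x"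
  shows "v = w"
  using assms cont_eq V_cont by blast

lemma infinite_Q2_near: "infinite {y \<in> Q2. pre n y = pre n x}"
proof -
  define e where "e j = prepend (pre n x) (\<lambda>i. i = j)" for j
  have "inj e"
  proof (rule injI)
    fix j k assume "e j = e k"
    then have "(\<lambda>i. i = j) = (\<lambda>i. i = k)" by (simp add: e_def)
    then show "j = k" by metis
  qed
  moreover have "(\<lambda>i. i = j) \<in> Q2" for j by (simp add: Q2_def)
  then have "range e \<subseteq> {y \<in> Q2. pre n y = pre n x}"
    unfolding e_def using pre_prepend[of "pre n x"] by auto
  ultimately show ?thesis using infinite_iff_countable_subset by blast
qed

lemma infinite_Q2: "infinite Q2"
  using infinite_Q2_near[of 0 undefined] by (simp add: pre_def)

lemma Q2_avoid: "finite F \<Longrightarrow> \<exists>x\<in>Q2. x \<notin> F"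
  using infinite_Q2 by (meson finite_subset subsetI)

text \<open>Being moved is an open condition by continuity, and every cylinder contains infinitely
  many points of Q2.\<close>

lemma moved_infinite:
  assumes "v \<in> ThompsonV" "v \<noteq> id"
  shows "infinite {x \<in> Q2. v x \<noteq> x}"
proof -
  obtain z where z: "z \<in> Q2" "v z \<noteq> z" using V_faithful[OF assms(1) V_id] assms(2) by auto
  then obtain i where i: "v z i \<noteq> z i" by blast
  obtain n where n: "\<forall>y. (\<forall>j<n. y j = z j) \<longrightarrow> (\<forall>j<Suc i. v y j = v z j)"
    using V_cont[OF assms(1)] unfolding cantor_cont_def by blast
  have "v y \<noteq> y" if "pre (max n (Suc i)) y = pre (max n (Suc i)) z" for y
  proof -
    from that have "\<forall>j<n. y j = z j" "y i = z i" by (simp_all add: pre_eq_iff)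
    with n have "v y i = v z i" "y i = z i" by blast+
    then show ?thesis using i by auto
  qed
  then have "{y \<in> Q2. pre (max n (Suc i)) y = pre (max n (Suc i)) z} \<subseteq> {x \<in> Q2. v x \<noteq> x}" by blast
  then show ?thesis using infinite_Q2_near infinite_super by blast
qed

section \<open>Cylinder swaps and high transitivity on Q2\<close>

definition swp :: "bool list \<Rightarrow> bool list \<Rightarrow> cantor \<Rightarrow> cantor" where
  "swp m n x = (if x \<in> cyl m then prepend n (shift (length m) x)
                else if x \<in> cyl n then prepend m (shift (length n) x) else x)"

text \<open>Equal lengths make the two cylinders equal or disjoint, so the two tests in
  \<open>swp\<close> never conflict, and any third word of that length is left alone.\<close>

lemma swp_props:
  assumes "length m = length n"
  shows swp_V: "swp m n \<in> ThompsonV"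
    and swp_left: "swp m n (prepend m y) = prepend n y"
    and swp_right: "swp m n (prepend n y) = prepend m y"
    and swp_other: "x \<notin> cyl m \<Longrightarrow> x \<notin> cyl n \<Longrightarrow> swp m n x = x"
    and swp_invol: "swp m n (swp m n x) = x"
proof -
  show l: "swp m n (prepend m y) = prepend n y" for y
    by (simp add: swp_def)
  show r: "swp m n (prepend n y) = prepend m y" for y
    using assms by (metis cyl_iff pre_prepend prepend_in_cyl shift_prepend swp_def)
  show o: "x \<notin> cyl m \<Longrightarrow> x \<notin> cyl n \<Longrightarrow> swp m n x = x" for x
    by (simp add: swp_def)
  show i: "swp m n (swp m n x) = x" for x
    using l r o by (metis cylE)
  then have "bij (swp m n)" by (intro o_bij[of "swp m n"]) (auto simp: fun_eq_iff)
  moreover have "\<exists>p'. affine (swp m n) p p'" if "length p = length m" for p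
  proof -
    consider "p = m" | "p = n" | "p \<noteq> m" "p \<noteq> n" by blast
    then show ?thesis
    proof cases
      case 3
      then have "prepend p y \<notin> cyl m" "prepend p y \<notin> cyl n" for y
        using that assms pre_prepend[of p y] unfolding cyl_iff by metis+
      then have "affine (swp m n) p p"
        by (simp add: affine_def o)
      then show ?thesis by blast
    qed (use l r in \<open>auto simp: affine_def\<close>)
  qed
  ultimately show "swp m n \<in> ThompsonV" unfolding ThompsonV_iff by blast
qed

lemma Q2_eventually_zero: assumes "x \<in> Q2" obtains n where "\<And>k. n \<le> k \<Longrightarrow> shift k x = zero_seq"
proof -
  obtain n where "\<And>i. x i \<Longrightarrow> i < n"
    using assms by (auto simp: Q2_def finite_nat_set_iff_bounded)
  then have "shift k x = zero_seq" if "n \<le> k" for k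
    using that by (force simp: shift_def zero_seq_def)
  with that show ?thesis by blast
qed

lemma separate: assumes "finite F" obtains n where "\<And>k y. n \<le> k \<Longrightarrow> y \<in> F \<Longrightarrow> pre k y = pre k x \<Longrightarrow> y = x"
proof -
  have "\<exists>n. \<forall>k\<ge>n. \<forall>y\<in>F. pre k y = pre k x \<longrightarrow> y = x"
    using assms
  proof (induction F)
    case (insert z F)
    then obtain n where n: "\<forall>k\<ge>n. \<forall>y\<in>F. pre k y = pre k x \<longrightarrow> y = x" by blast
    show ?case
    proof (cases "z = x")
      case False
      then obtain i where i: "z i \<noteq> x i" by blast
      have "\<forall>k\<ge>max n (Suc i). \<forall>y\<in>insert z F. pre k y = pre k x \<longrightarrow> y = x"
        using i n by (auto simp: pre_eq_iff)
      then show ?thesis by blast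
    qed (use n in auto)
  qed auto
  with that show ?thesis by blast
qed

text \<open>Points of Q2 have zero tails from some depth on, so swapping the cylinders of two long
  prefixes takes x to y; a still larger depth keeps these cylinders away from F.\<close>

lemma swap_points:
  assumes "x \<in> Q2" "y \<in> Q2" "finite F" "x \<notin> F" "y \<notin> F"
  obtains v where "v \<in> ThompsonV" "v x = y" "\<And>z. z \<in> F \<Longrightarrow> v z = z"
proof -
  obtain a where a: "\<And>k. a \<le> k \<Longrightarrow> shift k x = zero_seq" using Q2_eventually_zero assms(1) by blast
  obtain b where b: "\<And>k. b \<le> k \<Longrightarrow> shift k y = zero_seq" using Q2_eventually_zero assms(2) by blast
  obtain c where c: "\<And>k z. c \<le> k \<Longrightarrow> z \<in> F \<Longrightarrow> pre k z = pre k x \<Longrightarrow> z = x" using separate assms(3) by blast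
  obtain d where d: "\<And>k z. d \<le> k \<Longrightarrow> z \<in> F \<Longrightarrow> pre k z = pre k y \<Longrightarrow> z = y" using separate assms(3) by blast
  let ?k = "max (max a b) (max c d)"
  let ?m = "pre ?k x" and ?n = "pre ?k y"
  have "shift ?k x = zero_seq" "shift ?k y = zero_seq" using a b by auto
  then have e: "x = prepend ?m zero_seq" "y = prepend ?n zero_seq" by (metis prepend_pre_shift)+
  have 2: "swp ?m ?n x = y" by (metis e length_pre swp_left)
  have 3: "swp ?m ?n z = z" if "z \<in> F" for z
    using c[of ?k z] d[of ?k z] that assms by (intro swp_other) (auto simp: cyl_iff)
  show ?thesis using that[of "swp ?m ?n"] swp_V[of ?m ?n] 2 3 by simp
qed

text \<open>High transitivity by induction: if v realises g on F, a swap taking \<open>v x\<close>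
  to \<open>g x\<close> and fixing the images of F corrects the value at the new point.\<close>

lemma V_extend:
  assumes "finite F" "F \<subseteq> Q2" "g ` F \<subseteq> Q2" "inj_on g F"
  obtains v where "v \<in> ThompsonV" "\<And>x. x \<in> F \<Longrightarrow> v x = g x"
proof -
  have "\<exists>v\<in>ThompsonV. \<forall>x\<in>F. v x = g x"
    using assms
  proof (induction F)
    case empty
    then show ?case using V_id by blast
  next
    case (insert x F)
    then obtain v where v: "v \<in> ThompsonV" "\<forall>x\<in>F. v x = g x" by auto
    have "v x \<notin> g ` F"
    proof
      assume "v x \<in> g ` F"
      then obtain y where "y \<in> F" "v x = v y" using v by auto
      then show False using insert.hyps v by (metis V_bij bij_pointE)
    qed
    moreover have "g x \<notin> g ` F" using insert by auto
    ultimately obtain u where u: "u \<in> ThompsonV" "u (v x) = g x" "\<And>z. z \<in> g ` F \<Longrightarrow> u z = z"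
      using swap_points[of "v x" "g x" "g ` F"] insert v by auto
    then show ?case using v by (intro bexI[of _ "u \<circ> v"]) auto
  qed
  with that show ?thesis by blast
qed

lemma V_transitive:
  assumes "x \<in> Q2" "y \<in> Q2" obtains v where "v \<in> ThompsonV" "v x = y"
  using swap_points[OF assms, of "{}"] by blast

section \<open>Slopes, valuations and the normaliser of \<open>V\<close>\<close>

text \<open>The tree pair 0 -> 00, 10 -> 01, 11 -> 1, a standard generator of Thompson's group F up
  to inversion. It fixes 0 with slope 1/2, so its germ generates the germs at 0 of the stabiliser of
  0; \<open>expd\<close> is its inverse.\<close>

definition contr :: "cantor \<Rightarrow> cantor" where
  "contr x = (if \<not> x 0 then prepend [False] x
     else if \<not> x 1 then prepend [False, True] (shift 2 x) else prepend [True] (shift 2 x))"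

definition expd :: "cantor \<Rightarrow> cantor" where
  "expd x = (if \<not> x 0 \<and> \<not> x 1 then shift 1 x
     else if \<not> x 0 then prepend [True, False] (shift 2 x) else prepend [True, True] (shift 1 x))"

lemma prepend_Cons_0 [simp]: "prepend (b # m) x 0 = b"
  by (simp add: prepend_def)

lemma prepend_Cons_Suc [simp]: "prepend (b # m) x (Suc i) = prepend m x i"
  by (simp add: prepend_def)

lemma contr_inverse: "expd (contr x) = x" "contr (expd x) = x"
proof -
  show "expd (contr x) = x"
  proof (rule ext)
    fix i show "expd (contr x) i = x i"
      by (cases i; cases "i - 1") (auto simp: contr_def expd_def shift_def numeral_2_eq_2)
  qed
  show "contr (expd x) = x"
  proof (rule ext)
    fix i show "contr (expd x) i = x i"
      by (cases i; cases "i - 1") (auto simp: contr_def expd_def shift_def numeral_2_eq_2)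
  qed
qed

lemma contr_affine: "affine contr [False] [False, False]"
  by (auto simp: affine_def contr_def prepend_append[of "[False]" "[False]", simplified])

lemma contr_V: "contr \<in> ThompsonV"
  unfolding ThompsonV_iff
proof (intro conjI exI[of _ 2] allI impI)
  show "bij contr" by (rule o_bij[of expd]) (auto simp: contr_inverse)
  fix m :: "bool list" assume "length m = 2"
  then obtain a b where m: "m = [a, b]" by (auto simp: numeral_2_eq_2 length_Suc_conv)
  have *: "shift 2 (prepend [a, b] y) = y" for y
    using shift_prepend[of "[a, b]" y] by (simp add: numeral_2_eq_2)
  show "\<exists>m'. affine contr m m'"
  proof (cases a)
    case True
    then show ?thesis using *
      by (cases b) (auto simp: m affine_def contr_def)
  next
    case False
    then show ?thesis using affine_append[OF contr_affine, of "[b]"] m by auto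
  qed
qed

lemma prepend_False_zero [simp]: "prepend [False] zero_seq = zero_seq"
  by (auto simp: prepend_def zero_seq_def)

lemma contr_zero: "contr zero_seq = zero_seq" "log_slope contr zero_seq = -1"
proof -
  show "contr zero_seq = zero_seq" by (auto simp: contr_def zero_seq_def fun_eq_iff prepend_def)
  show "log_slope contr zero_seq = -1"
    by (subst log_slope_eq[OF contr_affine]) (auto simp: cyl_iff pre_def zero_seq_def)
qed

lemma log_slope_funpow:
  assumes "v \<in> ThompsonV" "v x = x"
  shows "v ^^ n \<in> ThompsonV" "(v ^^ n) x = x" "log_slope (v ^^ n) x = int n * log_slope v x"
proof -
  have "v ^^ n \<in> ThompsonV \<and> (v ^^ n) x = x \<and> log_slope (v ^^ n) x = int n * log_slope v x"
  proof (induction n)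
    case (Suc n)
    then show ?case using assms log_slope_comp[of v "v ^^ n" x] V_comp[of v "v ^^ n"]
      unfolding funpow.simps(2) by (metis comp_apply distrib_right mult_1 of_nat_Suc add.commute)
  qed (use V_id log_slope_id in \<open>simp add: id_def del: V_id log_slope_id\<close>)
  then show "v ^^ n \<in> ThompsonV" "(v ^^ n) x = x" "log_slope (v ^^ n) x = int n * log_slope v x" by auto
qed

text \<open>Conjugating \<open>contr\<close> by an element taking 0 to x transports it to x; the
  slopes of the conjugating element cancel.\<close>

lemma contr_at:
  assumes "x \<in> Q2"
  obtains u where "u \<in> ThompsonV" "u x = x" "log_slope u x = -1"
proof -
  obtain v where v: "v \<in> ThompsonV" "v zero_seq = x" using V_transitive zero_Q2 assms by blast
  let ?u = "v \<circ> contr \<circ> the_inv v"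
  have i: "the_inv v x = zero_seq" using v by auto
  have "log_slope ?u x = log_slope v zero_seq + log_slope contr zero_seq + log_slope (the_inv v) x"
    using v contr_V i by (simp add: log_slope_comp contr_zero)
  also have "\<dots> = -1" using v by (simp add: log_slope_inv i contr_zero)
  finally show ?thesis using that[of ?u] v contr_V by (simp add: i contr_zero)
qed

section \<open>Dyadic valuations and the cocycle p\<close>

lemma dyadic_val_eq:
  assumes "odd a" shows "dyadic_val (of_int a / 2 ^ n) = - int n"
proof -
  have nz: "a \<noteq> 0" using assms by auto
  have "(THE k. \<exists>c b :: int. odd c \<and> odd b \<and> of_int a / 2 ^ n = power_int 2 k * of_int c / (of_int b :: rat)) = - int n"
  proof (rule the_equality)
    have "of_int a / 2 ^ n = power_int 2 (- int n) * of_int a / (of_int 1 :: rat)"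
      by (simp add: power_int_minus field_simps)
    then show "\<exists>c b :: int. odd c \<and> odd b \<and> of_int a / 2 ^ n = power_int 2 (- int n) * of_int c / (of_int b :: rat)"
      using assms odd_one by blast
  next
    fix k assume "\<exists>c b :: int. odd c \<and> odd b \<and> of_int a / 2 ^ n = power_int 2 k * of_int c / (of_int b :: rat)"
    then obtain c b :: int where cb: "odd c" "odd b" and e: "of_int a / 2 ^ n = power_int 2 k * of_int c / (of_int b :: rat)" by blast
    from cb have "b \<noteq> 0" by auto
    \<comment> \<open>After clearing denominators, two products of odd integers differ by a power of
      two, so parity decides. The sign of k + n tells on which side that power stands.\<close>
    show "k = - int n"
    proof (cases "k \<ge> - int n")
      case True
      define j where "j = nat (k + int n)"
      have k: "k = int j - int n" using True by (simp add: j_def)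
      have "(2::rat) powi k = 2 ^ j / 2 ^ n" by (simp add: k power_int_diff)
      with e \<open>b \<noteq> 0\<close> have "of_int (a * b) = (of_int (2 ^ j * c) :: rat)" by (simp add: field_simps)
      then have "a * b = 2 ^ j * c" by (simp only: of_int_eq_iff)
      moreover have "odd (a * b)" using assms cb by simp
      ultimately have "j = 0" by (cases j) auto
      then show ?thesis using k by simp
    next
      case False
      define j where "j = nat (- int n - k)"
      have k: "- k = int n + int j" "j > 0" using False by (simp_all add: j_def)
      have "(2::rat) powi k = inverse (2 powi (- k))" by (simp add: power_int_minus)
      also have "\<dots> = 1 / (2 ^ n * 2 ^ j)" by (simp add: k power_int_add field_simps)
      finally have 1: "(2::rat) powi k * (2 ^ n * 2 ^ j) = 1" by simp
      have 2: "of_int a * of_int b = (2::rat) powi k * 2 ^ n * of_int c" using e \<open>b \<noteq> 0\<close>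
        by (simp add: divide_simps mult_ac)
      have "of_int (2 ^ j * a * b) = 2 ^ j * (of_int a * of_int b :: rat)" by simp
      also have "\<dots> = (2 powi k * (2 ^ n * 2 ^ j)) * of_int c" unfolding 2 by (simp only: mult_ac)
      finally have "of_int (2 ^ j * a * b) = (of_int c :: rat)" unfolding 1 by simp
      then have "2 ^ j * a * b = c" by (simp only: of_int_eq_iff)
      with cb k(2) have False by auto
      then show ?thesis ..
    qed
  qed
  then show ?thesis using nz by (simp add: dyadic_val_def)
qed

text \<open>Pulling out the weight of the last nonzero digit leaves 1 plus even terms, hence an odd
  numerator over \<open>2 ^ Suc L\<close>.\<close>

lemma nu_eq:
  assumes "x L" "\<And>i. L < i \<Longrightarrow> \<not> x i"
  shows "nu x = - int (Suc L)"
proof -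
  let ?S = "{i. i < L \<and> x i}"
  have S: "{i. x i} = insert L ?S" using assms by (auto simp: not_less_iff_gr_or_eq) (metis nat_neq_iff)
  have "cantor_value x = 1 / 2 ^ Suc L + (\<Sum>i\<in>?S. 1 / 2 ^ Suc i)"
    unfolding cantor_value_def S by (subst sum.insert) auto
  also have "(\<Sum>i\<in>?S. 1 / 2 ^ Suc i) = (\<Sum>i\<in>?S. (2::rat) ^ (L - i) / 2 ^ Suc L)"
    by (rule sum.cong) (auto simp: field_simps simp flip: power_add)
  also have "1 / 2 ^ Suc L + \<dots> = of_int (1 + (\<Sum>i\<in>?S. 2 ^ (L - i))) / 2 ^ Suc L"
    by (simp add: sum_divide_distrib add_divide_distrib)
  finally have "nu x = dyadic_val (of_int (1 + (\<Sum>i\<in>?S. 2 ^ (L - i))) / 2 ^ Suc L)"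
    by (simp add: nu_def)
  moreover have "even (\<Sum>i\<in>?S. (2::int) ^ (L - i))"
    by (rule dvd_sum) auto
  ultimately show ?thesis by (subst (asm) dyadic_val_eq) auto
qed

text \<open>A prefix pushes the last nonzero digit back by its length. For y = 0 that digit would
  have to lie in m, which is the source of the finite exceptional set in
  \<open>p_cocycle_finite\<close>.\<close>

lemma nu_prepend:
  assumes "y \<in> Q2" "y \<noteq> zero_seq"
  shows "nu (prepend m y) = nu y - int (length m)"
proof -
  have ne: "{i. y i} \<noteq> {}" and fin: "finite {i. y i}" using assms by (auto simp: Q2_def zero_seq_def)
  define L where "L = Max {i. y i}"
  have L: "y L" "\<And>i. L < i \<Longrightarrow> \<not> y i"
    using Max_in[OF fin ne] Max_ge[OF fin] by (auto simp: L_def simp flip: not_le)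
  have "nu (prepend m y) = - int (Suc (L + length m))"
    by (rule nu_eq) (use L in \<open>auto simp: prepend_def\<close>)
  moreover have "nu y = - int (Suc L)" by (rule nu_eq) (use L in auto)
  ultimately show ?thesis by simp
qed

lemma p_cocycle_comp:
  assumes "v \<in> ThompsonV" "w \<in> ThompsonV"
  shows "p_cocycle (v \<circ> w) x = p_cocycle v x + p_cocycle w (the_inv v x)"
  using assms by (simp add: p_cocycle_def the_inv_comp log_slope_comp)

lemma p_cocycle_id [simp]: "p_cocycle id x = 0"
  by (simp add: p_cocycle_def)

lemma p_cocycle_finite:
  assumes v: "v \<in> ThompsonV"
  shows "finite {x \<in> Q2. p_cocycle v x \<noteq> 0}"
proof -
  obtain N where N: "\<And>n x. N \<le> n \<Longrightarrow> \<exists>m'. affine v (pre n x) m'" using V_affine v by blast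
  have "{x \<in> Q2. p_cocycle v x \<noteq> 0} \<subseteq> (\<lambda>m. v (prepend m zero_seq)) ` set (words N)"
  proof
    fix x assume "x \<in> {x \<in> Q2. p_cocycle v x \<noteq> 0}"
    then have x: "x \<in> Q2" "p_cocycle v x \<noteq> 0" by auto
    define z where "z = the_inv v x"
    obtain m' where m': "affine v (pre N z) m'" using N by blast
    have xz: "x = v z" "z \<in> Q2" using v x by (simp_all add: z_def)
    then have xm: "x = prepend m' (shift N z)" using affine_at m' by blast
    have "shift N z = zero_seq"
    proof (rule ccontr)
      assume nz: "shift N z \<noteq> zero_seq"
      then have "nu x = nu (shift N z) - int (length m')" unfolding xm
        by (rule nu_prepend[rotated]) (simp add: xz)
      moreover have "nu z = nu (shift N z) - int N"
        using nu_prepend[OF _ nz, of "pre N z"] xz by simp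
      moreover have "log_slope v z = int N - int (length m')" using log_slope_eq[OF m'] by simp
      ultimately show False using x(2) by (simp add: p_cocycle_def flip: z_def)
    qed
    then have "z = prepend (pre N z) zero_seq" by (metis prepend_pre_shift)
    then show "x \<in> (\<lambda>m. v (prepend m zero_seq)) ` set (words N)"
      using xz(1) by (intro image_eqI[of _ _ "pre N z"]) (auto simp: words)
  qed
  then show ?thesis by (rule finite_subset) simp
qed

lemma p_cocycle_fix: "v \<in> ThompsonV \<Longrightarrow> v x = x \<Longrightarrow> p_cocycle v x = log_slope v x"
  by (simp add: p_cocycle_def the_inv_eq_iff the_inv_eq)

section \<open>The normaliser of V and its effect on slopes\<close>

lemma NormVD:
  assumes "\<phi> \<in> NormV"
  shows NormV_bij [simp]: "bij \<phi>" and NormV_conj: "v \<in> ThompsonV \<Longrightarrow> \<phi> \<circ> v \<circ> the_inv \<phi> \<in> ThompsonV"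
    and NormV_conj': "v \<in> ThompsonV \<Longrightarrow> the_inv \<phi> \<circ> v \<circ> \<phi> \<in> ThompsonV"
    and NormV_cont: "cantor_cont \<phi>" and NormV_cont_inv: "cantor_cont (the_inv \<phi>)"
proof -
  show b: "bij \<phi>" and "cantor_cont \<phi>" "cantor_cont (the_inv \<phi>)"
    using assms by (auto simp: NormV_def Homeo_def)
  have e: "(\<lambda>v. \<phi> \<circ> v \<circ> the_inv \<phi>) ` ThompsonV = ThompsonV" using assms by (simp add: NormV_def)
  then show "v \<in> ThompsonV \<Longrightarrow> \<phi> \<circ> v \<circ> the_inv \<phi> \<in> ThompsonV" by blast
  show "v \<in> ThompsonV \<Longrightarrow> the_inv \<phi> \<circ> v \<circ> \<phi> \<in> ThompsonV"
  proof -
    assume "v \<in> ThompsonV"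
    then obtain w where w: "w \<in> ThompsonV" "v = \<phi> \<circ> w \<circ> the_inv \<phi>" using e by blast
    then have "the_inv \<phi> \<circ> v \<circ> \<phi> = w" using b by (intro ext) simp
    with w show ?thesis by simp
  qed
qed

lemma NormVI:
  assumes "\<phi> \<in> Homeo" "\<And>v. v \<in> ThompsonV \<Longrightarrow> \<phi> \<circ> v \<circ> the_inv \<phi> \<in> ThompsonV"
    "\<And>v. v \<in> ThompsonV \<Longrightarrow> the_inv \<phi> \<circ> v \<circ> \<phi> \<in> ThompsonV"
  shows "\<phi> \<in> NormV"
proof -
  have b: "bij \<phi>" using assms by (simp add: Homeo_def)
  have "v \<in> (\<lambda>v. \<phi> \<circ> v \<circ> the_inv \<phi>) ` ThompsonV" if "v \<in> ThompsonV" for v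
  proof
    show "v = \<phi> \<circ> (the_inv \<phi> \<circ> v \<circ> \<phi>) \<circ> the_inv \<phi>" using b by (intro ext) simp
  qed (use assms that in blast)
  then show ?thesis using assms by (auto simp: NormV_def)
qed

lemma StabN_iff: "\<phi> \<in> StabN \<longleftrightarrow> \<phi> \<in> NormV \<and> (\<forall>x. \<phi> x \<in> Q2 \<longleftrightarrow> x \<in> Q2)"
proof
  assume "\<phi> \<in> StabN"
  then have n: "\<phi> \<in> NormV" and "\<phi> ` Q2 = Q2" by (auto simp: StabN_def)
  then show "\<phi> \<in> NormV \<and> (\<forall>x. \<phi> x \<in> Q2 \<longleftrightarrow> x \<in> Q2)"
    using NormV_bij[OF n] by (metis bij_is_inj image_eqI inj_image_mem_iff)
next
  assume a: "\<phi> \<in> NormV \<and> (\<forall>x. \<phi> x \<in> Q2 \<longleftrightarrow> x \<in> Q2)"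
  then have b: "bij \<phi>" by simp
  have "x \<in> \<phi> ` Q2" if "x \<in> Q2" for x
    using a that f_the_inv[OF b, of x] by (metis imageI)
  moreover have "\<phi> ` Q2 \<subseteq> Q2" using a by blast
  ultimately have "\<phi> ` Q2 = Q2" by blast
  then show "\<phi> \<in> StabN" using a by (simp add: StabN_def)
qed

lemma StabN_NormV: "\<phi> \<in> StabN \<Longrightarrow> \<phi> \<in> NormV"
  by (simp add: StabN_iff)

lemma StabN_bij [simp]: "\<phi> \<in> StabN \<Longrightarrow> bij \<phi>"
  by (simp add: StabN_iff)

lemma StabN_Q2 [simp]: "\<phi> \<in> StabN \<Longrightarrow> \<phi> x \<in> Q2 \<longleftrightarrow> x \<in> Q2"
  by (simp add: StabN_iff)

lemma StabN_inv_Q2 [simp]: "\<phi> \<in> StabN \<Longrightarrow> the_inv \<phi> x \<in> Q2 \<longleftrightarrow> x \<in> Q2"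
  by (metis StabN_Q2 StabN_bij f_the_inv)

lemma StabN_conj [simp]:
  assumes "\<phi> \<in> StabN" "v \<in> ThompsonV"
  shows "\<phi> \<circ> v \<circ> the_inv \<phi> \<in> ThompsonV" "the_inv \<phi> \<circ> v \<circ> \<phi> \<in> ThompsonV"
  using NormV_conj NormV_conj' StabN_NormV assms by blast+

lemma StabN_id [simp]: "id \<in> StabN"
  unfolding StabN_iff by (auto intro!: NormVI V_Homeo)

lemma StabN_comp [simp]: assumes "\<phi> \<in> StabN" "\<psi> \<in> StabN" shows "\<phi> \<circ> \<psi> \<in> StabN"
proof -
  note n = StabN_NormV[OF assms(1)] StabN_NormV[OF assms(2)]
  have b: "bij \<phi>" "bij \<psi>" using assms by auto
  have i: "the_inv (\<phi> \<circ> \<psi>) = the_inv \<psi> \<circ> the_inv \<phi>" using b by (rule the_inv_comp)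
  have "\<phi> \<circ> \<psi> \<in> Homeo"
    unfolding Homeo_def mem_Collect_eq i
    by (intro conjI cont_comp bij_comp b n NormV_cont NormV_cont_inv)
  moreover have "(\<phi> \<circ> \<psi>) \<circ> v \<circ> the_inv (\<phi> \<circ> \<psi>) \<in> ThompsonV" if "v \<in> ThompsonV" for v
    using NormV_conj[OF n(1) NormV_conj[OF n(2) that]] by (simp add: i comp_assoc)
  moreover have "the_inv (\<phi> \<circ> \<psi>) \<circ> v \<circ> (\<phi> \<circ> \<psi>) \<in> ThompsonV" if "v \<in> ThompsonV" for v
    using NormV_conj'[OF n(2) NormV_conj'[OF n(1) that]] by (simp add: i comp_assoc)
  ultimately have "\<phi> \<circ> \<psi> \<in> NormV" using NormVI by blast
  then show ?thesis using assms by (simp add: StabN_iff)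
qed

lemma conj_cancel:
  assumes "bij \<phi>"
  shows "the_inv \<phi> \<circ> (\<phi> \<circ> v \<circ> the_inv \<phi>) \<circ> \<phi> = v" "\<phi> \<circ> (the_inv \<phi> \<circ> v \<circ> \<phi>) \<circ> the_inv \<phi> = v"
  using assms by (intro ext, simp)+

lemma conj_comp:
  assumes "bij \<phi>"
  shows "\<phi> \<circ> (v \<circ> w) \<circ> the_inv \<phi> = (\<phi> \<circ> v \<circ> the_inv \<phi>) \<circ> (\<phi> \<circ> w \<circ> the_inv \<phi>)"
    "the_inv \<phi> \<circ> (v \<circ> w) \<circ> \<phi> = (the_inv \<phi> \<circ> v \<circ> \<phi>) \<circ> (the_inv \<phi> \<circ> w \<circ> \<phi>)"
  using assms by (intro ext, simp)+

lemma conj_funpow: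
  fixes \<phi> :: "'a \<Rightarrow> 'a"
  assumes "bij \<phi>"
  shows "the_inv \<phi> \<circ> (v ^^ n) \<circ> \<phi> = (the_inv \<phi> \<circ> v \<circ> \<phi>) ^^ n"
proof (induction n)
  case (Suc n)
  then show ?case by (simp only: funpow.simps conj_comp(2)[OF assms, of v "v ^^ n"])
qed (use assms in \<open>auto simp: fun_eq_iff\<close>)

lemma cont_pre:
  assumes "cantor_cont f"
  obtains k where "\<And>y. pre k y = pre k x \<Longrightarrow> pre n (f y) = pre n (f x)"
  using assms unfolding cantor_cont_def pre_eq_iff by blast

text \<open>At slope 1/2 the image word is one letter longer than the prefix of z, so each
  application of v makes one more digit agree with z.\<close>

lemma attracting:
  assumes "v \<in> ThompsonV" "v z = z" "log_slope v z = -1"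
  obtains n where "\<And>j y. pre n y = pre n z \<Longrightarrow> pre (n + j) ((v ^^ j) y) = pre (n + j) z"
proof -
  obtain n m' where a: "affine v (pre n z) m'" using V_affine assms(1) by (metis order_refl)
  have m: "length m' = Suc n" using log_slope_eq[OF a in_cyl_pre] assms(3) by simp
  have z: "z = prepend m' (shift n z)" using affine_at[OF a] assms(2) by simp
  have step: "pre (n + Suc j) (v y) = pre (n + Suc j) z" if y: "pre (n + j) y = pre (n + j) z" for y j
  proof -
    have "pre n y = pre n z" using y by (simp add: pre_eq_iff)
    with a have vy: "v y = prepend m' (shift n y)" by (metis affine_at)
    have "v y i = z i" if "i < n + Suc j" for i
      unfolding vy using that y fun_cong[OF z, of i] by (auto simp: prepend_def m shift_def pre_eq_iff)
    then show ?thesis by (simp add: pre_eq_iff)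
  qed
  have "pre (n + j) ((v ^^ j) y) = pre (n + j) z" if "pre n y = pre n z" for y j
    by (induction j) (use that step in auto)
  with that show ?thesis by blast
qed

text \<open>Conjugation by \<open>\<phi>\<close> maps the infinite cyclic group of germs at \<open>z\<close> of the stabiliser of
  \<open>z\<close> onto the one at \<open>\<phi>\<^sup>-\<^sup>1 z\<close>, so it preserves slopes up to a sign; the sign is positive
  because attracting fixed points are a topological notion.\<close>

lemma conj_log_slope:
  assumes \<phi>: "\<phi> \<in> StabN" and z: "z \<in> Q2" and u: "u \<in> ThompsonV" "u z = z"
  shows "log_slope (the_inv \<phi> \<circ> u \<circ> \<phi>) (the_inv \<phi> z) = log_slope u z"
proof -
  have b: "bij \<phi>" using \<phi> by simp
  note nv = StabN_NormV[OF \<phi>]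
  define w where "w = the_inv \<phi> z"
  have \<phi>w: "\<phi> w = z" and w: "w \<in> Q2" using b \<phi> z by (simp_all add: w_def)
  define C where "C u = the_inv \<phi> \<circ> u \<circ> \<phi>" for u
  have C: "C u \<in> ThompsonV" if "u \<in> ThompsonV" for u using that \<phi> by (simp add: C_def)
  have Cw: "C u w = w" if "u z = z" for u using that unfolding C_def comp_apply \<phi>w by (simp add: w_def)
  define h where "h u = log_slope (C u) w" for u
  have h_comp: "h (u \<circ> v) = h u + h v" if "u \<in> ThompsonV" "v \<in> ThompsonV" "v z = z" for u v
    unfolding h_def using log_slope_comp[OF C C, of u v w] Cw that conj_comp(2)[OF b, of u v]
    by (simp add: C_def)
  \<comment> \<open>u is the identity on a cylinder around z, and continuity of \<phi> pulls this
    cylinder back to a neighbourhood of w.\<close>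
  have h_triv: "h u = 0" if uV: "u \<in> ThompsonV" and uz: "u z = z" "log_slope u z = 0" for u
  proof -
    obtain n where n: "\<And>y. pre n y = pre n z \<Longrightarrow> u y = y" using id_near uV uz by blast
    obtain k where k: "\<And>y. pre k y = pre k w \<Longrightarrow> pre n (\<phi> y) = pre n (\<phi> w)"
      using cont_pre NormV_cont[OF nv] by blast
    have "log_slope (C u) w = log_slope id w"
    proof (rule log_slope_cong)
      fix y assume "pre k y = pre k w"
      then have "u (\<phi> y) = \<phi> y" using n k \<phi>w by simp
      then show "C u y = id y" using b by (simp add: C_def)
    qed (use C uV in auto)
    then show ?thesis by (simp add: h_def)
  qed
  \<comment> \<open>The germ of c generates the germs at z of the stabiliser of z, so the single
    integer k determines h.\<close>
  obtain c where c: "c \<in> ThompsonV" "c z = z" "log_slope c z = -1" using contr_at z by blast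
  define k where "k = h c"
  have h_pow: "h (c ^^ n) = int n * k" for n
    unfolding h_def k_def C_def conj_funpow[OF b]
    using log_slope_funpow(3)[OF C[OF c(1)] Cw[of c, OF c(2)]] by (simp only: C_def)
  have nonneg: "h u = - log_slope u z * k" if uV: "u \<in> ThompsonV" and uz: "u z = z" "log_slope u z \<ge> 0" for u
  proof -
    let ?n = "nat (log_slope u z)"
    note cn = log_slope_funpow[OF c(1,2), of ?n]
    have "log_slope (u \<circ> c ^^ ?n) z = 0"
      using log_slope_comp[OF uV cn(1), of z] cn(2,3) c(3) uz by simp
    then have "h (u \<circ> c ^^ ?n) = 0" using h_triv[of "u \<circ> c ^^ ?n"] uV cn(1,2) uz by simp
    moreover have "h (u \<circ> c ^^ ?n) = h u + h (c ^^ ?n)" by (rule h_comp[OF uV cn(1,2)])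
    ultimately show ?thesis using h_pow[of ?n] uz by simp
  qed
  have all: "h u = - log_slope u z * k" if uV: "u \<in> ThompsonV" and uz: "u z = z" for u
  proof (cases "log_slope u z \<ge> 0")
    case False
    have iz: "the_inv u z = z" using uV uz by (simp add: the_inv_eq)
    then have s: "log_slope (the_inv u) z = - log_slope u z" using log_slope_inv[OF uV] by simp
    have "h (the_inv u) = log_slope u z * k" using nonneg[of "the_inv u"] s iz False uV by simp
    moreover have "h (the_inv u \<circ> u) = h (the_inv u) + h u" using uV uz by (intro h_comp) auto
    moreover have "h id = 0" by (rule h_triv) auto
    ultimately show ?thesis using uV by simp
  qed (use nonneg that in auto)
  \<comment> \<open>If k = 1, the conjugate g of c expands at w while c contracts at z. Powers of c
    bring \<open>\<phi> y\<close> close to z, hence powers of g bring y close to w; undoing them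
    with the contraction \<open>the_inv g\<close> gives points still closer to w, although the
    result is y itself.\<close>
  have "k \<noteq> 1"
  proof
    assume "k = 1"
    define g where "g = C c"
    have g: "g \<in> ThompsonV" "g w = w" using C Cw c by (auto simp: g_def)
    have gi: "the_inv g \<in> ThompsonV" "the_inv g w = w" "log_slope (the_inv g) w = -1"
      using g \<open>k = 1\<close> log_slope_inv[OF g(1), of w] by (auto simp: k_def h_def the_inv_eq simp flip: g_def)
    obtain n where n: "\<And>j y. pre n y = pre n z \<Longrightarrow> pre (n + j) ((c ^^ j) y) = pre (n + j) z"
      using attracting c by blast
    obtain m where m: "\<And>j y. pre m y = pre m w \<Longrightarrow> pre (m + j) ((the_inv g ^^ j) y) = pre (m + j) w"
      using attracting gi by blast
    obtain k where k: "\<And>y. pre k y = pre k w \<Longrightarrow> pre n (\<phi> y) = pre n (\<phi> w)"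
      using cont_pre NormV_cont[OF nv] by blast
    obtain l where l: "\<And>y. pre l y = pre l z \<Longrightarrow> pre m (the_inv \<phi> y) = pre m (the_inv \<phi> z)"
      using cont_pre NormV_cont_inv[OF nv] by blast
    obtain y where y: "y \<noteq> w" "pre k y = pre k w"
    proof -
      have "\<not> {y \<in> Q2. pre k y = pre k w} \<subseteq> {w}"
        using infinite_Q2_near[of k w] finite_subset by blast
      with that show ?thesis by blast
    qed
    then obtain i where i: "y i \<noteq> w i" by blast
    \<comment> \<open>Large enough to pass both the depth l and the digit i at which y and w
      differ.\<close>
    define j where "j = max l (Suc i)"
    have "pre (n + j) ((c ^^ j) (\<phi> y)) = pre (n + j) z" using n k y \<phi>w by simp
    then have "pre l ((c ^^ j) (\<phi> y)) = pre l z" by (simp add: pre_eq_iff j_def)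
    then have "pre m (the_inv \<phi> ((c ^^ j) (\<phi> y))) = pre m w" using l unfolding w_def by blast
    moreover have "the_inv \<phi> ((c ^^ j) (\<phi> y)) = (g ^^ j) y"
      using fun_cong[OF conj_funpow[OF b, of j c], of y] unfolding g_def C_def comp_apply .
    ultimately have "pre (m + j) ((the_inv g ^^ j) ((g ^^ j) y)) = pre (m + j) w" using m by simp
    moreover have "(the_inv g ^^ j) ((g ^^ j) y) = y"
    proof (induction j)
      case (Suc j)
      then show ?case using g(1) by (subst funpow_Suc_right) simp
    qed simp
    ultimately have "pre (m + j) y = pre (m + j) w" by simp
    then show False using i by (auto simp: pre_eq_iff j_def)
  qed
  \<comment> \<open>A contracting element at w, carried over to z by \<phi>, exhibits -1 as an
    integer multiple of k, so k is a unit.\<close>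
  obtain d where d: "d \<in> ThompsonV" "d w = w" "log_slope d w = -1" using contr_at w by blast
  define e where "e = \<phi> \<circ> d \<circ> the_inv \<phi>"
  have "e \<in> ThompsonV" using d \<phi> by (simp add: e_def)
  moreover have "e z = z" unfolding e_def comp_apply w_def[symmetric] by (simp add: d \<phi>w)
  moreover have "C e = d" using conj_cancel(1)[OF b, of d] by (simp add: e_def C_def)
  ultimately have "log_slope e z * k = 1" using all[of e] d(3) by (simp add: h_def)
  then have "k = 1 \<or> k = -1" by (auto simp: zmult_eq_1_iff)
  with \<open>k \<noteq> 1\<close> have "k = -1" by blast
  then show ?thesis using all[OF u] by (simp add: h_def C_def w_def)
qed

text \<open>Two elements taking 0 to x differ by some u fixing 0, and \<open>conj_log_slope\<close>
  makes the contribution of u to the two slopes cancel. This removes the \<open>SOME\<close> from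
  \<open>mu\<close>.\<close>

lemma mu_eq:
  assumes \<phi>: "\<phi> \<in> StabN" and v: "v \<in> ThompsonV" "v zero_seq = x"
  shows "mu \<phi> x = log_slope (the_inv \<phi> \<circ> v \<circ> \<phi>) (the_inv \<phi> zero_seq) - log_slope v zero_seq
      - nu (the_inv \<phi> x) + nu x"
proof -
  have b: "bij \<phi>" using \<phi> by simp
  define w where "w = (SOME v. v \<in> ThompsonV \<and> v zero_seq = x)"
  have w: "w \<in> ThompsonV" "w zero_seq = x" using someI[of "\<lambda>v. v \<in> ThompsonV \<and> v zero_seq = x"] v
    by (auto simp: w_def)
  define u where "u = the_inv w \<circ> v"
  have u: "u \<in> ThompsonV" "u zero_seq = zero_seq" and vw: "v = w \<circ> u"
    using v w by (auto simp: u_def the_inv_eq V_comp_assoc_inv)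
  have 1: "log_slope v zero_seq = log_slope w zero_seq + log_slope u zero_seq"
    using log_slope_comp[OF w(1) u(1)] u(2) vw by simp
  have 2: "(the_inv \<phi> \<circ> u \<circ> \<phi>) (the_inv \<phi> zero_seq) = the_inv \<phi> zero_seq"
    using b u by simp
  have "log_slope (the_inv \<phi> \<circ> v \<circ> \<phi>) (the_inv \<phi> zero_seq)
    = log_slope (the_inv \<phi> \<circ> w \<circ> \<phi>) (the_inv \<phi> zero_seq) + log_slope u zero_seq"
    unfolding vw conj_comp(2)[OF b]
    by (subst log_slope_comp) (use \<phi> w u in \<open>simp_all only: StabN_conj 2 conj_log_slope zero_Q2\<close>)
  then show ?thesis unfolding mu_def Let_def w_def[symmetric] using 1 by simp
qed

text \<open>With w taking 0 to \<open>the_inv v x\<close>, the values of \<open>mu\<close> at that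
  point and at x can be computed from w and v o w. The chain rule then cancels all slopes at 0 and
  at its preimage under \<phi>.\<close>

lemma p_cocycle_conj:
  assumes \<phi>: "\<phi> \<in> StabN" and v: "v \<in> ThompsonV" and x: "x \<in> Q2"
  shows "p_cocycle (the_inv \<phi> \<circ> v \<circ> \<phi>) (the_inv \<phi> x) = p_cocycle v x + mu \<phi> x - mu \<phi> (the_inv v x)"
proof -
  have b: "bij \<phi>" using \<phi> by simp
  obtain w where w: "w \<in> ThompsonV" "w zero_seq = the_inv v x"
    using V_transitive[of zero_seq "the_inv v x"] v x by auto
  have vw: "v \<circ> w \<in> ThompsonV" "(v \<circ> w) zero_seq = x" using v w by auto
  let ?C = "\<lambda>v. the_inv \<phi> \<circ> v \<circ> \<phi>"
  have i: "the_inv (?C v) (the_inv \<phi> x) = the_inv \<phi> (the_inv v x)"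
    using \<phi> v b by (intro the_inv_eq) (auto intro: V_bij StabN_conj)
  have c: "?C w (the_inv \<phi> zero_seq) = the_inv \<phi> (the_inv v x)" using b w by simp
  have "log_slope (?C (v \<circ> w)) (the_inv \<phi> zero_seq)
      = log_slope (?C v) (the_inv \<phi> (the_inv v x)) + log_slope (?C w) (the_inv \<phi> zero_seq)"
    unfolding conj_comp(2)[OF b] c[symmetric] by (rule log_slope_comp) (use \<phi> v w in auto)
  moreover have "log_slope (v \<circ> w) zero_seq = log_slope v (the_inv v x) + log_slope w zero_seq"
    using log_slope_comp[OF v w(1)] w(2) by simp
  ultimately show ?thesis
    unfolding mu_eq[OF \<phi> vw] mu_eq[OF \<phi> w] p_cocycle_def i by simp
qed

section \<open>The wreath product and the maps \<open>E_\<zeta> \<circ> ad(f) \<circ> A_{\<phi>,\<beta>}\<close>\<close>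

locale coeff_group = group \<Gamma> for \<Gamma> :: "'g monoid" (structure)
begin

abbreviation G where "G \<equiv> Gw \<Gamma>"

lemma KbarI: "(\<And>x. x \<in> Q2 \<Longrightarrow> a x \<in> carrier \<Gamma>) \<Longrightarrow> (\<And>x. x \<notin> Q2 \<Longrightarrow> a x = \<one>) \<Longrightarrow> a \<in> Kbar \<Gamma>"
  unfolding Kbar_def by blast

lemma Kbar_closed [simp]: "a \<in> Kbar \<Gamma> \<Longrightarrow> a x \<in> carrier \<Gamma>"
  by (cases "x \<in> Q2") (simp_all add: Kbar_def)

lemma Kbar_off [simp]: "a \<in> Kbar \<Gamma> \<Longrightarrow> x \<notin> Q2 \<Longrightarrow> a x = \<one>"
  unfolding Kbar_def by blast

lemma Kfin_Kbar: "a \<in> Kfin \<Gamma> \<Longrightarrow> a \<in> Kbar \<Gamma>"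
  unfolding Kfin_def by blast

lemma Kfin_closed [simp]: "a \<in> Kfin \<Gamma> \<Longrightarrow> a x \<in> carrier \<Gamma>"
  by (simp add: Kfin_Kbar)

lemma Kfin_off [simp]: "a \<in> Kfin \<Gamma> \<Longrightarrow> x \<notin> Q2 \<Longrightarrow> a x = \<one>"
  by (simp add: Kfin_Kbar)

lemma Kfin_finite: "a \<in> Kfin \<Gamma> \<Longrightarrow> finite {x. a x \<noteq> \<one>}"
  unfolding Kfin_def by blast

lemma KfinI:
  assumes "\<And>x. x \<in> Q2 \<Longrightarrow> a x \<in> carrier \<Gamma>" "\<And>x. x \<notin> Q2 \<Longrightarrow> a x = \<one>"
    "finite F" "\<And>x. x \<in> Q2 \<Longrightarrow> x \<notin> F \<Longrightarrow> a x = \<one>"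
  shows "a \<in> Kfin \<Gamma>"
proof -
  have "{x. a x \<noteq> \<one>} \<subseteq> F" using assms(2,4) by blast
  then have "finite {x. a x \<noteq> \<one>}" using assms(3) by (rule finite_subset)
  moreover have "a \<in> Kbar \<Gamma>" using assms(1,2) by (rule KbarI)
  ultimately show ?thesis unfolding Kfin_def by blast
qed

lemma kone_Kfin [simp]: "kone \<Gamma> \<in> Kfin \<Gamma>"
  by (rule KfinI[of _ "{}"]) (auto simp: kone_def)

lemma Kfin_mult [simp]: "a \<in> Kfin \<Gamma> \<Longrightarrow> b \<in> Kfin \<Gamma> \<Longrightarrow> (\<lambda>x. a x \<otimes> b x) \<in> Kfin \<Gamma>"
  by (rule KfinI[of _ "{x. a x \<noteq> \<one>} \<union> {x. b x \<noteq> \<one>}"]) (auto simp: Kfin_finite)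

lemma Kfin_inverse [simp]: "a \<in> Kfin \<Gamma> \<Longrightarrow> (\<lambda>x. inv (a x)) \<in> Kfin \<Gamma>"
  by (rule KfinI[of _ "{x. a x \<noteq> \<one>}"]) (auto simp: Kfin_finite)

lemma Kfin_act [simp]: 
  assumes "a \<in> Kfin \<Gamma>" "v \<in> ThompsonV" shows "(\<lambda>x. a (the_inv v x)) \<in> Kfin \<Gamma>"
proof (rule KfinI[of _ "v ` {x. a x \<noteq> \<one>}"])
  fix x assume "x \<notin> v ` {x. a x \<noteq> \<one>}"
  moreover have "x = v (the_inv v x)" using assms(2) by simp
  ultimately show "a (the_inv v x) = \<one>" by blast
next
  show "finite (v ` {x. a x \<noteq> \<one>})" using assms(1) by (intro finite_imageI Kfin_finite)
qed (use assms in simp_all)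

lemma Kfin_act': 
  assumes "a \<in> Kfin \<Gamma>" "v \<in> ThompsonV" shows "(\<lambda>x. a (v x)) \<in> Kfin \<Gamma>"
  using Kfin_act[of a "the_inv v"] assms by simp

lemma carrier_G: "carrier G = Kfin \<Gamma> \<times> ThompsonV"
  by (simp add: wreath_def)

lemma in_G [simp]: "(a, v) \<in> carrier G \<longleftrightarrow> a \<in> Kfin \<Gamma> \<and> v \<in> ThompsonV"
  by (simp add: carrier_G)

lemma mult_G [simp]: "(a, v) \<otimes>\<^bsub>G\<^esub> (b, w) = (\<lambda>x. a x \<otimes> b (the_inv v x), v \<circ> w)"
  by (simp add: wreath_def kmul_def)

lemma one_G: "\<one>\<^bsub>G\<^esub> = (kone \<Gamma>, id)"
  by (simp add: wreath_def)

lemma group_G: "group G"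
proof (rule groupI)
  fix g h assume "g \<in> carrier G" "h \<in> carrier G"
  then show "g \<otimes>\<^bsub>G\<^esub> h \<in> carrier G" by (cases g; cases h) simp
next
  fix g h k assume "g \<in> carrier G" "h \<in> carrier G" "k \<in> carrier G"
  then show "g \<otimes>\<^bsub>G\<^esub> h \<otimes>\<^bsub>G\<^esub> k = g \<otimes>\<^bsub>G\<^esub> (h \<otimes>\<^bsub>G\<^esub> k)"
    by (cases g; cases h; cases k) (auto simp: the_inv_comp m_assoc comp_assoc)
next
  fix g assume "g \<in> carrier G"
  then show "\<one>\<^bsub>G\<^esub> \<otimes>\<^bsub>G\<^esub> g = g" by (cases g) (simp add: one_G kone_def)
next
  fix g assume "g \<in> carrier G"
  then obtain a v where g: "g = (a, v)" "a \<in> Kfin \<Gamma>" "v \<in> ThompsonV" by (cases g) auto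
  show "\<exists>h\<in>carrier G. h \<otimes>\<^bsub>G\<^esub> g = \<one>\<^bsub>G\<^esub>"
    by (rule bexI[of _ "(\<lambda>x. inv (a (v x)), the_inv v)"]) (use g Kfin_act'[of "\<lambda>x. inv (a x)" v] in \<open>simp_all add: one_G kone_def\<close>)
qed (simp add: one_G)

lemma inv_G: "a \<in> Kfin \<Gamma> \<Longrightarrow> v \<in> ThompsonV \<Longrightarrow> inv\<^bsub>G\<^esub> (a, v) = (\<lambda>x. inv (a (v x)), the_inv v)"
  using Kfin_act'[of "\<lambda>x. inv (a x)" v]
  by (intro group.inv_equality[OF group_G]) (simp_all add: one_G kone_def)

section \<open>Conjugation by elements of Kbar\<close>

lemma adK_eq: "v \<in> ThompsonV \<Longrightarrow> adK \<Gamma> f (a, v) = (\<lambda>x. f x \<otimes> a x \<otimes> inv (f (the_inv v x)), v)"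
  by (simp add: adK_def wreath_def kmul_def)

lemma mult_cancel_left [simp]:
  assumes "x \<in> carrier \<Gamma>" "y \<in> carrier \<Gamma>"
  shows "inv x \<otimes> (x \<otimes> y) = y" "x \<otimes> (inv x \<otimes> y) = y"
  using assms by (simp_all flip: m_assoc)

lemma mult_inv_eq_one: "a \<in> carrier \<Gamma> \<Longrightarrow> b \<in> carrier \<Gamma> \<Longrightarrow> a \<otimes> inv b = \<one> \<longleftrightarrow> a = b"
  by (metis inv_closed inv_equality inv_inv r_inv)

text \<open>Conjugating v by f multiplies it by f times the inverse of its translate under v, so
  normalising G means that f differs from each translate at finitely many points.\<close>

lemma NKbar_iff:
  "f \<in> NKbar \<Gamma> \<longleftrightarrow> f \<in> Kbar \<Gamma> \<and> (\<forall>v\<in>ThompsonV. finite {x \<in> Q2. f x \<noteq> f (the_inv v x)})"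
proof (intro iffI conjI ballI)
  assume f: "f \<in> NKbar \<Gamma>"
  then show fK: "f \<in> Kbar \<Gamma>" unfolding NKbar_def by blast
  fix v assume v: "v \<in> ThompsonV"
  then have "adK \<Gamma> f (kone \<Gamma>, v) \<in> carrier G" using f unfolding NKbar_def
    by (metis (mono_tags, lifting) image_eqI in_G kone_Kfin mem_Collect_eq)
  then have "(\<lambda>x. f x \<otimes> \<one> \<otimes> inv (f (the_inv v x))) \<in> Kfin \<Gamma>" using v by (simp add: adK_eq kone_def)
  from Kfin_finite[OF this] show "finite {x \<in> Q2. f x \<noteq> f (the_inv v x)}"
    by (rule rev_finite_subset) (use fK in \<open>auto simp: mult_inv_eq_one\<close>)
next
  assume a: "f \<in> Kbar \<Gamma> \<and> (\<forall>v\<in>ThompsonV. finite {x \<in> Q2. f x \<noteq> f (the_inv v x)})"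
  then have fK: "f \<in> Kbar \<Gamma>" by simp
  have "adK \<Gamma> f g \<in> carrier G" if g: "g \<in> carrier G" for g
  proof -
    obtain b v where bv: "g = (b, v)" "b \<in> Kfin \<Gamma>" "v \<in> ThompsonV" using g by (cases g) auto
    have "(\<lambda>x. f x \<otimes> b x \<otimes> inv (f (the_inv v x))) \<in> Kfin \<Gamma>"
      by (rule KfinI[of _ "{x. b x \<noteq> \<one>} \<union> {x \<in> Q2. f x \<noteq> f (the_inv v x)}"])
        (use bv a in \<open>auto simp: Kfin_finite\<close>)
    then show ?thesis using bv by (simp add: adK_eq)
  qed
  moreover have "g \<in> adK \<Gamma> f ` carrier G" if g: "g \<in> carrier G" for g
  proof -
    obtain b v where bv: "g = (b, v)" "b \<in> Kfin \<Gamma>" "v \<in> ThompsonV" using g by (cases g) auto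
    \<comment> \<open>The preimage is found by solving the conjugation formula for its middle
      factor.\<close>
    let ?c = "\<lambda>x. inv (f x) \<otimes> b x \<otimes> f (the_inv v x)"
    have c: "?c \<in> Kfin \<Gamma>"
    proof (rule KfinI[of _ "{x. b x \<noteq> \<one>} \<union> {x \<in> Q2. f x \<noteq> f (the_inv v x)}"])
      fix x assume "x \<in> Q2" "x \<notin> {x. b x \<noteq> \<one>} \<union> {x \<in> Q2. f x \<noteq> f (the_inv v x)}"
      then have "b x = \<one>" "f (the_inv v x) = f x" by auto
      then show "?c x = \<one>" using fK by simp
    qed (use bv a in \<open>auto simp: Kfin_finite\<close>)
    have "adK \<Gamma> f (?c, v) = g"
      using bv fK by (simp add: adK_eq m_assoc)
    with c bv show ?thesis by (intro image_eqI[of _ _ "(?c, v)"]) auto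
  qed
  ultimately show "f \<in> NKbar \<Gamma>" using fK unfolding NKbar_def by blast
qed

lemma NKbar_Kbar: "f \<in> NKbar \<Gamma> \<Longrightarrow> f \<in> Kbar \<Gamma>"
  unfolding NKbar_def by blast

lemma NKbar_closed [simp]: "f \<in> NKbar \<Gamma> \<Longrightarrow> f x \<in> carrier \<Gamma>"
  by (simp add: NKbar_Kbar)

lemma NKbar_fin: "f \<in> NKbar \<Gamma> \<Longrightarrow> v \<in> ThompsonV \<Longrightarrow> finite {x \<in> Q2. f x \<noteq> f (the_inv v x)}"
  unfolding NKbar_iff by blast

lemma NKbar_mult:
  assumes "f \<in> NKbar \<Gamma>" "g \<in> NKbar \<Gamma>" shows "kmul \<Gamma> f g \<in> NKbar \<Gamma>"
  unfolding NKbar_iff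
proof (intro conjI ballI)
  show "kmul \<Gamma> f g \<in> Kbar \<Gamma>" using assms by (auto simp: kmul_def NKbar_Kbar intro: KbarI)
  fix v assume "v \<in> ThompsonV"
  then have "finite ({x \<in> Q2. f x \<noteq> f (the_inv v x)} \<union> {x \<in> Q2. g x \<noteq> g (the_inv v x)})"
    using assms NKbar_fin by simp
  then show "finite {x \<in> Q2. kmul \<Gamma> f g x \<noteq> kmul \<Gamma> f g (the_inv v x)}"
    by (rule rev_finite_subset) (auto simp: kmul_def)
qed

lemma kconst_NKbar: "g \<in> carrier \<Gamma> \<Longrightarrow> kconst \<Gamma> g \<in> NKbar \<Gamma>"
  unfolding NKbar_iff by (auto simp: kconst_def intro: KbarI)

section \<open>Centre and automorphisms of \<Gamma>\<close>

lemma centre_closed [simp]: "z \<in> centre \<Gamma> \<Longrightarrow> z \<in> carrier \<Gamma>"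
  by (simp add: centre_def)

lemma centre_comm: "z \<in> centre \<Gamma> \<Longrightarrow> g \<in> carrier \<Gamma> \<Longrightarrow> z \<otimes> g = g \<otimes> z"
  unfolding centre_def by blast

lemma centreI: "z \<in> carrier \<Gamma> \<Longrightarrow> (\<And>g. g \<in> carrier \<Gamma> \<Longrightarrow> z \<otimes> g = g \<otimes> z) \<Longrightarrow> z \<in> centre \<Gamma>"
  unfolding centre_def by blast

lemma centre_one [simp]: "\<one> \<in> centre \<Gamma>"
  by (rule centreI) simp_all

lemma centre_mult [simp]: "y \<in> centre \<Gamma> \<Longrightarrow> z \<in> centre \<Gamma> \<Longrightarrow> y \<otimes> z \<in> centre \<Gamma>"
  by (rule centreI) (simp_all add: m_assoc, metis centre_closed centre_comm m_assoc m_closed)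

lemma centre_inv [simp]: "z \<in> centre \<Gamma> \<Longrightarrow> inv z \<in> centre \<Gamma>"
  by (rule centreI) (auto, metis centre_closed centre_comm inv_closed inv_inv inv_mult_group)

lemma centre_pow [simp]: assumes "z \<in> centre \<Gamma>" shows "z [^] (k :: int) \<in> centre \<Gamma>"
proof -
  have n: "z [^] (n :: nat) \<in> centre \<Gamma>" for n
    by (induction n) (use assms in auto)
  show ?thesis unfolding int_pow_def2 by (simp only: n centre_inv split: if_split) simp
qed

lemma autoD:
  assumes "\<beta> \<in> auto \<Gamma>"
  shows auto_closed [simp]: "x \<in> carrier \<Gamma> \<Longrightarrow> \<beta> x \<in> carrier \<Gamma>"
    and auto_mult: "x \<in> carrier \<Gamma> \<Longrightarrow> y \<in> carrier \<Gamma> \<Longrightarrow> \<beta> (x \<otimes> y) = \<beta> x \<otimes> \<beta> y"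
    and auto_inj: "inj_on \<beta> (carrier \<Gamma>)"
    and auto_surj: "\<beta> ` carrier \<Gamma> = carrier \<Gamma>"
    and auto_ext: "\<beta> \<in> extensional (carrier \<Gamma>)"
    and auto_hom: "group_hom \<Gamma> \<Gamma> \<beta>"
  using assms by (auto simp: auto_def Bij_def bij_betw_def hom_def group_hom_def group_hom_axioms_def)

lemma auto_one [simp]: "\<beta> \<in> auto \<Gamma> \<Longrightarrow> \<beta> \<one> = \<one>"
  using group_hom.hom_one[OF auto_hom] .

lemma auto_eq_one: "\<beta> \<in> auto \<Gamma> \<Longrightarrow> x \<in> carrier \<Gamma> \<Longrightarrow> \<beta> x = \<one> \<longleftrightarrow> x = \<one>"
  by (metis auto_inj auto_one inj_onD one_closed)

lemma auto_inverse: "\<beta> \<in> auto \<Gamma> \<Longrightarrow> x \<in> carrier \<Gamma> \<Longrightarrow> \<beta> (inv x) = inv (\<beta> x)"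
  using group_hom.hom_inv[OF auto_hom] .

lemma auto_pow: "\<beta> \<in> auto \<Gamma> \<Longrightarrow> x \<in> carrier \<Gamma> \<Longrightarrow> \<beta> (x [^] (k::int)) = \<beta> x [^] k"
  using group_hom.hom_int_pow[OF auto_hom] by metis

lemma auto_centre [simp]: assumes "\<beta> \<in> auto \<Gamma>" "z \<in> centre \<Gamma>" shows "\<beta> z \<in> centre \<Gamma>"
proof (rule centreI)
  fix g assume "g \<in> carrier \<Gamma>"
  then obtain h where h: "h \<in> carrier \<Gamma>" "g = \<beta> h" using auto_surj[OF assms(1)] by blast
  then show "\<beta> z \<otimes> g = g \<otimes> \<beta> z" using assms centre_comm[OF assms(2) h(1)]
    by (metis auto_mult centre_closed)
qed (use assms in simp)

text \<open>The composite of E, ad(f) and A in pointwise form. Its argument f is a map and not a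
  class, so no representative is chosen here; the default value off Q2 respects the encoding of
  \<open>Kbar\<close>.\<close>

definition Xmap where
  "Xmap \<zeta> f \<phi> \<beta> = (\<lambda>(a, v). let w = \<phi> \<circ> v \<circ> the_inv \<phi> in
     (\<lambda>x. if x \<in> Q2 then f x \<otimes> \<beta> (a (the_inv \<phi> x)) \<otimes> inv (f (the_inv w x)) \<otimes> \<zeta> [^] p_cocycle w x else \<one>, w))"

lemma Xmap_pt:
  "x \<in> Q2 \<Longrightarrow> fst (Xmap \<zeta> f \<phi> \<beta> (a, v)) x = f x \<otimes> \<beta> (a (the_inv \<phi> x)) \<otimes>
     inv (f (the_inv (\<phi> \<circ> v \<circ> the_inv \<phi>) x)) \<otimes> \<zeta> [^] p_cocycle (\<phi> \<circ> v \<circ> the_inv \<phi>) x"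
  "x \<notin> Q2 \<Longrightarrow> fst (Xmap \<zeta> f \<phi> \<beta> (a, v)) x = \<one>"
  "snd (Xmap \<zeta> f \<phi> \<beta> (a, v)) = \<phi> \<circ> v \<circ> the_inv \<phi>"
  by (simp_all add: Xmap_def Let_def)

lemma composite_eq_Xmap:
  assumes "\<phi> \<in> StabN" "v \<in> ThompsonV" "f \<in> Kbar \<Gamma>"
  shows "(E_aut \<Gamma> \<zeta> \<circ> adK \<Gamma> f \<circ> A_aut \<Gamma> \<phi> \<beta>) (a, v) = Xmap \<zeta> f \<phi> \<beta> (a, v)"
proof -
  have "\<phi> \<circ> v \<circ> the_inv \<phi> \<in> ThompsonV" using assms by simp
  then show ?thesis using assms
    by (auto simp: E_aut_def adK_eq A_aut_def Xmap_def Let_def kmul_def zpow_def fun_eq_iff)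
qed

lemma Xmap_closed:
  assumes q: "\<zeta> \<in> centre \<Gamma>" "f \<in> NKbar \<Gamma>" "\<phi> \<in> StabN" "\<beta> \<in> auto \<Gamma>" and av: "a \<in> Kfin \<Gamma>" "v \<in> ThompsonV"
  shows "Xmap \<zeta> f \<phi> \<beta> (a, v) \<in> carrier G"
proof -
  let ?w = "\<phi> \<circ> v \<circ> the_inv \<phi>"
  have w: "?w \<in> ThompsonV" using q av by simp
  have "(\<lambda>x. if x \<in> Q2 then f x \<otimes> \<beta> (a (the_inv \<phi> x)) \<otimes> inv (f (the_inv ?w x)) \<otimes> \<zeta> [^] p_cocycle ?w x else \<one>) \<in> Kfin \<Gamma>"
  \<comment> \<open>Outside these three finite sets the factor coming from a is trivial, the two
    values of f cancel, and the exponent of \<zeta> is 0.\<close>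
  proof (rule KfinI[of _ "\<phi> ` {x. a x \<noteq> \<one>} \<union> {x \<in> Q2. f x \<noteq> f (the_inv ?w x)} \<union> {x \<in> Q2. p_cocycle ?w x \<noteq> 0}"])
    show "finite (\<phi> ` {x. a x \<noteq> \<one>} \<union> {x \<in> Q2. f x \<noteq> f (the_inv ?w x)} \<union> {x \<in> Q2. p_cocycle ?w x \<noteq> 0})"
      using NKbar_fin[OF q(2) w] Kfin_finite[OF av(1)] p_cocycle_finite[OF w] by blast
  next
    fix x assume x: "x \<in> Q2" "x \<notin> \<phi> ` {x. a x \<noteq> \<one>} \<union> {x \<in> Q2. f x \<noteq> f (the_inv ?w x)} \<union> {x \<in> Q2. p_cocycle ?w x \<noteq> 0}"
    then have 1: "f (the_inv ?w x) = f x" "p_cocycle ?w x = 0" by auto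
    have "x = \<phi> (the_inv \<phi> x)" using q by simp
    with x have 2: "a (the_inv \<phi> x) = \<one>" by blast
    show "(if x \<in> Q2 then f x \<otimes> \<beta> (a (the_inv \<phi> x)) \<otimes> inv (f (the_inv ?w x)) \<otimes> \<zeta> [^] p_cocycle ?w x else \<one>) = \<one>"
      unfolding 1 2 using q by simp
  qed (use q av in auto)
  then show ?thesis using w by (simp add: Xmap_def Let_def)
qed

text \<open>f enters as a coboundary and the power of \<zeta> as a central cocycle, so neither
  disturbs multiplicativity.\<close>

lemma Xmap_hom:
  assumes q: "\<zeta> \<in> centre \<Gamma>" "f \<in> NKbar \<Gamma>" "\<phi> \<in> StabN" "\<beta> \<in> auto \<Gamma>"
    and av: "a \<in> Kfin \<Gamma>" "v \<in> ThompsonV" "b \<in> Kfin \<Gamma>" "u \<in> ThompsonV"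
  shows "Xmap \<zeta> f \<phi> \<beta> ((a, v) \<otimes>\<^bsub>G\<^esub> (b, u)) = Xmap \<zeta> f \<phi> \<beta> (a, v) \<otimes>\<^bsub>G\<^esub> Xmap \<zeta> f \<phi> \<beta> (b, u)"
proof -
  have bij: "bij \<phi>" using q by simp
  define w where "w = \<phi> \<circ> v \<circ> the_inv \<phi>"
  define t where "t = \<phi> \<circ> u \<circ> the_inv \<phi>"
  have w: "w \<in> ThompsonV" and t: "t \<in> ThompsonV" using q av by (simp_all add: w_def t_def)
  have wt: "\<phi> \<circ> (v \<circ> u) \<circ> the_inv \<phi> = w \<circ> t" unfolding w_def t_def by (rule conj_comp(1)[OF bij])
  have iw: "the_inv v (the_inv \<phi> x) = the_inv \<phi> (the_inv w x)" for x
    using av(2) bij unfolding w_def by (simp add: the_inv_comp bij_comp)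
  \<comment> \<open>F' is the value of f at the intermediate point: it cancels against its inverse
    once the central c has been carried past the second block.\<close>
  have alg: "F \<otimes> (A \<otimes> B) \<otimes> inv H \<otimes> (c \<otimes> d) = F \<otimes> A \<otimes> inv F' \<otimes> c \<otimes> (F' \<otimes> B \<otimes> inv H \<otimes> d)"
    if "F \<in> carrier \<Gamma>" "A \<in> carrier \<Gamma>" "B \<in> carrier \<Gamma>" "H \<in> carrier \<Gamma>" "F' \<in> carrier \<Gamma>"
      "c \<in> centre \<Gamma>" "d \<in> centre \<Gamma>" for F A B H F' c d
  proof -
    have "F \<otimes> A \<otimes> inv F' \<otimes> c \<otimes> (F' \<otimes> B \<otimes> inv H \<otimes> d) = F \<otimes> A \<otimes> inv F' \<otimes> (c \<otimes> (F' \<otimes> B \<otimes> inv H)) \<otimes> d"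
      using that by (simp add: m_assoc)
    also have "\<dots> = F \<otimes> A \<otimes> inv F' \<otimes> ((F' \<otimes> B \<otimes> inv H) \<otimes> c) \<otimes> d"
      using centre_comm[of c "F' \<otimes> B \<otimes> inv H"] that by simp
    finally show ?thesis using that by (simp add: m_assoc)
  qed
  have "f x \<otimes> \<beta> (a (the_inv \<phi> x) \<otimes> b (the_inv v (the_inv \<phi> x))) \<otimes> inv (f (the_inv (w \<circ> t) x)) \<otimes> \<zeta> [^] p_cocycle (w \<circ> t) x
    = f x \<otimes> \<beta> (a (the_inv \<phi> x)) \<otimes> inv (f (the_inv w x)) \<otimes> \<zeta> [^] p_cocycle w x \<otimes>
      (f (the_inv w x) \<otimes> \<beta> (b (the_inv \<phi> (the_inv w x))) \<otimes> inv (f (the_inv t (the_inv w x))) \<otimes> \<zeta> [^] p_cocycle t (the_inv w x))" for x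
  proof -
    have 1: "\<zeta> [^] p_cocycle (w \<circ> t) x = \<zeta> [^] p_cocycle w x \<otimes> \<zeta> [^] p_cocycle t (the_inv w x)"
      using q w t by (simp add: p_cocycle_comp int_pow_mult)
    have 2: "\<beta> (a (the_inv \<phi> x) \<otimes> b (the_inv v (the_inv \<phi> x))) = \<beta> (a (the_inv \<phi> x)) \<otimes> \<beta> (b (the_inv \<phi> (the_inv w x)))"
      using q av by (simp add: auto_mult iw)
    have 3: "the_inv (w \<circ> t) x = the_inv t (the_inv w x)" using w t by (simp add: the_inv_comp)
    show ?thesis unfolding 1 2 3 by (rule alg) (use q av in auto)
  qed
  then show ?thesis
    unfolding Xmap_def Let_def prod.case mult_G wt w_def[symmetric] t_def[symmetric]
    using w by (auto simp: fun_eq_iff)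
qed

lemma Xmap_inj:
  assumes q: "\<zeta> \<in> centre \<Gamma>" "f \<in> NKbar \<Gamma>" "\<phi> \<in> StabN" "\<beta> \<in> auto \<Gamma>"
    and av: "a \<in> Kfin \<Gamma>" "v \<in> ThompsonV" "b \<in> Kfin \<Gamma>" "u \<in> ThompsonV"
    and e: "Xmap \<zeta> f \<phi> \<beta> (a, v) = Xmap \<zeta> f \<phi> \<beta> (b, u)"
  shows "(a, v) = (b, u)"
proof -
  have bij: "bij \<phi>" using q by simp
  have "\<phi> \<circ> v \<circ> the_inv \<phi> = \<phi> \<circ> u \<circ> the_inv \<phi>" using e Xmap_pt(3) by metis
  then have vu: "v = u" using conj_cancel(1)[OF bij] by metis
  have "a y = b y" for y
  proof (cases "y \<in> Q2")
    case True
    then have x: "\<phi> y \<in> Q2" using q by simp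
    from Xmap_pt(1)[OF x, of \<zeta> f \<phi> \<beta> a v] Xmap_pt(1)[OF x, of \<zeta> f \<phi> \<beta> b v]
    have "\<beta> (a y) = \<beta> (b y)" using e q av bij unfolding vu[symmetric] by simp
    then show ?thesis using auto_inj[OF q(4)] av by (simp add: inj_on_def)
  qed (use av in simp)
  then show ?thesis using vu by blast
qed

lemma Xmap_surj:
  assumes q: "\<zeta> \<in> centre \<Gamma>" "f \<in> NKbar \<Gamma>" "\<phi> \<in> StabN" "\<beta> \<in> auto \<Gamma>"
    and bw: "b \<in> Kfin \<Gamma>" "w \<in> ThompsonV"
  shows "\<exists>a v. a \<in> Kfin \<Gamma> \<and> v \<in> ThompsonV \<and> Xmap \<zeta> f \<phi> \<beta> (a, v) = (b, w)"
proof -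
  have bij: "bij \<phi>" using q by simp
  define v where "v = the_inv \<phi> \<circ> w \<circ> \<phi>"
  have v: "v \<in> ThompsonV" and vw: "\<phi> \<circ> v \<circ> the_inv \<phi> = w"
    using q bw conj_cancel[OF bij] by (simp_all add: v_def)
  \<comment> \<open>The value that \<beta>(a) must take at x, from the pointwise formula of
    \<open>Xmap\<close>.\<close>
  define c where "c x = inv (f x) \<otimes> b x \<otimes> inv (\<zeta> [^] p_cocycle w x) \<otimes> f (the_inv w x)" for x
  have c: "c x \<in> carrier \<Gamma>" for x using q bw by (simp add: c_def)
  define a where "a y = (if y \<in> Q2 then inv_into (carrier \<Gamma>) \<beta> (c (\<phi> y)) else \<one>)" for y
  have \<beta>: "inv_into (carrier \<Gamma>) \<beta> x \<in> carrier \<Gamma>" "\<beta> (inv_into (carrier \<Gamma>) \<beta> x) = x" if "x \<in> carrier \<Gamma>" for x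
    using auto_surj[OF q(4)] that by (auto intro: inv_into_into f_inv_into_f)
  let ?F = "{x. b x \<noteq> \<one>} \<union> {x \<in> Q2. f x \<noteq> f (the_inv w x)} \<union> {x \<in> Q2. p_cocycle w x \<noteq> 0}"
  have "a \<in> Kfin \<Gamma>"
  proof (rule KfinI[of _ "the_inv \<phi> ` ?F"])
    show "finite (the_inv \<phi> ` ?F)"
      using NKbar_fin[OF q(2) bw(2)] Kfin_finite[OF bw(1)] p_cocycle_finite[OF bw(2)] by blast
  next
    fix y assume y: "y \<in> Q2" "y \<notin> the_inv \<phi> ` ?F"
    have "\<phi> y \<notin> ?F"
    proof
      assume "\<phi> y \<in> ?F"
      then have "the_inv \<phi> (\<phi> y) \<in> the_inv \<phi> ` ?F" by (rule imageI)
      with y bij show False by simp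
    qed
    then have "b (\<phi> y) = \<one>" "f (the_inv w (\<phi> y)) = f (\<phi> y)" "p_cocycle w (\<phi> y) = 0" using y q by auto
    then have "c (\<phi> y) = \<one>" using q unfolding c_def by simp
    then show "a y = \<one>" using y \<beta>[of \<one>] auto_eq_one[OF q(4)] by (simp add: a_def)
  qed (use c \<beta> in \<open>auto simp: a_def\<close>)
  moreover have "Xmap \<zeta> f \<phi> \<beta> (a, v) = (b, w)"
  proof -
    have "f x \<otimes> \<beta> (a (the_inv \<phi> x)) \<otimes> inv (f (the_inv w x)) \<otimes> \<zeta> [^] p_cocycle w x = b x" if x: "x \<in> Q2" for x
    proof -
      have "\<beta> (a (the_inv \<phi> x)) = c x" using x q c \<beta> bij by (simp add: a_def)
      then show ?thesis using q bw by (simp add: c_def m_assoc)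
    qed
    then show ?thesis using bw by (auto simp: Xmap_def Let_def vw fun_eq_iff)
  qed
  ultimately show ?thesis using v by blast
qed

lemma Xmap_auto:
  assumes q: "\<zeta> \<in> centre \<Gamma>" "f \<in> NKbar \<Gamma>" "\<phi> \<in> StabN" "\<beta> \<in> auto \<Gamma>"
  shows "restrict (Xmap \<zeta> f \<phi> \<beta>) (carrier G) \<in> auto G"
proof -
  interpret GG: group G by (rule group_G)
  let ?X = "restrict (Xmap \<zeta> f \<phi> \<beta>) (carrier G)"
  have cl: "?X g \<in> carrier G" if "g \<in> carrier G" for g
    using that Xmap_closed[OF q] by (cases g) simp
  have "?X \<in> hom G G"
  proof (rule homI)
    fix g h assume gh: "g \<in> carrier G" "h \<in> carrier G"
    then obtain a v b u where e: "g = (a, v)" "h = (b, u)" "a \<in> Kfin \<Gamma>" "v \<in> ThompsonV" "b \<in> Kfin \<Gamma>" "u \<in> ThompsonV"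
      by (cases g; cases h) auto
    have "?X (g \<otimes>\<^bsub>G\<^esub> h) = Xmap \<zeta> f \<phi> \<beta> (g \<otimes>\<^bsub>G\<^esub> h)" using gh by (simp del: mult_G)
    also have "\<dots> = ?X g \<otimes>\<^bsub>G\<^esub> ?X h" using Xmap_hom[OF q e(3-6)] gh e(1,2) by (simp del: mult_G)
    finally show "?X (g \<otimes>\<^bsub>G\<^esub> h) = ?X g \<otimes>\<^bsub>G\<^esub> ?X h" .
  qed (rule cl)
  moreover have "inj_on ?X (carrier G)"
    using Xmap_inj[OF q] by (intro inj_onI) (simp add: carrier_G, auto)
  moreover have "?X ` carrier G = carrier G"
  proof
    show "carrier G \<subseteq> ?X ` carrier G"
    proof
      fix g assume "g \<in> carrier G"
      then obtain b w where g: "g = (b, w)" "b \<in> Kfin \<Gamma>" "w \<in> ThompsonV" by (cases g) auto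
      then obtain a v where "a \<in> Kfin \<Gamma>" "v \<in> ThompsonV" "Xmap \<zeta> f \<phi> \<beta> (a, v) = (b, w)"
        using Xmap_surj[OF q] by blast
      then show "g \<in> ?X ` carrier G" using g by (intro image_eqI[of _ _ "(a, v)"]) auto
    qed
  qed (use cl in blast)
  ultimately show ?thesis by (simp add: auto_def Bij_def bij_betw_def)
qed

end

section \<open>Multiplicativity and kernel of \<open>\<Xi>\<close>\<close>

context coeff_group
begin

lemma centre_lcomm:
  assumes "z \<in> centre \<Gamma>" "x \<in> carrier \<Gamma>" "y \<in> carrier \<Gamma>"
  shows "x \<otimes> (z \<otimes> y) = z \<otimes> (x \<otimes> y)"
  using assms centre_comm[of z x] by (simp flip: m_assoc)

lemma auto_compose:
  assumes "\<beta>1 \<in> auto \<Gamma>" "\<beta>2 \<in> auto \<Gamma>" shows "compose (carrier \<Gamma>) \<beta>1 \<beta>2 \<in> auto \<Gamma>"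
  using assms by (auto simp: auto_def hom_compose compose_Bij)

text \<open>The power with exponent \<open>mu\<close> need not be finitely supported, but by
  \<open>p_cocycle_conj\<close> the change of \<open>mu\<close> along v is a difference of two
  values of p, hence zero outside a finite set.\<close>

lemma sigma2_NKbar:
  assumes \<phi>: "\<phi> \<in> StabN" and \<beta>: "\<beta> \<in> auto \<Gamma>" and \<zeta>: "\<zeta> \<in> centre \<Gamma>" and f: "f \<in> NKbar \<Gamma>"
  shows "sigma2 \<Gamma> \<phi> \<beta> \<zeta> f \<in> NKbar \<Gamma>"
  unfolding NKbar_iff
proof (intro conjI ballI)
  have b: "bij \<phi>" using \<phi> by simp
  show "sigma2 \<Gamma> \<phi> \<beta> \<zeta> f \<in> Kbar \<Gamma>"
    by (rule KbarI) (use assms in \<open>simp_all add: sigma2_def kmul_def zpow_def\<close>)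
  fix v assume v: "v \<in> ThompsonV"
  let ?u = "the_inv \<phi> \<circ> v \<circ> \<phi>"
  have u: "?u \<in> ThompsonV" using \<phi> v by simp
  have iu: "the_inv ?u y = the_inv \<phi> (the_inv v (\<phi> y))" for y
    using b v u by (intro the_inv_eq) auto
  let ?F = "\<phi> ` {y \<in> Q2. f y \<noteq> f (the_inv ?u y)} \<union> \<phi> ` {y \<in> Q2. p_cocycle ?u y \<noteq> 0} \<union> {x \<in> Q2. p_cocycle v x \<noteq> 0}"
  have fin: "finite ?F" using NKbar_fin[OF f u] p_cocycle_finite[OF u] p_cocycle_finite[OF v] by blast
  show "finite {x \<in> Q2. sigma2 \<Gamma> \<phi> \<beta> \<zeta> f x \<noteq> sigma2 \<Gamma> \<phi> \<beta> \<zeta> f (the_inv v x)}"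
  proof (rule rev_finite_subset[OF fin], intro subsetI, rule ccontr)
    fix x assume x: "x \<in> {x \<in> Q2. sigma2 \<Gamma> \<phi> \<beta> \<zeta> f x \<noteq> sigma2 \<Gamma> \<phi> \<beta> \<zeta> f (the_inv v x)}" and n: "x \<notin> ?F"
    have xQ: "x \<in> Q2" and xe: "x = \<phi> (the_inv \<phi> x)" and xi: "the_inv \<phi> x \<in> Q2" using x b \<phi> by auto
    have 1: "f (the_inv \<phi> x) = f (the_inv \<phi> (the_inv v x))"
      using n xe xi iu[of "the_inv \<phi> x"] by (metis (mono_tags, lifting) UnCI image_eqI mem_Collect_eq)
    have "p_cocycle ?u (the_inv \<phi> x) = 0"
      using n xe xi by (metis (mono_tags, lifting) UnCI image_eqI mem_Collect_eq)
    moreover have "p_cocycle v x = 0" using n xQ by blast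
    ultimately have 2: "mu \<phi> x = mu \<phi> (the_inv v x)" using p_cocycle_conj[OF \<phi> v xQ] by simp
    have "sigma2 \<Gamma> \<phi> \<beta> \<zeta> f x = sigma2 \<Gamma> \<phi> \<beta> \<zeta> f (the_inv v x)"
      using xQ v by (simp add: sigma2_def kmul_def zpow_def 1 2)
    with x show False by simp
  qed
qed

text \<open>This is the origin of \<sigma>. Pushing the power of \<zeta>2 through \<phi>1 and
  \<beta>1 turns its exponent into p plus a coboundary of \<open>mu\<close>; the p part joins
  \<zeta>1 and the coboundary joins f1.\<close>

lemma Xmap_comp:
  assumes q1: "\<zeta>1 \<in> centre \<Gamma>" "f1 \<in> NKbar \<Gamma>" "\<phi>1 \<in> StabN" "\<beta>1 \<in> auto \<Gamma>"
    and q2: "\<zeta>2 \<in> centre \<Gamma>" "f2 \<in> NKbar \<Gamma>" "\<phi>2 \<in> StabN" "\<beta>2 \<in> auto \<Gamma>"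
    and av: "a \<in> Kfin \<Gamma>" "v \<in> ThompsonV"
  shows "Xmap \<zeta>1 f1 \<phi>1 \<beta>1 (Xmap \<zeta>2 f2 \<phi>2 \<beta>2 (a, v))
    = Xmap (\<zeta>1 \<otimes> \<beta>1 \<zeta>2) (kmul \<Gamma> f1 (sigma2 \<Gamma> \<phi>1 \<beta>1 \<zeta>2 f2)) (\<phi>1 \<circ> \<phi>2) (compose (carrier \<Gamma>) \<beta>1 \<beta>2) (a, v)"
proof -
  have b: "bij \<phi>1" "bij \<phi>2" using q1 q2 by auto
  define w2 where "w2 = \<phi>2 \<circ> v \<circ> the_inv \<phi>2"
  define w where "w = \<phi>1 \<circ> w2 \<circ> the_inv \<phi>1"
  have w2: "w2 \<in> ThompsonV" using q2 av by (simp add: w2_def)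
  have w: "w \<in> ThompsonV" using q1 w2 by (simp add: w_def)
  have i: "the_inv (\<phi>1 \<circ> \<phi>2) = the_inv \<phi>2 \<circ> the_inv \<phi>1" using b by (rule the_inv_comp)
  have ww: "\<phi>1 \<circ> \<phi>2 \<circ> v \<circ> the_inv (\<phi>1 \<circ> \<phi>2) = w"
    by (simp add: i w_def w2_def comp_assoc)
  have w2w: "w2 = the_inv \<phi>1 \<circ> w \<circ> \<phi>1" unfolding w_def using conj_cancel(1)[OF b(1)] by simp
  have iw: "the_inv w2 (the_inv \<phi>1 x) = the_inv \<phi>1 (the_inv w x)" for x
    using w w2 b by (intro the_inv_eq) (auto simp: w2w)
  \<comment> \<open>Here d is \<beta>1 \<zeta>2. Its exponent is split in three: one part merges
    with the power of c, the other two are attached to P and Q on either side of A.\<close>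
  have alg: "F \<otimes> (P \<otimes> A \<otimes> inv Q \<otimes> d [^] (p + m - m')) \<otimes> inv R \<otimes> c [^] p
      = F \<otimes> (P \<otimes> d [^] m) \<otimes> A \<otimes> inv (R \<otimes> (Q \<otimes> d [^] m')) \<otimes> (c \<otimes> d) [^] p"
    if "F \<in> carrier \<Gamma>" "P \<in> carrier \<Gamma>" "A \<in> carrier \<Gamma>" "Q \<in> carrier \<Gamma>" "R \<in> carrier \<Gamma>" "c \<in> centre \<Gamma>" "d \<in> centre \<Gamma>"
    for F P A Q R c d and p m m' :: int
  proof -
    have cd: "(c \<otimes> d) [^] p = c [^] p \<otimes> d [^] p" using that by (intro int_pow_mult_distrib centre_comm) auto
    have dd: "d [^] (p + m - m') = d [^] m \<otimes> inv (d [^] m') \<otimes> d [^] p"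
      using that int_pow_mult[of d] int_pow_neg[of d m']
      by (metis add.commute add.left_commute add_uminus_conv_diff centre_closed add.assoc)
    define D where "D = d [^] m"
    define D' where "D' = inv (d [^] m')"
    define E where "E = d [^] p"
    have z: "D \<in> centre \<Gamma>" "D' \<in> centre \<Gamma>" "E \<in> centre \<Gamma>" "c [^] p \<in> centre \<Gamma>"
      using that by (simp_all add: D_def D'_def E_def)
    have "F \<otimes> (P \<otimes> A \<otimes> inv Q \<otimes> (D \<otimes> D' \<otimes> E)) \<otimes> inv R \<otimes> c [^] p
      = F \<otimes> (P \<otimes> (A \<otimes> (inv Q \<otimes> (D \<otimes> (D' \<otimes> (E \<otimes> (inv R \<otimes> c [^] p)))))))"
      using that z by (simp add: m_assoc)
    also have "E \<otimes> (inv R \<otimes> c [^] p) = (inv R \<otimes> c [^] p) \<otimes> E" using that z by (intro centre_comm) auto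
    also have "inv Q \<otimes> (D \<otimes> (D' \<otimes> ((inv R \<otimes> c [^] p) \<otimes> E))) = D \<otimes> (D' \<otimes> (inv Q \<otimes> ((inv R \<otimes> c [^] p) \<otimes> E)))"
      using that z by (simp add: centre_lcomm[of D "inv Q"] centre_lcomm[of D' "inv Q"])
    also have "A \<otimes> (D \<otimes> (D' \<otimes> (inv Q \<otimes> ((inv R \<otimes> c [^] p) \<otimes> E)))) = D \<otimes> (A \<otimes> (D' \<otimes> (inv Q \<otimes> ((inv R \<otimes> c [^] p) \<otimes> E))))"
      using that z by (simp add: centre_lcomm[of D A])
    also have "F \<otimes> (P \<otimes> (D \<otimes> (A \<otimes> (D' \<otimes> (inv Q \<otimes> ((inv R \<otimes> c [^] p) \<otimes> E))))))
      = F \<otimes> (P \<otimes> D) \<otimes> A \<otimes> (D' \<otimes> inv Q \<otimes> inv R) \<otimes> (c [^] p \<otimes> E)"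
      using that z by (simp add: m_assoc)
    also have "D' \<otimes> inv Q \<otimes> inv R = inv (R \<otimes> (Q \<otimes> d [^] m'))"
      using that by (simp add: D'_def inv_mult_group m_assoc)
    finally show ?thesis unfolding cd dd D_def D'_def E_def .
  qed
  have main: "f1 x \<otimes> \<beta>1 (f2 (the_inv \<phi>1 x) \<otimes> \<beta>2 (a (the_inv \<phi>2 (the_inv \<phi>1 x))) \<otimes> inv (f2 (the_inv w2 (the_inv \<phi>1 x)))
        \<otimes> \<zeta>2 [^] p_cocycle w2 (the_inv \<phi>1 x)) \<otimes> inv (f1 (the_inv w x)) \<otimes> \<zeta>1 [^] p_cocycle w x
    = kmul \<Gamma> f1 (sigma2 \<Gamma> \<phi>1 \<beta>1 \<zeta>2 f2) x \<otimes> compose (carrier \<Gamma>) \<beta>1 \<beta>2 (a (the_inv (\<phi>1 \<circ> \<phi>2) x))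
      \<otimes> inv (kmul \<Gamma> f1 (sigma2 \<Gamma> \<phi>1 \<beta>1 \<zeta>2 f2) (the_inv w x)) \<otimes> (\<zeta>1 \<otimes> \<beta>1 \<zeta>2) [^] p_cocycle w x"
    (is "?lhs = ?rhs") if x: "x \<in> Q2" for x
  proof -
    have p: "p_cocycle w2 (the_inv \<phi>1 x) = p_cocycle w x + mu \<phi>1 x - mu \<phi>1 (the_inv w x)"
      unfolding w2w by (rule p_cocycle_conj[OF q1(3) w x])
    have "?lhs = f1 x \<otimes> (\<beta>1 (f2 (the_inv \<phi>1 x)) \<otimes> \<beta>1 (\<beta>2 (a (the_inv \<phi>2 (the_inv \<phi>1 x)))) \<otimes>
        inv (\<beta>1 (f2 (the_inv \<phi>1 (the_inv w x)))) \<otimes> \<beta>1 \<zeta>2 [^] (p_cocycle w x + mu \<phi>1 x - mu \<phi>1 (the_inv w x)))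
        \<otimes> inv (f1 (the_inv w x)) \<otimes> \<zeta>1 [^] p_cocycle w x"
      using q1 q2 av by (simp add: auto_mult auto_inverse auto_pow iw p)
    also have "\<dots> = f1 x \<otimes> (\<beta>1 (f2 (the_inv \<phi>1 x)) \<otimes> \<beta>1 \<zeta>2 [^] mu \<phi>1 x) \<otimes> \<beta>1 (\<beta>2 (a (the_inv \<phi>2 (the_inv \<phi>1 x)))) \<otimes>
        inv (f1 (the_inv w x) \<otimes> (\<beta>1 (f2 (the_inv \<phi>1 (the_inv w x))) \<otimes> \<beta>1 \<zeta>2 [^] mu \<phi>1 (the_inv w x)))
        \<otimes> (\<zeta>1 \<otimes> \<beta>1 \<zeta>2) [^] p_cocycle w x"
      by (rule alg) (use q1 q2 av in simp_all)
    also have "\<dots> = ?rhs" using x w av by (simp add: kmul_def sigma2_def zpow_def compose_def i)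
    finally show ?thesis .
  qed
  have X2: "Xmap \<zeta>2 f2 \<phi>2 \<beta>2 (a, v) = (\<lambda>y. if y \<in> Q2 then f2 y \<otimes> \<beta>2 (a (the_inv \<phi>2 y)) \<otimes> inv (f2 (the_inv w2 y)) \<otimes> \<zeta>2 [^] p_cocycle w2 y else \<one>, w2)"
    unfolding Xmap_def Let_def prod.case w2_def[symmetric] ..
  have X1: "Xmap \<zeta>1 f1 \<phi>1 \<beta>1 (b, w2) = (\<lambda>y. if y \<in> Q2 then f1 y \<otimes> \<beta>1 (b (the_inv \<phi>1 y)) \<otimes> inv (f1 (the_inv w y)) \<otimes> \<zeta>1 [^] p_cocycle w y else \<one>, w)" for b
    unfolding Xmap_def Let_def prod.case w_def[symmetric] ..
  have X3: "Xmap z g (\<phi>1 \<circ> \<phi>2) \<beta> (a, v) = (\<lambda>y. if y \<in> Q2 then g y \<otimes> \<beta> (a (the_inv (\<phi>1 \<circ> \<phi>2) y)) \<otimes> inv (g (the_inv w y)) \<otimes> z [^] p_cocycle w y else \<one>, w)" for z g \<beta>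
    unfolding Xmap_def Let_def prod.case ww ..
  show ?thesis unfolding X2 X1 X3
    by (intro prod_eqI ext, unfold fst_conv snd_conv)
      (use main q1(3) in \<open>simp_all only: if_True if_False StabN_inv_Q2 split: if_split\<close>, simp)
qed

section \<open>Classes modulo central constants and the choice of representatives\<close>

lemma zcls_self: assumes "f \<in> NKbar \<Gamma>" shows "f \<in> zcls \<Gamma> f"
proof -
  have "f = kmul \<Gamma> f (kconst \<Gamma> \<one>)" using assms by (simp add: kmul_def kconst_def)
  then show ?thesis unfolding zcls_def using centre_one by blast
qed

lemma rep_zcls: assumes "f \<in> NKbar \<Gamma>" obtains z where "z \<in> centre \<Gamma>" "rep (zcls \<Gamma> f) = kmul \<Gamma> f (kconst \<Gamma> z)"
proof -
  have "rep (zcls \<Gamma> f) \<in> zcls \<Gamma> f" unfolding rep_def by (rule someI[of "\<lambda>g. g \<in> zcls \<Gamma> f"]) (rule zcls_self[OF assms])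
  with that show ?thesis unfolding zcls_def by blast
qed

lemma rep_NKbar: "F \<in> zcls \<Gamma> ` NKbar \<Gamma> \<Longrightarrow> rep F \<in> NKbar \<Gamma>"
  by (elim imageE) (metis rep_zcls NKbar_mult kconst_NKbar centre_closed)

lemma zcls_mult_central:
  assumes f: "f \<in> NKbar \<Gamma>" and z: "z \<in> centre \<Gamma>"
  shows "zcls \<Gamma> (kmul \<Gamma> f (kconst \<Gamma> z)) = zcls \<Gamma> f"
proof -
  have e: "kmul \<Gamma> (kmul \<Gamma> f (kconst \<Gamma> z)) (kconst \<Gamma> y) = kmul \<Gamma> f (kconst \<Gamma> (z \<otimes> y))" if "y \<in> centre \<Gamma>" for y
    using f z that by (auto simp: kmul_def kconst_def m_assoc)
  have "kmul \<Gamma> f (kconst \<Gamma> y) = kmul \<Gamma> (kmul \<Gamma> f (kconst \<Gamma> z)) (kconst \<Gamma> (inv z \<otimes> y))" if "y \<in> centre \<Gamma>" for y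
    using z that by (simp add: e)
  then show ?thesis unfolding zcls_def using e centre_mult[OF z] centre_mult[OF centre_inv[OF z]] by blast
qed

lemma zcls_rep: "F \<in> zcls \<Gamma> ` NKbar \<Gamma> \<Longrightarrow> zcls \<Gamma> (rep F) = F"
  by (elim imageE) (metis rep_zcls zcls_mult_central)

text \<open>z occurs once and its inverse once; being central, they meet across the middle factor
  and cancel.\<close>

lemma Xmap_central:
  assumes f: "f \<in> NKbar \<Gamma>" and z: "z \<in> centre \<Gamma>" and q: "\<zeta> \<in> centre \<Gamma>" "\<phi> \<in> StabN" "\<beta> \<in> auto \<Gamma>"
    and av: "a \<in> Kfin \<Gamma>" "v \<in> ThompsonV"
  shows "Xmap \<zeta> (kmul \<Gamma> f (kconst \<Gamma> z)) \<phi> \<beta> (a, v) = Xmap \<zeta> f \<phi> \<beta> (a, v)"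
proof -
  have "\<phi> \<circ> v \<circ> the_inv \<phi> \<in> ThompsonV" using q av by simp
  moreover have "F \<otimes> z \<otimes> A \<otimes> inv (H \<otimes> z) = F \<otimes> A \<otimes> inv H"
    if "F \<in> carrier \<Gamma>" "A \<in> carrier \<Gamma>" "H \<in> carrier \<Gamma>" for F A H
  proof -
    have "F \<otimes> z \<otimes> A \<otimes> inv (H \<otimes> z) = F \<otimes> (z \<otimes> A) \<otimes> (inv z \<otimes> inv H)"
      using that z by (simp add: m_assoc inv_mult_group)
    also have "\<dots> = F \<otimes> (A \<otimes> z) \<otimes> (inv z \<otimes> inv H)" using that z centre_comm by simp
    finally show ?thesis using that z by (simp add: m_assoc)
  qed
  ultimately show ?thesis using assms by (simp add: Xmap_def Let_def kmul_def kconst_def cong: if_cong)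
qed

lemma Xi_rep:
  assumes "\<zeta> \<in> centre \<Gamma>" "F \<in> zcls \<Gamma> ` NKbar \<Gamma>" "\<phi> \<in> StabN" "\<beta> \<in> auto \<Gamma>"
  shows "Xi \<Gamma> (\<zeta>, F, \<phi>, \<beta>) = restrict (Xmap \<zeta> (rep F) \<phi> \<beta>) (carrier G)"
  unfolding Xi_def prod.case
proof (rule restrict_ext)
  fix g assume "g \<in> carrier G"
  then show "(E_aut \<Gamma> \<zeta> \<circ> adK \<Gamma> (rep F) \<circ> A_aut \<Gamma> \<phi> \<beta>) g = Xmap \<zeta> (rep F) \<phi> \<beta> g"
    using composite_eq_Xmap[OF assms(3)] NKbar_Kbar[OF rep_NKbar[OF assms(2)]] by (cases g) (simp del: comp_apply)
qed

text \<open>\<open>rep\<close> may return another member of the class, but only up to a central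
  constant, which \<open>Xmap\<close> does not see. Any representative therefore computes
  \<open>Xi\<close>.\<close>

lemma Xi_zcls:
  assumes "\<zeta> \<in> centre \<Gamma>" "f \<in> NKbar \<Gamma>" "\<phi> \<in> StabN" "\<beta> \<in> auto \<Gamma>"
  shows "Xi \<Gamma> (\<zeta>, zcls \<Gamma> f, \<phi>, \<beta>) = restrict (Xmap \<zeta> f \<phi> \<beta>) (carrier G)"
proof -
  obtain z where z: "z \<in> centre \<Gamma>" "rep (zcls \<Gamma> f) = kmul \<Gamma> f (kconst \<Gamma> z)" using rep_zcls assms(2) by blast
  have "Xi \<Gamma> (\<zeta>, zcls \<Gamma> f, \<phi>, \<beta>) = restrict (Xmap \<zeta> (rep (zcls \<Gamma> f)) \<phi> \<beta>) (carrier G)"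
    by (rule Xi_rep) (use assms in auto)
  also have "\<dots> = restrict (Xmap \<zeta> f \<phi> \<beta>) (carrier G)"
    unfolding z(2) by (rule restrict_ext) (use Xmap_central assms z in auto)
  finally show ?thesis .
qed

lemma in_Q: "(\<zeta>, F, \<phi>, \<beta>) \<in> carrier (Qgrp \<Gamma>) \<longleftrightarrow> \<zeta> \<in> centre \<Gamma> \<and> F \<in> zcls \<Gamma> ` NKbar \<Gamma> \<and> \<phi> \<in> StabN \<and> \<beta> \<in> auto \<Gamma>"
  by (simp add: Qgrp_def)

lemma Xi_auto: "q \<in> carrier (Qgrp \<Gamma>) \<Longrightarrow> Xi \<Gamma> q \<in> auto G"
  by (cases q) (simp add: in_Q Xi_rep rep_NKbar Xmap_auto)

lemma AutoGroup_mult: "g \<in> auto G \<Longrightarrow> h \<in> auto G \<Longrightarrow> g \<otimes>\<^bsub>AutoGroup G\<^esub> h = compose (carrier G) g h"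
  by (simp add: AutoGroup_def BijGroup_def auto_def)

lemma Xi_mult:
  assumes "q1 \<in> carrier (Qgrp \<Gamma>)" "q2 \<in> carrier (Qgrp \<Gamma>)"
  shows "Xi \<Gamma> (q1 \<otimes>\<^bsub>Qgrp \<Gamma>\<^esub> q2) = compose (carrier G) (Xi \<Gamma> q1) (Xi \<Gamma> q2)"
proof -
  obtain \<zeta>1 F1 \<phi>1 \<beta>1 where q1: "q1 = (\<zeta>1, F1, \<phi>1, \<beta>1)" by (cases q1)
  obtain \<zeta>2 F2 \<phi>2 \<beta>2 where q2: "q2 = (\<zeta>2, F2, \<phi>2, \<beta>2)" by (cases q2)
  from assms have h1: "\<zeta>1 \<in> centre \<Gamma>" "F1 \<in> zcls \<Gamma> ` NKbar \<Gamma>" "\<phi>1 \<in> StabN" "\<beta>1 \<in> auto \<Gamma>"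
    and h2: "\<zeta>2 \<in> centre \<Gamma>" "F2 \<in> zcls \<Gamma> ` NKbar \<Gamma>" "\<phi>2 \<in> StabN" "\<beta>2 \<in> auto \<Gamma>"
    by (simp_all add: q1 q2 in_Q)
  note r = rep_NKbar[OF h1(2)] rep_NKbar[OF h2(2)]
  let ?f = "kmul \<Gamma> (rep F1) (sigma2 \<Gamma> \<phi>1 \<beta>1 \<zeta>2 (rep F2))"
  have f: "?f \<in> NKbar \<Gamma>" using NKbar_mult r sigma2_NKbar h1 h2 by simp
  have "Xi \<Gamma> (q1 \<otimes>\<^bsub>Qgrp \<Gamma>\<^esub> q2) = Xi \<Gamma> (\<zeta>1 \<otimes> \<beta>1 \<zeta>2, zcls \<Gamma> ?f, \<phi>1 \<circ> \<phi>2, compose (carrier \<Gamma>) \<beta>1 \<beta>2)"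
    by (simp add: q1 q2 Qgrp_def)
  also have "\<dots> = restrict (Xmap (\<zeta>1 \<otimes> \<beta>1 \<zeta>2) ?f (\<phi>1 \<circ> \<phi>2) (compose (carrier \<Gamma>) \<beta>1 \<beta>2)) (carrier G)"
    by (rule Xi_zcls) (use h1 h2 f auto_compose in simp_all)
  also have "\<dots> = compose (carrier G) (Xi \<Gamma> q1) (Xi \<Gamma> q2)"
    unfolding compose_def[of "carrier G"]
  proof (rule restrict_ext)
    fix g assume g: "g \<in> carrier G"
    then obtain a v where av: "g = (a, v)" "a \<in> Kfin \<Gamma>" "v \<in> ThompsonV" by (cases g) auto
    have X2: "Xi \<Gamma> q2 g = Xmap \<zeta>2 (rep F2) \<phi>2 \<beta>2 g" using g by (simp add: q2 Xi_rep h2)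
    have "Xmap \<zeta>2 (rep F2) \<phi>2 \<beta>2 g \<in> carrier G" unfolding av(1) by (rule Xmap_closed) (use h2 r av in auto)
    then have "Xi \<Gamma> q1 (Xi \<Gamma> q2 g) = Xmap \<zeta>1 (rep F1) \<phi>1 \<beta>1 (Xmap \<zeta>2 (rep F2) \<phi>2 \<beta>2 g)"
      unfolding X2 by (simp add: q1 Xi_rep h1)
    also have "\<dots> = Xmap (\<zeta>1 \<otimes> \<beta>1 \<zeta>2) ?f (\<phi>1 \<circ> \<phi>2) (compose (carrier \<Gamma>) \<beta>1 \<beta>2) g"
      unfolding av(1) by (rule Xmap_comp) (use h1 h2 r av in auto)
    finally show "Xmap (\<zeta>1 \<otimes> \<beta>1 \<zeta>2) ?f (\<phi>1 \<circ> \<phi>2) (compose (carrier \<Gamma>) \<beta>1 \<beta>2) g = Xi \<Gamma> q1 (Xi \<Gamma> q2 g)" by simp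
  qed
  finally show ?thesis .
qed

lemma Xi_hom: "Xi \<Gamma> \<in> hom (Qgrp \<Gamma>) (AutoGroup G)"
  by (rule homI) (simp_all add: Xi_mult AutoGroup_mult Xi_auto, simp add: AutoGroup_def Xi_auto)

section \<open>The kernel of Xi\<close>

definition single :: "cantor \<Rightarrow> 'g \<Rightarrow> cantor \<Rightarrow> 'g" where
  "single x g = (\<lambda>y. if y = x then g else \<one>)"

lemma single_Kfin [simp]: "x \<in> Q2 \<Longrightarrow> g \<in> carrier \<Gamma> \<Longrightarrow> single x g \<in> Kfin \<Gamma>"
  by (rule KfinI[of _ "{x}"]) (auto simp: single_def)

lemma single_same [simp]: "single x g x = g"
  by (simp add: single_def)

text \<open>If \<phi> moved x, some v would fix x and move \<open>\<phi> x\<close>, whereas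
  commuting with v forces v to fix \<open>\<phi> x\<close>.\<close>

lemma centralizer_V_trivial:
  assumes \<phi>: "\<phi> \<in> StabN" and c: "\<And>v. v \<in> ThompsonV \<Longrightarrow> \<phi> \<circ> v \<circ> the_inv \<phi> = v"
  shows "\<phi> = id"
proof (rule cont_eq)
  show "cantor_cont \<phi>" using NormV_cont StabN_NormV \<phi> by blast
  show "cantor_cont id" by simp
  fix x assume x: "x \<in> Q2"
  have b: "bij \<phi>" using \<phi> by simp
  show "\<phi> x = id x"
  proof (rule ccontr)
    assume ne: "\<phi> x \<noteq> id x"
    obtain y where y: "y \<in> Q2" "y \<notin> {x, \<phi> x}" using Q2_avoid[of "{x, \<phi> x}"] by auto
    obtain v where v: "v \<in> ThompsonV" "v (\<phi> x) = y" "\<And>z. z \<in> {x} \<Longrightarrow> v z = z"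
      using swap_points[of "\<phi> x" y "{x}"] x y \<phi> ne by auto
    have "(\<phi> \<circ> v \<circ> the_inv \<phi>) (\<phi> x) = \<phi> x" using b v(3) by simp
    then show False using c[OF v(1)] v(2) y by simp
  qed
qed

lemma conj_auto:
  assumes g: "g \<in> carrier \<Gamma>" shows "(\<lambda>h \<in> carrier \<Gamma>. inv g \<otimes> h \<otimes> g) \<in> auto \<Gamma>"
proof -
  let ?c = "\<lambda>h \<in> carrier \<Gamma>. inv g \<otimes> h \<otimes> g"
  have "?c \<in> hom \<Gamma> \<Gamma>" using g by (intro homI) (simp_all add: m_assoc)
  moreover have "bij_betw ?c (carrier \<Gamma>) (carrier \<Gamma>)"
    by (rule bij_betw_byWitness[of _ "\<lambda>h. g \<otimes> h \<otimes> inv g"]) (use g in \<open>auto simp: m_assoc\<close>)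
  ultimately show ?thesis by (simp add: auto_def Bij_def)
qed

text \<open>Test elements isolate the parameters: V-parts give \<phi>; \<open>contr\<close> at 0,
  where f cancels and p is -1, gives \<zeta>; elements taking 0 to x show that f is constant; a copy
  of h at 0 gives \<beta>.\<close>

lemma Xmap_identity_imp:
  assumes q: "\<zeta> \<in> centre \<Gamma>" "f \<in> NKbar \<Gamma>" "\<phi> \<in> StabN" "\<beta> \<in> auto \<Gamma>"
    and e: "\<And>a v. a \<in> Kfin \<Gamma> \<Longrightarrow> v \<in> ThompsonV \<Longrightarrow> Xmap \<zeta> f \<phi> \<beta> (a, v) = (a, v)"
  obtains g where "g \<in> carrier \<Gamma>" "\<zeta> = \<one>" "f = kconst \<Gamma> g" "\<phi> = id" "\<beta> = (\<lambda>h \<in> carrier \<Gamma>. inv g \<otimes> h \<otimes> g)"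
proof -
  have "\<phi> \<circ> v \<circ> the_inv \<phi> = v" if "v \<in> ThompsonV" for v
    using e[OF kone_Kfin that] Xmap_pt(3) by (metis snd_conv)
  then have \<phi>: "\<phi> = id" by (rule centralizer_V_trivial[OF q(3)])
  have pt: "f x \<otimes> \<beta> (a x) \<otimes> inv (f (the_inv v x)) \<otimes> \<zeta> [^] p_cocycle v x = a x"
    if "a \<in> Kfin \<Gamma>" "v \<in> ThompsonV" "x \<in> Q2" for a v x
    using Xmap_pt(1)[OF that(3), of \<zeta> f \<phi> \<beta> a v] e[OF that(1,2)] by (simp add: \<phi>)
  have "f zero_seq \<otimes> \<one> \<otimes> inv (f zero_seq) \<otimes> \<zeta> [^] (-1 :: int) = \<one>"
    using pt[OF kone_Kfin contr_V zero_Q2] q contr_V contr_zero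
    by (simp add: kone_def p_cocycle_fix the_inv_eq)
  then have \<zeta>: "\<zeta> = \<one>" using q by (simp add: int_pow_neg int_pow_1)
  define g where "g = f zero_seq"
  have g: "g \<in> carrier \<Gamma>" using q by (simp add: g_def)
  have f: "f x = g" if x: "x \<in> Q2" for x
  proof -
    obtain v where v: "v \<in> ThompsonV" "v zero_seq = x" using V_transitive[OF zero_Q2 x] .
    then have "the_inv v x = zero_seq" by (simp add: the_inv_eq)
    then show ?thesis using pt[OF kone_Kfin v(1) x] q by (simp add: kone_def \<zeta> mult_inv_eq_one g_def)
  qed
  have fk: "f = kconst \<Gamma> g" using f NKbar_Kbar[OF q(2)] by (auto simp: kconst_def)
  have "\<beta> h = inv g \<otimes> h \<otimes> g" if h: "h \<in> carrier \<Gamma>" for h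
  proof -
    have "g \<otimes> \<beta> h \<otimes> inv g = h"
      using pt[OF single_Kfin[OF zero_Q2 h] V_id zero_Q2] q g h by (simp add: \<zeta> g_def)
    then have "inv g \<otimes> h \<otimes> g = inv g \<otimes> (g \<otimes> \<beta> h \<otimes> inv g) \<otimes> g" by simp
    also have "\<dots> = \<beta> h" using g q h by (simp add: m_assoc)
    finally show ?thesis by simp
  qed
  then have "\<beta> = (\<lambda>h \<in> carrier \<Gamma>. inv g \<otimes> h \<otimes> g)"
    using auto_ext[OF q(4)] by (auto simp: extensional_def fun_eq_iff)
  with that g \<zeta> fk \<phi> show ?thesis by blast
qed

lemma Xmap_identity:
  assumes g: "g \<in> carrier \<Gamma>" and av: "a \<in> Kfin \<Gamma>" "v \<in> ThompsonV"
  shows "Xmap \<one> (kconst \<Gamma> g) id (\<lambda>h \<in> carrier \<Gamma>. inv g \<otimes> h \<otimes> g) (a, v) = (a, v)"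
  using assms by (auto simp: Xmap_def kconst_def m_assoc fun_eq_iff)

lemma Xi_kernel:
  "kernel (Qgrp \<Gamma>) (AutoGroup G) (Xi \<Gamma>)
     = {(\<one>, zcls \<Gamma> (kconst \<Gamma> g), id, (\<lambda>h \<in> carrier \<Gamma>. inv g \<otimes> h \<otimes> g)) | g. g \<in> carrier \<Gamma>}" (is "?L = ?R")
proof
  have one: "\<one>\<^bsub>AutoGroup G\<^esub> = (\<lambda>x \<in> carrier G. x)" by (simp add: AutoGroup_def BijGroup_def)
  show "?L \<subseteq> ?R"
  proof
    fix q assume "q \<in> ?L"
    then have q: "q \<in> carrier (Qgrp \<Gamma>)" and x: "Xi \<Gamma> q = (\<lambda>x \<in> carrier G. x)" by (simp_all add: kernel_def one)
    obtain \<zeta> F \<phi> \<beta> where e: "q = (\<zeta>, F, \<phi>, \<beta>)" by (cases q)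
    with q have h: "\<zeta> \<in> centre \<Gamma>" "F \<in> zcls \<Gamma> ` NKbar \<Gamma>" "\<phi> \<in> StabN" "\<beta> \<in> auto \<Gamma>" by (simp_all add: in_Q)
    have "Xmap \<zeta> (rep F) \<phi> \<beta> (a, v) = (a, v)" if "a \<in> Kfin \<Gamma>" "v \<in> ThompsonV" for a v
      using fun_cong[OF x, of "(a, v)"] that by (simp add: e Xi_rep h)
    then obtain g where g: "g \<in> carrier \<Gamma>" "\<zeta> = \<one>" "rep F = kconst \<Gamma> g" "\<phi> = id" "\<beta> = (\<lambda>h \<in> carrier \<Gamma>. inv g \<otimes> h \<otimes> g)"
      using Xmap_identity_imp[OF h(1) rep_NKbar[OF h(2)] h(3,4)] by metis
    moreover have "F = zcls \<Gamma> (kconst \<Gamma> g)" using zcls_rep[OF h(2)] g(3) by simp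
    ultimately show "q \<in> ?R" unfolding e by blast
  qed
  show "?R \<subseteq> ?L"
  proof
    fix q assume "q \<in> ?R"
    then obtain g where g: "g \<in> carrier \<Gamma>" and q: "q = (\<one>, zcls \<Gamma> (kconst \<Gamma> g), id, (\<lambda>h \<in> carrier \<Gamma>. inv g \<otimes> h \<otimes> g))" by blast
    have "Xi \<Gamma> q = restrict (Xmap \<one> (kconst \<Gamma> g) id (\<lambda>h \<in> carrier \<Gamma>. inv g \<otimes> h \<otimes> g)) (carrier G)"
      unfolding q by (rule Xi_zcls) (use g kconst_NKbar conj_auto in auto)
    also have "\<dots> = (\<lambda>x \<in> carrier G. x)"
    proof (rule restrict_ext)
      fix h assume "h \<in> carrier G"
      then show "Xmap \<one> (kconst \<Gamma> g) id (\<lambda>h \<in> carrier \<Gamma>. inv g \<otimes> h \<otimes> g) h = h"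
        using Xmap_identity[OF g] by (cases h) simp
    qed
    finally show "q \<in> ?L" using g kconst_NKbar conj_auto by (simp add: kernel_def one q in_Q)
  qed
qed

end

section \<open>The action of an automorphism of \<open>G\<close> on \<open>Q2\<close>\<close>

text \<open>For any t, some s fixing y and y' keeps the images of \<open>t y\<close> and
  \<open>t y'\<close> off x and x', and then some r fixing x and x' brings them back to y and y'. So
  r o s o t fixes y and y'.\<close>

lemma stabilisers_generate:
  assumes L: "L \<subseteq> ThompsonV" "\<And>s t. s \<in> L \<Longrightarrow> t \<in> L \<Longrightarrow> s \<circ> t \<in> L" "\<And>s. s \<in> L \<Longrightarrow> the_inv s \<in> L"
    and pts: "x \<in> Q2" "x' \<in> Q2" "y \<in> Q2" "y' \<in> Q2" "distinct [x, x', y, y']"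
    and Lx: "\<And>t. t \<in> ThompsonV \<Longrightarrow> t x = x \<Longrightarrow> t x' = x' \<Longrightarrow> t \<in> L"
    and Ly: "\<And>t. t \<in> ThompsonV \<Longrightarrow> t y = y \<Longrightarrow> t y' = y' \<Longrightarrow> t \<in> L"
  shows "ThompsonV \<subseteq> L"
proof
  fix t assume t: "t \<in> ThompsonV"
  define p where "p = t y"
  define q where "q = t y'"
  have pq: "p \<in> Q2" "q \<in> Q2" "p \<noteq> q"
    using t pts by (auto simp: p_def q_def dest: bij_is_inj[OF V_bij, THEN injD])
  obtain e where e: "e \<in> Q2" "e \<notin> {x, x', y, y'}" using Q2_avoid[of "{x, x', y, y'}"] by auto
  obtain e' where e': "e' \<in> Q2" "e' \<notin> {x, x', y, y', e}" using Q2_avoid[of "{x, x', y, y', e}"] by auto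
  \<comment> \<open>Points already equal to y or y' must stay; e and e' are fresh, which makes g
    injective and avoids x and x'.\<close>
  define g where "g z = (if z = y \<or> z = y' then z else if z = p then e else e')" for z
  obtain s where s: "s \<in> ThompsonV" "\<And>z. z \<in> {y, y', p, q} \<Longrightarrow> s z = g z"
  proof (rule V_extend)
    show "inj_on g {y, y', p, q}" using pq e e' by (auto simp: inj_on_def g_def)
  qed (use pts pq e e' in \<open>auto simp: g_def\<close>)
  have sL: "s \<in> L" using s Ly by (simp add: g_def)
  have sp: "s p \<notin> {x, x'}" "s q \<notin> {x, x'}" "s p \<noteq> s q"
    using s(2)[of p] s(2)[of q] e e' pts(5) pq(3) by (auto simp: g_def)
  define h where "h z = (if z = x \<or> z = x' then z else if z = s p then y else y')" for z
  obtain r where r: "r \<in> ThompsonV" "\<And>z. z \<in> {x, x', s p, s q} \<Longrightarrow> r z = h z"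
  proof (rule V_extend)
    show "inj_on h {x, x', s p, s q}" using sp pts(5) by (auto simp: inj_on_def h_def)
  qed (use pts pq s(1) in \<open>auto simp: h_def\<close>)
  have rL: "r \<in> L" using r Lx by (simp add: h_def)
  have "r \<circ> s \<circ> t \<in> L"
    using r s t sp by (intro Ly) (auto simp: h_def simp flip: p_def q_def)
  moreover have "t = the_inv s \<circ> (the_inv r \<circ> (r \<circ> s \<circ> t))"
    using r(1) s(1) by (intro ext) simp
  ultimately show "t \<in> L" using L(2,3) rL sL by metis
qed

text \<open>The point z is followed through both products. w fixes z and sends \<open>v z\<close> to
  z2, p to \<open>v z\<close> and \<open>v p\<close> to q, so one product takes z to
  \<open>v z2\<close> and the other takes it to q. The choice of p keeps the four prescribed points
  distinct.\<close>

lemma noncommuting_conjugate: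
  assumes "v \<in> ThompsonV" "v \<noteq> id"
  obtains w where "w \<in> ThompsonV" "v \<circ> (w \<circ> v \<circ> the_inv w) \<noteq> (w \<circ> v \<circ> the_inv w) \<circ> v"
proof -
  have inf: "infinite {x \<in> Q2. v x \<noteq> x}" using moved_infinite assms by blast
  have b: "bij v" using assms by simp
  have v_inj: "v x = v y \<longleftrightarrow> x = y" for x y using bij_is_inj[OF b] by (simp add: inj_eq)
  obtain z where z: "z \<in> Q2" "v z \<noteq> z" using not_finite_existsD[OF inf] by blast
  have "\<not> {x \<in> Q2. v x \<noteq> x} \<subseteq> {z, v z, the_inv v z}" using inf finite_subset by blast
  then obtain p where p: "p \<in> Q2" "v p \<noteq> p" "p \<notin> {z, v z, the_inv v z}" by blast
  have vp: "v p \<noteq> z" "v p \<noteq> v z" using p b v_inj by auto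
  obtain z2 where z2: "z2 \<in> Q2" "z2 \<notin> {z, v z}" using Q2_avoid[of "{z, v z}"] by auto
  obtain q where q: "q \<in> Q2" "q \<notin> {z, v z, z2, v z2}" using Q2_avoid[of "{z, v z, z2, v z2}"] by auto
  define g where "g y = (if y = z then z else if y = v z then z2 else if y = p then v z else q)" for y
  obtain w where w: "w \<in> ThompsonV" "\<And>y. y \<in> {z, v z, p, v p} \<Longrightarrow> w y = g y"
  proof (rule V_extend)
    show "inj_on g {z, v z, p, v p}" using z p vp z2 q by (auto simp: inj_on_def g_def)
  qed (use assms z p z2 q in \<open>auto simp: g_def\<close>)
  have iz: "the_inv w z = z" using w by (simp add: the_inv_eq g_def)
  have ip: "the_inv w (v z) = p" using w p z by (simp add: the_inv_eq g_def)
  have "(v \<circ> (w \<circ> v \<circ> the_inv w)) z = v z2" using w z by (simp add: iz g_def)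
  moreover have "((w \<circ> v \<circ> the_inv w) \<circ> v) z = q" using w(2)[of "v p"] p vp by (simp add: ip g_def)
  ultimately have "(v \<circ> (w \<circ> v \<circ> the_inv w)) z \<noteq> ((w \<circ> v \<circ> the_inv w) \<circ> v) z" using q by auto
  with that w(1) show ?thesis by metis
qed

lemma stabiliser_determines_point:
  assumes "x \<in> Q2" "y \<in> Q2" "\<And>v. v \<in> ThompsonV \<Longrightarrow> v x = x \<Longrightarrow> v y = y"
  shows "x = y"
proof (rule ccontr)
  assume ne: "x \<noteq> y"
  obtain z where z: "z \<in> Q2" "z \<notin> {x, y}" using Q2_avoid[of "{x, y}"] by auto
  obtain v where "v \<in> ThompsonV" "v y = z" "\<And>a. a \<in> {x} \<Longrightarrow> v a = a"
    using swap_points[of y z "{x}"] assms z ne by auto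
  then show False using assms(3)[of v] z by auto
qed

text \<open>Point stabilisers are maximal because the action is doubly transitive, so
  \<open>\<alpha> V\<^sub>x\<close> is the full stabiliser of \<open>S\<close>. If \<open>S\<close> had at least two points, the orbits of its
  stabiliser would distinguish two sets of that size by how they meet \<open>S\<close>, contradicting the
  double transitivity once more.\<close>

lemma stabiliser_image:
  assumes \<alpha>: "\<And>v. v \<in> ThompsonV \<Longrightarrow> \<alpha> v \<in> ThompsonV"
    and \<alpha>_comp: "\<And>v w. v \<in> ThompsonV \<Longrightarrow> w \<in> ThompsonV \<Longrightarrow> \<alpha> (v \<circ> w) = \<alpha> v \<circ> \<alpha> w"
    and \<alpha>_surj: "\<And>w. w \<in> ThompsonV \<Longrightarrow> \<exists>v\<in>ThompsonV. \<alpha> v = w"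
    and S: "finite S" "S \<noteq> {}" "S \<subseteq> Q2" and x: "x \<in> Q2"
    and st: "\<And>v. v \<in> ThompsonV \<Longrightarrow> v x = x \<Longrightarrow> \<alpha> v ` S = S"
  obtains y where "S = {y}" "\<And>v. v \<in> ThompsonV \<Longrightarrow> v x = x \<longleftrightarrow> \<alpha> v y = y"
proof -
  obtain s where s: "s \<in> S" using S by blast
  obtain e where e: "e \<in> Q2" "e \<notin> S" using Q2_avoid[OF S(1)] by blast
  \<comment> \<open>Double transitivity in group form: all elements that move x form one double
    coset of V_x.\<close>
  have double_coset: "\<exists>a b. a \<in> ThompsonV \<and> b \<in> ThompsonV \<and> a x = x \<and> b x = x \<and> w = a \<circ> u \<circ> b"
    if u: "u \<in> ThompsonV" "u x \<noteq> x" and w: "w \<in> ThompsonV" "w x \<noteq> x" for u w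
  proof -
    obtain a where a: "a \<in> ThompsonV" "a (u x) = w x" "\<And>z. z \<in> {x} \<Longrightarrow> a z = z"
      using swap_points[of "u x" "w x" "{x}"] u w x by auto
    define b where "b = the_inv (a \<circ> u) \<circ> w"
    have au: "a \<circ> u \<in> ThompsonV" using a u by simp
    have "b x = x" unfolding b_def comp_apply[of "the_inv _"] using a by (intro the_inv_eq V_bij[OF au]) simp
    moreover have "w = a \<circ> u \<circ> b" unfolding b_def by (simp only: V_comp_assoc_inv(2)[OF au])
    moreover have "b \<in> ThompsonV" unfolding b_def by (intro V_comp V_inv au w)
    ultimately show ?thesis using a(1,3) by blast
  qed
  have full: "u x = x" if u: "u \<in> ThompsonV" "\<alpha> u ` S = S" for u
  proof (rule ccontr)
    assume ux: "u x \<noteq> x"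
    have "\<alpha> w ` S = S" if w: "w \<in> ThompsonV" for w
    proof (cases "w x = x")
      case False
      obtain a b where ab: "a \<in> ThompsonV" "b \<in> ThompsonV" "a x = x" "b x = x" "w = a \<circ> u \<circ> b"
        using double_coset[OF u(1) ux w False] by blast
      have e: "\<alpha> w = \<alpha> a \<circ> \<alpha> u \<circ> \<alpha> b" unfolding ab(5) using ab u by (simp add: \<alpha>_comp)
      show ?thesis unfolding e image_comp[symmetric] using st ab u by simp
    qed (use st w in blast)
    moreover obtain v where v: "v \<in> ThompsonV" "v s = e" using V_transitive s S e by blast
    moreover obtain w where "w \<in> ThompsonV" "\<alpha> w = v" using \<alpha>_surj v by blast
    ultimately have "v ` S = S" by blast
    then show False using v s e by blast
  qed
  have "S = {s}"
  proof (rule ccontr)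
    assume "S \<noteq> {s}"
    then obtain s' where s': "s' \<in> S" "s' \<noteq> s" using s by blast
    \<comment> \<open>w2 keeps s and expels s', while w1 below moves S off itself. Preimages of both
      move x, hence share a double coset, and then \<open>\<alpha> a s\<close> lies both in S and in
      its image under w1.\<close>
    obtain w2 where w2: "w2 \<in> ThompsonV" "w2 s' = e" "\<And>z. z \<in> {s} \<Longrightarrow> w2 z = z"
      using swap_points[of s' e "{s}"] s s' S e by blast
    obtain T where T: "finite T" "T \<subseteq> Q2 - S" "card T = card S"
      using infinite_arbitrarily_large[of "Q2 - S" "card S"] infinite_Q2 S(1) by auto
    then obtain f where f: "bij_betw f S T" using S(1) finite_same_card_bij by metis
    obtain w1 where w1: "w1 \<in> ThompsonV" "\<And>z. z \<in> S \<Longrightarrow> w1 z = f z"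
      using V_extend[of S f] S(1,3) T(2) f unfolding bij_betw_def by blast
    have w1S: "w1 ` S \<inter> S = {}" using w1(2) f T(2) unfolding bij_betw_def by auto
    obtain u1 u2 where u: "u1 \<in> ThompsonV" "\<alpha> u1 = w1" "u2 \<in> ThompsonV" "\<alpha> u2 = w2"
      using \<alpha>_surj w1 w2 by metis
    have "u1 x \<noteq> x" using st[OF u(1)] u(2) w1S s by auto
    moreover have "u2 x \<noteq> x" using st[OF u(3)] u(4) w2 s' e by auto
    ultimately obtain a b where ab: "a \<in> ThompsonV" "b \<in> ThompsonV" "a x = x" "b x = x" "u1 = a \<circ> u2 \<circ> b"
      using double_coset u by meson
    have e: "w1 = \<alpha> a \<circ> w2 \<circ> \<alpha> b" using ab u by (metis V_comp \<alpha>_comp)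
    have "s \<in> w2 ` S" using w2 s by (metis imageI singletonI)
    then have "\<alpha> a s \<in> w1 ` S" unfolding e image_comp[symmetric] st[OF ab(2,4)] by blast
    moreover have "\<alpha> a s \<in> S" using st[OF ab(1,3)] s by blast
    ultimately show False using w1S by blast
  qed
  moreover have "v x = x \<longleftrightarrow> \<alpha> v s = s" if "v \<in> ThompsonV" for v
    using st[OF that] full[OF that] \<open>S = {s}\<close> by auto
  ultimately show ?thesis using that by blast
qed

section \<open>Automorphisms of G preserve K\<close>

locale wreath_iso = coeff_group +
  fixes \<theta> \<theta>' :: "(cantor \<Rightarrow> 'a) \<times> (cantor \<Rightarrow> cantor) \<Rightarrow> (cantor \<Rightarrow> 'a) \<times> (cantor \<Rightarrow> cantor)" and g0 :: 'a
  assumes closed [simp]: "g \<in> carrier G \<Longrightarrow> \<theta> g \<in> carrier G"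
    and closed' [simp]: "g \<in> carrier G \<Longrightarrow> \<theta>' g \<in> carrier G"
    and mult: "g \<in> carrier G \<Longrightarrow> h \<in> carrier G \<Longrightarrow> \<theta> (g \<otimes>\<^bsub>G\<^esub> h) = \<theta> g \<otimes>\<^bsub>G\<^esub> \<theta> h"
    and left_inv [simp]: "g \<in> carrier G \<Longrightarrow> \<theta>' (\<theta> g) = g"
    and right_inv [simp]: "g \<in> carrier G \<Longrightarrow> \<theta> (\<theta>' g) = g"
    and g0 [simp]: "g0 \<in> carrier \<Gamma>" "g0 \<noteq> \<one>"
begin

sublocale GG: group G by (rule group_G)

lemma mult': "g \<in> carrier G \<Longrightarrow> h \<in> carrier G \<Longrightarrow> \<theta>' (g \<otimes>\<^bsub>G\<^esub> h) = \<theta>' g \<otimes>\<^bsub>G\<^esub> \<theta>' h"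
  using mult[of "\<theta>' g" "\<theta>' h"] left_inv[of "\<theta>' g \<otimes>\<^bsub>G\<^esub> \<theta>' h"] by simp

text \<open>Every fact proved for \<theta> becomes available for its inverse; the later bijectivity
  statements rest on this symmetry.\<close>

lemma swap: "wreath_iso \<Gamma> \<theta>' \<theta> g0"
  by unfold_locales (simp_all add: mult')

lemma hom_one: "\<theta> \<one>\<^bsub>G\<^esub> = \<one>\<^bsub>G\<^esub>"
  using mult[of "\<one>\<^bsub>G\<^esub>" "\<one>\<^bsub>G\<^esub>"] by (simp add: GG.r_cancel_one')

lemma hom_inv: assumes "g \<in> carrier G" shows "\<theta> (inv\<^bsub>G\<^esub> g) = inv\<^bsub>G\<^esub> \<theta> g"
proof -
  have "\<theta> (inv\<^bsub>G\<^esub> g) \<otimes>\<^bsub>G\<^esub> \<theta> g = \<one>\<^bsub>G\<^esub>" using assms hom_one mult[of "inv\<^bsub>G\<^esub> g" g] by simp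
  then show ?thesis using assms by (simp add: GG.inv_equality)
qed

lemma snd_mult: "snd (g \<otimes>\<^bsub>G\<^esub> h) = snd g \<circ> snd h"
  by (cases g; cases h) simp

lemma snd_inv: "g \<in> carrier G \<Longrightarrow> snd (inv\<^bsub>G\<^esub> g) = the_inv (snd g)"
  by (cases g) (simp add: inv_G)

lemma snd_V [simp]: "g \<in> carrier G \<Longrightarrow> snd g \<in> ThompsonV"
  by (cases g) simp

lemma fst_Kfin [simp]: "g \<in> carrier G \<Longrightarrow> fst g \<in> Kfin \<Gamma>"
  by (cases g) simp

lemma conj_single:
  assumes h: "h \<in> carrier G" and x: "x \<in> Q2" "g \<in> carrier \<Gamma>"
  shows "h \<otimes>\<^bsub>G\<^esub> (single x g, id) \<otimes>\<^bsub>G\<^esub> inv\<^bsub>G\<^esub> h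
    = (single (snd h x) (fst h (snd h x) \<otimes> g \<otimes> inv (fst h (snd h x))), id)"
proof -
  obtain c w where e: "h = (c, w)" "c \<in> Kfin \<Gamma>" "w \<in> ThompsonV" using h by (cases h) auto
  have "c y \<otimes> single x g (the_inv w y) \<otimes> inv (c y) = single (w x) (c (w x) \<otimes> g \<otimes> inv (c (w x))) y" for y
    using e x by (auto simp: single_def the_inv_eq_iff)
  moreover have "w \<circ> the_inv w = id" using e by simp
  ultimately show ?thesis using e by (simp add: inv_G comp_def id_def)
qed

lemma single_commute:
  assumes "x \<in> Q2" "y \<in> Q2" "x \<noteq> y" "g \<in> carrier \<Gamma>" "h \<in> carrier \<Gamma>"
  shows "(single x g, id) \<otimes>\<^bsub>G\<^esub> (single y h, id) = (single y h, id) \<otimes>\<^bsub>G\<^esub> (single x g, id)"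
proof -
  have "single x g z \<otimes> single y h z = single y h z \<otimes> single x g z" for z
    using assms by (auto simp: single_def)
  then show ?thesis by simp
qed

text \<open>If \<open>\<theta>(\<Gamma>\<^sub>x)\<close> were not contained in \<open>K\<close>, then \<open>H = \<theta>(K \<rtimes> V\<^sub>x)\<close> would be all of \<open>G\<close>. Indeed an
  element outside \<open>H\<close> conjugates \<open>n \<in> \<theta>(\<Gamma>\<^sub>x)\<close> to an element commuting with \<open>n\<close>, which forces
  \<open>K \<subseteq> H\<close>; a commutator of \<open>n\<close> with \<open>a \<in> \<Gamma>\<^sub>z\<close> then lies in \<open>\<theta>(\<Gamma>\<^sub>x)\<close> and has support \<open>{z, vz}\<close>, so
  \<open>H\<close> contains the pointwise stabilisers of all such pairs, and these generate \<open>V\<close>.\<close>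

lemma single_to_K:
  assumes x: "x \<in> Q2" and g: "g \<in> carrier \<Gamma>"
  shows "snd (\<theta> (single x g, id)) = id"
proof (rule ccontr)
  define \<kappa> where "\<kappa> = (single x g, id :: cantor \<Rightarrow> cantor)"
  define n where "n = \<theta> \<kappa>"
  define v where "v = snd n"
  assume "snd (\<theta> (single x g, id)) \<noteq> id"
  then have v1: "v \<noteq> id" by (simp add: v_def n_def \<kappa>_def)
  have \<kappa>: "\<kappa> \<in> carrier G" using x g by (simp add: \<kappa>_def)
  then have n: "n \<in> carrier G" by (simp add: n_def)
  then have v: "v \<in> ThompsonV" by (simp add: v_def)
  define H where "H = {h \<in> carrier G. snd (\<theta>' h) x = x}"
  have H_mult: "h \<otimes>\<^bsub>G\<^esub> k \<in> H" if "h \<in> H" "k \<in> H" for h k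
    using that by (simp add: H_def mult' snd_mult)
  have H_inv: "inv\<^bsub>G\<^esub> h \<in> H" if "h \<in> H" for h
    using that wreath_iso.hom_inv[OF swap] by (simp add: H_def snd_inv the_inv_eq)
  have H_comm: "h \<in> H" if h: "h \<in> carrier G" and
    nc: "n \<otimes>\<^bsub>G\<^esub> (h \<otimes>\<^bsub>G\<^esub> n \<otimes>\<^bsub>G\<^esub> inv\<^bsub>G\<^esub> h) \<noteq> (h \<otimes>\<^bsub>G\<^esub> n \<otimes>\<^bsub>G\<^esub> inv\<^bsub>G\<^esub> h) \<otimes>\<^bsub>G\<^esub> n" for h
  proof (rule ccontr)
    assume "h \<notin> H"
    define h' where "h' = \<theta>' h"
    have h': "h' \<in> carrier G" "snd h' x \<noteq> x" "h = \<theta> h'" using h \<open>h \<notin> H\<close> by (simp_all add: H_def h'_def)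
    define k where "k = h' \<otimes>\<^bsub>G\<^esub> \<kappa> \<otimes>\<^bsub>G\<^esub> inv\<^bsub>G\<^esub> h'"
    have k: "k \<in> carrier G" using h' \<kappa> by (simp add: k_def)
    have "\<kappa> \<otimes>\<^bsub>G\<^esub> k = k \<otimes>\<^bsub>G\<^esub> \<kappa>"
      unfolding k_def \<kappa>_def conj_single[OF h'(1) x g]
      by (rule single_commute) (use h' x g in \<open>auto simp: eq_commute[of x]\<close>)
    then have "n \<otimes>\<^bsub>G\<^esub> \<theta> k = \<theta> k \<otimes>\<^bsub>G\<^esub> n" unfolding n_def using mult \<kappa> k by metis
    moreover have "\<theta> k = h \<otimes>\<^bsub>G\<^esub> n \<otimes>\<^bsub>G\<^esub> inv\<^bsub>G\<^esub> h"
      unfolding k_def h'(3) n_def using h'(1) \<kappa> by (simp add: mult hom_inv)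
    ultimately show False using nc by simp
  qed
  obtain w where w: "w \<in> ThompsonV" "v \<circ> (w \<circ> v \<circ> the_inv w) \<noteq> (w \<circ> v \<circ> the_inv w) \<circ> v"
    using noncommuting_conjugate v v1 by blast
  \<comment> \<open>w was chosen from v alone, so one w serves every c, and quotients of two such
    elements sweep out K.\<close>
  have cw: "(c, w) \<in> H" if c: "c \<in> Kfin \<Gamma>" for c
  proof (rule H_comm)
    show cG: "(c, w) \<in> carrier G" using c w by simp
    let ?k = "(c, w) \<otimes>\<^bsub>G\<^esub> n \<otimes>\<^bsub>G\<^esub> inv\<^bsub>G\<^esub> (c, w)"
    have "snd (n \<otimes>\<^bsub>G\<^esub> ?k) = v \<circ> (w \<circ> v \<circ> the_inv w)" "snd (?k \<otimes>\<^bsub>G\<^esub> n) = (w \<circ> v \<circ> the_inv w) \<circ> v"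
      unfolding snd_mult snd_inv[OF cG] v_def snd_conv by simp_all
    then show "n \<otimes>\<^bsub>G\<^esub> ?k \<noteq> ?k \<otimes>\<^bsub>G\<^esub> n" using w(2) by metis
  qed
  have KH: "(c, id) \<in> H" if c: "c \<in> Kfin \<Gamma>" for c
  proof -
    have "(c, w) \<otimes>\<^bsub>G\<^esub> inv\<^bsub>G\<^esub> (kone \<Gamma>, w) \<in> H" using cw[OF c] cw[OF kone_Kfin] H_mult H_inv by blast
    moreover have "(c, w) \<otimes>\<^bsub>G\<^esub> inv\<^bsub>G\<^esub> (kone \<Gamma>, w) = (c, id)"
      using c w(1) by (simp add: inv_G) (simp add: kone_def)
    ultimately show ?thesis by simp
  qed
  have stab: "(kone \<Gamma>, t) \<in> H" if z: "z \<in> Q2" "v z \<noteq> z" and t: "t \<in> ThompsonV" "t z = z" "t (v z) = v z" for z t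
  proof -
    define a where "a = (single z g0, id :: cantor \<Rightarrow> cantor)"
    have a: "a \<in> carrier G" using z by (simp add: a_def)
    \<comment> \<open>Read as a conjugate of a times its inverse, k lives on z and
      \<open>v z\<close>. Regrouped as n times a conjugate of its inverse by a, it lies in
      \<theta>(\<Gamma>_x), because a is in H.\<close>
    define k where "k = n \<otimes>\<^bsub>G\<^esub> a \<otimes>\<^bsub>G\<^esub> inv\<^bsub>G\<^esub> n \<otimes>\<^bsub>G\<^esub> inv\<^bsub>G\<^esub> a"
    have k: "k \<in> carrier G" using n a by (simp add: k_def)
    define g1 where "g1 = fst n (v z) \<otimes> g0 \<otimes> inv (fst n (v z))"
    have kk: "k = (\<lambda>y. single (v z) g1 y \<otimes> inv (single z g0 y), id)"
      unfolding k_def a_def conj_single[OF n z(1) g0(1)] using z(1) by (simp add: inv_G v_def g1_def)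
    have kz: "fst k z \<noteq> \<one>" using z by (auto simp: kk single_def)
    define a' where "a' = \<theta>' a"
    have a': "a' \<in> carrier G" "snd a' x = x" using KH[of "single z g0"] z by (auto simp: a'_def a_def H_def)
    define g2 where "g2 = fst a' x \<otimes> inv g \<otimes> inv (fst a' x)"
    have g2: "g2 \<in> carrier \<Gamma>" using a' g by (simp add: g2_def)
    have i\<kappa>: "inv\<^bsub>G\<^esub> \<kappa> = (single x (inv g), id)"
      using x g unfolding \<kappa>_def by (simp add: inv_G) (auto simp: single_def)
    have "k = n \<otimes>\<^bsub>G\<^esub> (a \<otimes>\<^bsub>G\<^esub> inv\<^bsub>G\<^esub> n \<otimes>\<^bsub>G\<^esub> inv\<^bsub>G\<^esub> a)" using n a by (simp add: k_def GG.m_assoc)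
    then have "\<theta>' k = \<kappa> \<otimes>\<^bsub>G\<^esub> (a' \<otimes>\<^bsub>G\<^esub> inv\<^bsub>G\<^esub> \<kappa> \<otimes>\<^bsub>G\<^esub> inv\<^bsub>G\<^esub> a')"
      using n a \<kappa> by (simp add: mult' wreath_iso.hom_inv[OF swap] a'_def n_def)
    also have "a' \<otimes>\<^bsub>G\<^esub> inv\<^bsub>G\<^esub> \<kappa> \<otimes>\<^bsub>G\<^esub> inv\<^bsub>G\<^esub> a' = (single x g2, id)"
      unfolding i\<kappa> using conj_single[OF a'(1) x] g a'(2) by (simp add: g2_def)
    also have "\<kappa> \<otimes>\<^bsub>G\<^esub> (single x g2, id) = (single x (g \<otimes> g2), id)"
      by (auto simp: \<kappa>_def single_def)
    finally have \<theta>k: "\<theta>' k = (single x (g \<otimes> g2), id)" .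
    have "g \<otimes> g2 \<noteq> \<one>"
    proof
      assume "g \<otimes> g2 = \<one>"
      then have "\<theta>' k = \<one>\<^bsub>G\<^esub>" unfolding \<theta>k one_G kone_def single_def by (metis (no_types))
      then have "k = \<one>\<^bsub>G\<^esub>" using k hom_one right_inv by metis
      then show False using kz by (simp add: one_G kone_def)
    qed
    define t' where "t' = \<theta>' (kone \<Gamma>, t)"
    have tG: "(kone \<Gamma>, t) \<in> carrier G" using t by simp
    then have t': "t' \<in> carrier G" by (simp add: t'_def)
    \<comment> \<open>t fixes both points of the support of k, hence commutes with k. Its preimage
      then commutes with a nontrivial element of \<Gamma>_x, and comparing supports shows that it
      fixes x.\<close>
    have tk: "fst k (the_inv t y) = fst k y" for y
      using t by (auto simp: kk single_def the_inv_eq_iff)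
    obtain kf where kf: "k = (kf, id)" using kk by blast
    have "(kone \<Gamma>, t) \<otimes>\<^bsub>G\<^esub> (kf, id) = (kf, id) \<otimes>\<^bsub>G\<^esub> (kone \<Gamma>, t)"
      using tk k unfolding kf by (simp add: kone_def)
    then have "(kone \<Gamma>, t) \<otimes>\<^bsub>G\<^esub> k = k \<otimes>\<^bsub>G\<^esub> (kone \<Gamma>, t)" by (simp only: kf)
    then have "t' \<otimes>\<^bsub>G\<^esub> \<theta>' k = \<theta>' k \<otimes>\<^bsub>G\<^esub> t'" unfolding t'_def using mult' tG k by metis
    then have "t' \<otimes>\<^bsub>G\<^esub> \<theta>' k \<otimes>\<^bsub>G\<^esub> inv\<^bsub>G\<^esub> t' = \<theta>' k" using t' k by (simp add: GG.m_assoc)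
    then have "single (snd t' x) (fst t' (snd t' x) \<otimes> (g \<otimes> g2) \<otimes> inv (fst t' (snd t' x))) = single x (g \<otimes> g2)"
      unfolding \<theta>k using conj_single[OF t' x, of "g \<otimes> g2"] g g2 by simp
    from fun_cong[OF this, of x] have "snd t' x = x" using \<open>g \<otimes> g2 \<noteq> \<one>\<close> by (auto simp: single_def split: if_splits)
    then show ?thesis using tG by (simp add: H_def t'_def)
  qed
  define L where "L = {t \<in> ThompsonV. (kone \<Gamma>, t) \<in> H}"
  have inf: "infinite {x \<in> Q2. v x \<noteq> x}" using moved_infinite v v1 by blast
  have v_inj: "v x = v y \<longleftrightarrow> x = y" for x y using bij_is_inj[OF V_bij[OF v]] by (simp add: inj_eq)
  obtain z where z: "z \<in> Q2" "v z \<noteq> z" using not_finite_existsD[OF inf] by blast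
  have "\<not> {x \<in> Q2. v x \<noteq> x} \<subseteq> {z, v z, the_inv v z}" using inf finite_subset by blast
  then obtain y where y: "y \<in> Q2" "v y \<noteq> y" "y \<notin> {z, v z, the_inv v z}" by blast
  have "ThompsonV \<subseteq> L"
  proof (rule stabilisers_generate[of L z "v z" y "v y"])
    show "s \<circ> t \<in> L" if "s \<in> L" "t \<in> L" for s t
    proof -
      have "(kone \<Gamma>, s) \<otimes>\<^bsub>G\<^esub> (kone \<Gamma>, t) = (kone \<Gamma>, s \<circ> t)" by (simp add: kone_def)
      then show ?thesis using that H_mult unfolding L_def by (metis (mono_tags, lifting) V_comp mem_Collect_eq)
    qed
    show "the_inv s \<in> L" if "s \<in> L" for s
    proof -
      have s: "s \<in> ThompsonV" "(kone \<Gamma>, s) \<in> H" using that by (simp_all add: L_def)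
      have "inv\<^bsub>G\<^esub> (kone \<Gamma>, s) = (kone \<Gamma>, the_inv s)" using s(1) by (simp add: inv_G) (simp add: kone_def)
      then show ?thesis using H_inv[OF s(2)] s(1) by (simp add: L_def)
    qed
    show "distinct [z, v z, y, v y]" using z y V_bij[OF v] v_inj by auto
  qed (use stab z y v in \<open>auto simp: L_def\<close>)
  obtain u where u: "u \<in> ThompsonV" "u x \<noteq> x"
    using stabiliser_determines_point V_transitive[OF x] Q2_avoid[of "{x}"] by (metis finite.emptyI finite.insertI insertI1)
  have "(kone \<Gamma>, u) \<in> carrier G" using u by simp
  moreover have "h \<in> H" if "h \<in> carrier G" for h
  proof -
    obtain c t where e: "h = (c, t)" "c \<in> Kfin \<Gamma>" "t \<in> ThompsonV"
      using \<open>h \<in> carrier G\<close> by (cases h) auto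
    have "(c, id) \<otimes>\<^bsub>G\<^esub> (kone \<Gamma>, t) = h" using e by (simp add: kone_def)
    moreover have "(kone \<Gamma>, t) \<in> H" using \<open>ThompsonV \<subseteq> L\<close> e by (auto simp: L_def)
    ultimately show ?thesis using KH[OF e(2)] H_mult by metis
  qed
  ultimately have "\<theta> (kone \<Gamma>, u) \<in> H" by simp
  then show False using u by (simp add: H_def)
qed

text \<open>K is generated by the subgroups \<Gamma>_x. The induction runs over a finite set
  containing the support; points of it off Q2 contribute nothing, since a is 1 there.\<close>

lemma Kfin_induct:
  assumes "a \<in> Kfin \<Gamma>" "P (kone \<Gamma>)"
    and step: "\<And>x g b. x \<in> Q2 \<Longrightarrow> g \<in> carrier \<Gamma> \<Longrightarrow> b \<in> Kfin \<Gamma> \<Longrightarrow> P b \<Longrightarrow> P (\<lambda>y. single x g y \<otimes> b y)"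
  shows "P a"
proof -
  have "P a" if "finite F" "a \<in> Kfin \<Gamma>" "{x. a x \<noteq> \<one>} \<subseteq> F" for F a
    using that
  proof (induction F arbitrary: a)
    case empty
    then have "a = kone \<Gamma>" by (auto simp: kone_def)
    then show ?case using assms(2) by simp
  next
    case (insert x F)
    define b where "b = (\<lambda>y. if y = x then \<one> else a y)"
    have b: "b \<in> Kfin \<Gamma>"
      by (rule KfinI[of _ "{x. a x \<noteq> \<one>}"]) (use insert.prems in \<open>auto simp: b_def Kfin_finite\<close>)
    have Pb: "P b" by (rule insert.IH[OF b]) (use insert.prems in \<open>auto simp: b_def\<close>)
    show ?case
    proof (cases "x \<in> Q2")
      case True
      have "a = (\<lambda>y. single x (a x) y \<otimes> b y)" using insert.prems by (auto simp: b_def single_def)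
      then show ?thesis using step[OF True _ b Pb, of "a x"] insert.prems by simp
    next
      case False
      then have "b = a" using insert.prems by (auto simp: b_def)
      then show ?thesis using Pb by simp
    qed
  qed
  then show ?thesis using assms(1) Kfin_finite by blast
qed

lemma K_to_K: assumes "a \<in> Kfin \<Gamma>" shows "snd (\<theta> (a, id)) = id"
proof (rule Kfin_induct[OF assms, where P = "\<lambda>a. snd (\<theta> (a, id)) = id"], goal_cases)
  case 1
  then show ?case using hom_one unfolding one_G by (metis snd_conv)
next
  case (2 x g b)
  have "(\<lambda>y. single x g y \<otimes> b y, id :: cantor \<Rightarrow> cantor) = (single x g, id) \<otimes>\<^bsub>G\<^esub> (b, id)" by simp
  then have "\<theta> (\<lambda>y. single x g y \<otimes> b y, id) = \<theta> (single x g, id) \<otimes>\<^bsub>G\<^esub> \<theta> (b, id)"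
    using 2 mult[of "(single x g, id)" "(b, id)"] by simp
  then show ?case using single_to_K[OF 2(1,2)] 2(4) by (simp add: snd_mult)
qed

section \<open>The induced automorphism of V and permutation of Q2\<close>

definition induced :: "(cantor \<Rightarrow> cantor) \<Rightarrow> cantor \<Rightarrow> cantor" where
  "induced v = snd (\<theta> (kone \<Gamma>, v))"

lemma split_G: "a \<in> Kfin \<Gamma> \<Longrightarrow> (a, v) = (a, id) \<otimes>\<^bsub>G\<^esub> (kone \<Gamma>, v)"
  by (simp add: kone_def)

text \<open>As K is preserved, the V-part of an image depends only on the V-part of the argument, so
  \<open>induced\<close> may be computed with any a.\<close>

lemma snd_hom: "a \<in> Kfin \<Gamma> \<Longrightarrow> v \<in> ThompsonV \<Longrightarrow> snd (\<theta> (a, v)) = induced v"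
  using split_G[of a v] mult[of "(a, id)" "(kone \<Gamma>, v)"] by (simp add: snd_mult K_to_K induced_def)

lemma induced_V [simp]: "v \<in> ThompsonV \<Longrightarrow> induced v \<in> ThompsonV"
  by (simp add: induced_def)

lemma kone_mult: "(kone \<Gamma>, v) \<otimes>\<^bsub>G\<^esub> (kone \<Gamma>, w) = (kone \<Gamma>, v \<circ> w)"
  by (simp add: kone_def)

lemma induced_comp: "v \<in> ThompsonV \<Longrightarrow> w \<in> ThompsonV \<Longrightarrow> induced (v \<circ> w) = induced v \<circ> induced w"
  using mult[of "(kone \<Gamma>, v)" "(kone \<Gamma>, w)", unfolded kone_mult] by (simp add: induced_def snd_mult)

lemma induced_inverse: assumes "v \<in> ThompsonV" shows "wreath_iso.induced \<Gamma> \<theta>' (induced v) = v"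
proof -
  interpret R: wreath_iso \<Gamma> \<theta>' \<theta> g0 by (rule swap)
  obtain c w where e: "\<theta> (kone \<Gamma>, v) = (c, w)" by (cases "\<theta> (kone \<Gamma>, v)")
  then have cw: "c \<in> Kfin \<Gamma>" "w \<in> ThompsonV" using closed[of "(kone \<Gamma>, v)"] assms by simp_all
  have "w = induced v" by (simp add: induced_def e)
  then show ?thesis using R.snd_hom[OF cw] left_inv[of "(kone \<Gamma>, v)"] assms e by simp
qed

text \<open>v commutes with \<Gamma>_x when it fixes x. The image of this relation permutes points
  by \<open>induced v\<close> and conjugates values by c, and conjugation does not change where a
  value is trivial.\<close>

lemma support_invariant:
  assumes x: "x \<in> Q2" "g \<in> carrier \<Gamma>" and v: "v \<in> ThompsonV" "v x = x"
  shows "induced v ` {y. fst (\<theta> (single x g, id)) y \<noteq> \<one>} = {y. fst (\<theta> (single x g, id)) y \<noteq> \<one>}"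
proof -
  let ?S = "{y. fst (\<theta> (single x g, id)) y \<noteq> \<one>}"
  define d where "d = fst (\<theta> (single x g, id))"
  define c where "c = fst (\<theta> (kone \<Gamma>, v))"
  have d: "\<theta> (single x g, id) = (d, id)" using K_to_K[of "single x g"] x by (metis d_def prod.collapse single_Kfin)
  have c: "\<theta> (kone \<Gamma>, v) = (c, induced v)" by (simp add: c_def induced_def)
  have dK: "d \<in> Kfin \<Gamma>" using x by (simp add: d_def)
  have cK: "c \<in> Kfin \<Gamma>" using v by (simp add: c_def)
  have "single x g (the_inv v y) = single x g y" for y
    using v by (auto simp: single_def the_inv_eq_iff)
  then have "(kone \<Gamma>, v) \<otimes>\<^bsub>G\<^esub> (single x g, id) = (single x g, id) \<otimes>\<^bsub>G\<^esub> (kone \<Gamma>, v)"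
    using x by (simp add: kone_def single_def)
  then have "(c, induced v) \<otimes>\<^bsub>G\<^esub> (d, id) = (d, id) \<otimes>\<^bsub>G\<^esub> (c, induced v)"
    using mult[of "(kone \<Gamma>, v)" "(single x g, id)"] mult[of "(single x g, id)" "(kone \<Gamma>, v)"] x v
    unfolding c d by simp
  then have e: "c y \<otimes> d (the_inv (induced v) y) = d y \<otimes> c y" for y by (simp add: fun_eq_iff)
  have iff: "d (the_inv (induced v) y) = \<one> \<longleftrightarrow> d y = \<one>" for y
    using e[of y] dK cK by (metis Kfin_closed l_one r_one l_cancel r_cancel one_closed)
  have bij: "bij (induced v)" using v by simp
  have "induced v y \<in> {y. d y \<noteq> \<one>} \<longleftrightarrow> y \<in> {y. d y \<noteq> \<one>}" for y
    using iff[of "induced v y"] bij by simp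
  moreover have "y \<in> induced v ` {y. d y \<noteq> \<one>}" if "y \<in> {y. d y \<noteq> \<one>}" for y
    using iff[of y] that bij by (intro image_eqI[of _ _ "the_inv (induced v) y"]) simp_all
  ultimately show ?thesis unfolding d_def[symmetric] by blast
qed

lemma point_exists:
  assumes x: "x \<in> Q2"
  shows "\<exists>y\<in>Q2. \<forall>v\<in>ThompsonV. v x = x \<longleftrightarrow> induced v y = y"
proof -
  interpret R: wreath_iso \<Gamma> \<theta>' \<theta> g0 by (rule swap)
  let ?d = "fst (\<theta> (single x g0, id))"
  let ?S = "{y. ?d y \<noteq> \<one>}"
  have dK: "?d \<in> Kfin \<Gamma>" using x by simp
  have S: "finite ?S" "?S \<subseteq> Q2" using Kfin_finite[OF dK] Kfin_off[OF dK] by auto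
  have ne: "?S \<noteq> {}"
  proof
    assume "?S = {}"
    then have "\<theta> (single x g0, id) = \<one>\<^bsub>G\<^esub>"
      using K_to_K[of "single x g0"] x by (simp add: one_G kone_def prod_eq_iff fun_eq_iff)
    then have "(single x g0, id) = \<one>\<^bsub>G\<^esub>"
      using left_inv[of "(single x g0, id)"] R.hom_one x by simp
    then have "single x g0 x = kone \<Gamma> x" by (simp add: one_G)
    then show False by (simp add: kone_def)
  qed
  obtain y where "?S = {y}" "\<And>v. v \<in> ThompsonV \<Longrightarrow> v x = x \<longleftrightarrow> induced v y = y"
  proof (rule stabiliser_image[of induced ?S x])
    show "\<exists>v\<in>ThompsonV. induced v = w" if "w \<in> ThompsonV" for w
      using R.induced_inverse[OF that] R.induced_V[OF that] by blast
    show "induced v ` ?S = ?S" if "v \<in> ThompsonV" "v x = x" for v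
      using support_invariant[OF x g0(1) that] .
  qed (assumption | rule S ne x induced_V induced_comp that)+
  then show ?thesis using S by blast
qed

definition point :: "cantor \<Rightarrow> cantor" where
  "point x = (SOME y. y \<in> Q2 \<and> (\<forall>v\<in>ThompsonV. v x = x \<longleftrightarrow> induced v y = y))"

lemma point:
  assumes "x \<in> Q2"
  shows "point x \<in> Q2" "v \<in> ThompsonV \<Longrightarrow> induced v (point x) = point x \<longleftrightarrow> v x = x"
proof -
  have "\<exists>y. y \<in> Q2 \<and> (\<forall>v\<in>ThompsonV. v x = x \<longleftrightarrow> induced v y = y)"
    using point_exists[OF assms] by blast
  from someI_ex[OF this]
  have "point x \<in> Q2 \<and> (\<forall>v\<in>ThompsonV. v x = x \<longleftrightarrow> induced v (point x) = point x)"
    unfolding point_def .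
  then show "point x \<in> Q2" "v \<in> ThompsonV \<Longrightarrow> induced v (point x) = point x \<longleftrightarrow> v x = x" by blast+
qed

lemma point_inverse:
  assumes "x \<in> Q2" shows "wreath_iso.point \<Gamma> \<theta>' (point x) = x"
proof -
  interpret R: wreath_iso \<Gamma> \<theta>' \<theta> g0 by (rule swap)
  show ?thesis
  proof (rule stabiliser_determines_point[symmetric])
    fix v assume v: "v \<in> ThompsonV" "v x = x"
    then have "induced v (point x) = point x" using point assms by blast
    then have "R.induced (induced v) (R.point (point x)) = R.point (point x)"
      using R.point(2)[OF point(1)[OF assms]] v by simp
    then show "v (R.point (point x)) = R.point (point x)" using induced_inverse v by simp
  qed (use assms point R.point in auto)
qed

text \<open>Stabilisers are compared: u fixes \<open>v x\<close> exactly when its conjugate t by v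
  fixes x.\<close>

lemma point_equivariant:
  assumes x: "x \<in> Q2" and v: "v \<in> ThompsonV"
  shows "point (v x) = induced v (point x)"
proof (rule stabiliser_determines_point)
  interpret R: wreath_iso \<Gamma> \<theta>' \<theta> g0 by (rule swap)
  fix w assume w: "w \<in> ThompsonV" "w (point (v x)) = point (v x)"
  define u where "u = R.induced w"
  have u: "u \<in> ThompsonV" "induced u = w" using w R.induced_inverse by (simp_all add: u_def)
  have vx: "v x \<in> Q2" using x v by simp
  have uv: "u (v x) = v x" using w(2) u point(2)[OF vx u(1)] by simp
  define t where "t = the_inv v \<circ> (u \<circ> v)"
  have t: "t \<in> ThompsonV" "v \<circ> t = u \<circ> v" unfolding t_def using v u V_comp_assoc_inv(2)[OF v] by simp_all
  have "t x = x" using uv v by (simp add: t_def)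
  then have "induced t (point x) = point x" using point x t by blast
  moreover have "induced v \<circ> induced t = w \<circ> induced v" using t u v induced_comp by metis
  ultimately show "w (induced v (point x)) = induced v (point x)" by (metis comp_apply)
qed (use point x v in simp_all)

end

section \<open>Surjectivity of \<open>\<Xi>\<close>\<close>

lemma involution_fix_open:
  assumes u: "u \<in> ThompsonV" "u \<circ> u = id"
  obtains N where "\<And>x y. pre N x = pre N y \<Longrightarrow> u x = x \<longleftrightarrow> u y = y"
proof -
  obtain N where N: "\<And>n x. N \<le> n \<Longrightarrow> \<exists>m'. affine u (pre n x) m'" using V_affine u by blast
  have "u y = y" if e: "pre N x = pre N y" and ux: "u x = x" for x y
  proof -
    obtain m' where m': "affine u (pre N x) m'" using N by blast
    \<comment> \<open>The chain rule for u o u = id makes twice the logarithmic slope vanish, so u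
      is the identity on the cylinder at the uniform depth N.\<close>
    have "0 = log_slope u x + log_slope u x" using log_slope_comp[OF u(1) u(1), of x] ux u(2) by simp
    then have "length m' = N" using log_slope_eq[OF m' in_cyl_pre] by simp
    moreover have "x = prepend m' (shift N x)" using affine_at[OF m'] ux by simp
    ultimately have "m' = pre N x" by (metis pre_prepend)
    then show ?thesis using m' e by (metis affine_at prepend_pre_shift)
  qed
  with that show ?thesis by metis
qed

text \<open>Exchanging the two halves of a cylinder changes the letter after m, so no point of it
  stays in place. Membership in the cylinder becomes a property of an element of V.\<close>

lemma flip_moves:
  "swp (m @ [False]) (m @ [True]) z \<noteq> z \<longleftrightarrow> z \<in> cyl m"
proof -
  have len: "length (m @ [False]) = length (m @ [True])" by simp
  have ne: "prepend (m @ [False]) y \<noteq> prepend (m @ [True]) y'" for y y'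
    using prepend_eqD[of "m @ [False]" y "m @ [True]" y'] by auto
  show ?thesis
  proof (cases "z \<in> cyl (m @ [False]) \<or> z \<in> cyl (m @ [True])")
    case True
    then obtain y where y: "z = prepend (m @ [False]) y \<or> z = prepend (m @ [True]) y" by (auto elim: cylE)
    then have "swp (m @ [False]) (m @ [True]) z \<noteq> z"
      using swp_left[OF len, of y] swp_right[OF len, of y] ne[of y y] by metis
    moreover have "z \<in> cyl m" using y by (metis prepend_append prepend_in_cyl)
    ultimately show ?thesis by simp
  next
    case False
    have "z \<notin> cyl m"
    proof
      assume "z \<in> cyl m"
      then obtain y where "z = prepend m y" by (rule cylE)
      moreover have "y = prepend [y 0] (shift 1 y)" by (auto simp: prepend_def shift_def fun_eq_iff)
      ultimately have "z = prepend (m @ [y 0]) (shift 1 y)" by (simp add: prepend_append)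
      then have "z \<in> cyl (m @ [y 0])" by (metis prepend_in_cyl)
      then show False using False by (cases "y 0") auto
    qed
    then show ?thesis using False swp_other[OF len] by simp
  qed
qed

text \<open>The trace of \<open>C\<^sub>m\<close> on \<open>Q2\<close> is the set of points moved by an involution in \<open>V\<close>; its preimage is
  again of this kind, and such sets are clopen.\<close>

lemma equivariant_uniformly_continuous:
  assumes inj: "inj_on f Q2"
    and \<beta>: "\<And>w. w \<in> ThompsonV \<Longrightarrow> \<beta> w \<in> ThompsonV" "\<beta> id = id"
      "\<And>v w. v \<in> ThompsonV \<Longrightarrow> w \<in> ThompsonV \<Longrightarrow> \<beta> (v \<circ> w) = \<beta> v \<circ> \<beta> w"
    and eq: "\<And>w x. w \<in> ThompsonV \<Longrightarrow> x \<in> Q2 \<Longrightarrow> f (\<beta> w x) = w (f x)"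
  shows "\<exists>N. \<forall>x\<in>Q2. \<forall>y\<in>Q2. pre N x = pre N y \<longrightarrow> pre n (f x) = pre n (f y)"
proof -
  have "\<exists>N. \<forall>x\<in>Q2. \<forall>y\<in>Q2. pre N x = pre N y \<longrightarrow> (f x \<in> cyl m \<longleftrightarrow> f y \<in> cyl m)" for m
  proof -
    define w where "w = swp (m @ [False]) (m @ [True])"
    have w: "w \<in> ThompsonV" "w \<circ> w = id" unfolding w_def
      by (simp add: swp_V, rule ext, simp add: swp_invol)
    have u: "\<beta> w \<in> ThompsonV" "\<beta> w \<circ> \<beta> w = id" using \<beta> w by metis+
    obtain N where N: "\<And>x y. pre N x = pre N y \<Longrightarrow> \<beta> w x = x \<longleftrightarrow> \<beta> w y = y"
      using involution_fix_open u by blast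
    have "f x \<in> cyl m \<longleftrightarrow> \<beta> w x \<noteq> x" if "x \<in> Q2" for x
      using flip_moves[of m "f x"] eq[OF w(1) that] inj that u(1) unfolding w_def[symmetric]
      by (metis V_Q2 inj_on_eq_iff)
    then show ?thesis using N by blast
  qed
  then obtain N where N: "\<And>m x y. x \<in> Q2 \<Longrightarrow> y \<in> Q2 \<Longrightarrow> pre (N m) x = pre (N m) y \<Longrightarrow> f x \<in> cyl m \<longleftrightarrow> f y \<in> cyl m"
    by metis
  \<comment> \<open>One depth for all words of length n, each of which came with its own.\<close>
  define M where "M = sum_list (map N (words n))"
  have "pre n (f x) = pre n (f y)" if xy: "x \<in> Q2" "y \<in> Q2" "pre M x = pre M y" for x y
  proof -
    have "N (pre n (f x)) \<le> M" unfolding M_def by (rule member_le_sum_list) (simp_all add: words)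
    then have "pre (N (pre n (f x))) x = pre (N (pre n (f x))) y" using xy(3) by (simp add: pre_eq_iff)
    then have "f y \<in> cyl (pre n (f x))" using N[OF xy(1,2)] in_cyl_pre by blast
    then show ?thesis by (simp add: cyl_iff)
  qed
  then show ?thesis by blast
qed

text \<open>Digit i is read from f at a truncation of x padded with zeros, which lies in Q2.
  Uniformity lets the truncation depth depend on i but not on x.\<close>

lemma uniformly_continuous_extend:
  assumes uc: "\<And>n. \<exists>N. \<forall>x\<in>Q2. \<forall>y\<in>Q2. pre N x = pre N y \<longrightarrow> pre n (f x) = pre n (f y)"
  obtains g where "cantor_cont g" "\<And>x. x \<in> Q2 \<Longrightarrow> g x = f x"
proof -
  obtain N where N: "\<And>n x y. x \<in> Q2 \<Longrightarrow> y \<in> Q2 \<Longrightarrow> pre (N n) x = pre (N n) y \<Longrightarrow> pre n (f x) = pre n (f y)"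
    using uc by metis
  define tr where "tr n x = prepend (pre n x) zero_seq" for n x
  have tr: "tr n x \<in> Q2" "pre n (tr n x) = pre n x" for n x
    using pre_prepend[of "pre n x" zero_seq] by (simp_all add: tr_def)
  define g where "g x = (\<lambda>i. f (tr (N (Suc i)) x) i)" for x
  have "g x = f x" if x: "x \<in> Q2" for x
  proof
    fix i
    have "pre (Suc i) (f (tr (N (Suc i)) x)) = pre (Suc i) (f x)" using N tr x by blast
    then show "g x i = f x i" by (simp add: g_def pre_eq_iff)
  qed
  moreover have "cantor_cont g" unfolding cantor_cont_def
  proof (intro allI)
    fix x n
    let ?M = "\<Sum>i<n. N (Suc i)"
    have "g y i = g x i" if y: "\<forall>i<?M. y i = x i" and i: "i < n" for y i
    proof -
      have "N (Suc i) \<le> ?M" by (rule member_le_sum) (use i in auto)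
      then have "pre (N (Suc i)) y = pre (N (Suc i)) x" using y by (simp add: pre_eq_iff)
      then show ?thesis by (simp add: g_def tr_def)
    qed
    then show "\<exists>m. \<forall>y. (\<forall>i<m. y i = x i) \<longrightarrow> (\<forall>i<n. g y i = g x i)" by blast
  qed
  ultimately show ?thesis using that by blast
qed

text \<open>The swapped prefixes both extend the common prefix of length n, so nothing outside that
  cylinder moves.\<close>

lemma swap_near:
  assumes "x \<in> Q2" "y \<in> Q2" "pre n y = pre n x"
  obtains v where "v \<in> ThompsonV" "v x = y" "\<And>z. pre n z \<noteq> pre n x \<Longrightarrow> v z = z"
proof -
  obtain a where a: "\<And>k. a \<le> k \<Longrightarrow> shift k x = zero_seq" using Q2_eventually_zero assms(1) by blast
  obtain b where b: "\<And>k. b \<le> k \<Longrightarrow> shift k y = zero_seq" using Q2_eventually_zero assms(2) by blast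
  let ?k = "max n (max a b)"
  have "shift ?k x = zero_seq" "shift ?k y = zero_seq" using a b by auto
  then have e: "x = prepend (pre ?k x) zero_seq" "y = prepend (pre ?k y) zero_seq" by (metis prepend_pre_shift)+
  have 2: "swp (pre ?k x) (pre ?k y) x = y" by (metis e length_pre swp_left)
  have 3: "swp (pre ?k x) (pre ?k y) z = z" if z: "pre n z \<noteq> pre n x" for z
  proof (rule swp_other)
    show "z \<notin> cyl (pre ?k x)" "z \<notin> cyl (pre ?k y)"
      using z assms(3) take_pre[of n ?k] by (metis cyl_iff length_pre max.cobounded1)+
  qed simp
  show ?thesis using that[of "swp (pre ?k x) (pre ?k y)"] swp_V[of "pre ?k x" "pre ?k y"] 2 3 by simp
qed

context wreath_iso
begin

lemma point_uniformly_continuous: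
  "\<exists>N. \<forall>x\<in>Q2. \<forall>y\<in>Q2. pre N x = pre N y \<longrightarrow> pre n (point x) = pre n (point y)"
proof -
  interpret R: wreath_iso \<Gamma> \<theta>' \<theta> g0 by (rule swap)
  show ?thesis
  proof (rule equivariant_uniformly_continuous[of point R.induced])
    show "inj_on point Q2" by (rule inj_on_inverseI) (rule point_inverse)
    show "R.induced id = id" using R.hom_one unfolding R.induced_def one_G by simp
    show "point (R.induced w x) = w (point x)" if "w \<in> ThompsonV" "x \<in> Q2" for w x
      using point_equivariant[OF that(2) R.induced_V[OF that(1)]] R.induced_inverse[OF that(1)] by simp
  qed (assumption | rule R.induced_V R.induced_comp)+
qed

text \<open>The point maps of \<theta> and of its inverse extend separately. Being mutually inverse
  and the conjugation formula are checked on the dense set Q2 and pass to the closure.\<close>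

lemma point_extends:
  obtains \<phi> where "\<phi> \<in> StabN" "\<And>v. v \<in> ThompsonV \<Longrightarrow> \<phi> \<circ> v \<circ> the_inv \<phi> = induced v"
proof -
  interpret R: wreath_iso \<Gamma> \<theta>' \<theta> g0 by (rule swap)
  obtain \<phi> where \<phi>: "cantor_cont \<phi>" "\<And>x. x \<in> Q2 \<Longrightarrow> \<phi> x = point x"
    using uniformly_continuous_extend[OF point_uniformly_continuous] by blast
  obtain \<psi> where \<psi>: "cantor_cont \<psi>" "\<And>x. x \<in> Q2 \<Longrightarrow> \<psi> x = R.point x"
    using uniformly_continuous_extend[OF R.point_uniformly_continuous] by blast
  have id_cont: "cantor_cont id" by simp
  have 1: "\<phi> \<circ> \<psi> = id"
    by (rule cont_eq[OF cont_comp[OF \<phi>(1) \<psi>(1)] id_cont]) (use \<phi>(2) \<psi>(2) R.point(1) R.point_inverse in simp)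
  have 2: "\<psi> \<circ> \<phi> = id"
    by (rule cont_eq[OF cont_comp[OF \<psi>(1) \<phi>(1)] id_cont]) (use \<phi>(2) \<psi>(2) point(1) point_inverse in simp)
  have b: "bij \<phi>" using 1 2 by (rule o_bij[rotated])
  have i: "the_inv \<phi> = \<psi>" using 1 2 by (rule the_inv_unique)
  have conj: "\<phi> \<circ> v \<circ> \<psi> = induced v" if v: "v \<in> ThompsonV" for v
  proof (rule cont_eq)
    show "cantor_cont (\<phi> \<circ> v \<circ> \<psi>)" using \<phi>(1) \<psi>(1) v by (intro cont_comp) simp_all
    show "cantor_cont (induced v)" using v by simp
    fix x assume x: "x \<in> Q2"
    have px: "R.point x \<in> Q2" using x by (rule R.point)
    show "(\<phi> \<circ> v \<circ> \<psi>) x = induced v x"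
      using \<psi>(2)[OF x] \<phi>(2)[of "v (R.point x)"] px v point_equivariant[OF px v] R.point_inverse[OF x] by simp
  qed
  have "\<phi> \<in> NormV"
  proof (rule NormVI)
    show "\<phi> \<in> Homeo" using b \<phi>(1) \<psi>(1) i by (simp add: Homeo_def)
    fix v assume v: "v \<in> ThompsonV"
    show "\<phi> \<circ> v \<circ> the_inv \<phi> \<in> ThompsonV" unfolding i conj[OF v] using v by simp
    define u where "u = R.induced v"
    have u: "u \<in> ThompsonV" using v by (simp add: u_def)
    have "v = \<phi> \<circ> u \<circ> \<psi>" using conj[OF u] R.induced_inverse[OF v] by (simp add: u_def)
    then have "the_inv \<phi> \<circ> v \<circ> \<phi> = u" using conj_cancel(1)[OF b, of u] unfolding i by simp
    then show "the_inv \<phi> \<circ> v \<circ> \<phi> \<in> ThompsonV" using u by simp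
  qed
  moreover have "\<phi> x \<in> Q2 \<longleftrightarrow> x \<in> Q2" for x
  proof
    show "x \<in> Q2 \<Longrightarrow> \<phi> x \<in> Q2" using \<phi>(2) point(1) by simp
    assume "\<phi> x \<in> Q2"
    then have "\<psi> (\<phi> x) \<in> Q2" using \<psi>(2) R.point(1) by simp
    then show "x \<in> Q2" using 2 by (metis comp_apply id_apply)
  qed
  ultimately have "\<phi> \<in> StabN" by (simp add: StabN_iff)
  then show ?thesis using that conj i by blast
qed

end

section \<open>Automorphisms that induce the identity on V\<close>

locale normalised_iso = wreath_iso +
  assumes induced_eq: "v \<in> ThompsonV \<Longrightarrow> induced v = v"
begin

lemma swap_normalised: "normalised_iso \<Gamma> \<theta>' \<theta> g0"
proof -
  interpret R: wreath_iso \<Gamma> \<theta>' \<theta> g0 by (rule swap)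
  show ?thesis by unfold_locales (metis induced_eq induced_inverse)
qed

definition cocycle :: "(cantor \<Rightarrow> cantor) \<Rightarrow> cantor \<Rightarrow> 'a" where
  "cocycle v = fst (\<theta> (kone \<Gamma>, v))"

lemma cocycle_Kfin [simp]: "v \<in> ThompsonV \<Longrightarrow> cocycle v \<in> Kfin \<Gamma>"
  by (simp add: cocycle_def)

lemma image_V: "v \<in> ThompsonV \<Longrightarrow> \<theta> (kone \<Gamma>, v) = (cocycle v, v)"
  using induced_eq[of v] by (simp add: cocycle_def induced_def prod_eq_iff)

lemma cocycle_comp:
  assumes "v \<in> ThompsonV" "w \<in> ThompsonV"
  shows "cocycle (v \<circ> w) x = cocycle v x \<otimes> cocycle w (the_inv v x)"
proof -
  have "\<theta> (kone \<Gamma>, v \<circ> w) = \<theta> (kone \<Gamma>, v) \<otimes>\<^bsub>G\<^esub> \<theta> (kone \<Gamma>, w)"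
    using mult[of "(kone \<Gamma>, v)" "(kone \<Gamma>, w)", unfolded kone_mult] assms by simp
  then show ?thesis using assms by (simp add: image_V)
qed

lemma cocycle_id: "cocycle id x = \<one>"
  using hom_one by (simp add: cocycle_def one_G kone_def)

definition slot_aut :: "cantor \<Rightarrow> 'a \<Rightarrow> 'a" where
  "slot_aut x g = fst (\<theta> (single x g, id)) x"

lemma slot_aut_closed [simp]: "x \<in> Q2 \<Longrightarrow> g \<in> carrier \<Gamma> \<Longrightarrow> slot_aut x g \<in> carrier \<Gamma>"
  by (simp add: slot_aut_def)

text \<open>The support of the image is finite and invariant under V_x, while V_x can move any other
  point y to a fresh point e; so only x can occur in it.\<close>

lemma image_single:
  assumes x: "x \<in> Q2" and g: "g \<in> carrier \<Gamma>"
  shows "\<theta> (single x g, id) = (single x (slot_aut x g), id)"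
proof -
  define d where "d = fst (\<theta> (single x g, id))"
  have dK: "d \<in> Kfin \<Gamma>" using x g by (simp add: d_def)
  have "d y = \<one>" if yx: "y \<noteq> x" for y
  proof (rule ccontr)
    assume dy: "d y \<noteq> \<one>"
    then have y: "y \<in> Q2" using dK by (metis Kfin_off)
    obtain e where e: "e \<in> Q2" "e \<notin> insert x {y. d y \<noteq> \<one>}"
      using Q2_avoid[of "insert x {y. d y \<noteq> \<one>}"] Kfin_finite[OF dK] by auto
    obtain v where v: "v \<in> ThompsonV" "v y = e" "\<And>z. z \<in> {x} \<Longrightarrow> v z = z"
      using swap_points[of y e "{x}"] y e yx by auto
    have "v ` {y. d y \<noteq> \<one>} = {y. d y \<noteq> \<one>}"
      using support_invariant[OF x g v(1)] v induced_eq by (simp add: d_def)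
    then have "e \<in> {y. d y \<noteq> \<one>}" using v(2) dy by blast
    then show False using e by simp
  qed
  then have "d = single x (slot_aut x g)" by (auto simp: single_def slot_aut_def d_def)
  then show ?thesis using K_to_K[of "single x g"] x g by (simp add: d_def prod_eq_iff)
qed

lemma slot_aut_mult:
  assumes "x \<in> Q2" "g \<in> carrier \<Gamma>" "h \<in> carrier \<Gamma>" shows "slot_aut x (g \<otimes> h) = slot_aut x g \<otimes> slot_aut x h"
proof -
  have e: "(single x g, id) \<otimes>\<^bsub>G\<^esub> (single x h, id) = (single x (g \<otimes> h), id)"
    by (auto simp: single_def)
  have "\<theta> (single x (g \<otimes> h), id) = \<theta> (single x g, id) \<otimes>\<^bsub>G\<^esub> \<theta> (single x h, id)"
    using mult[of "(single x g, id)" "(single x h, id)"] assms unfolding e by simp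
  then show ?thesis using assms by (simp add: image_single) (metis single_same)
qed

lemma slot_aut_inverse:
  assumes "x \<in> Q2" "g \<in> carrier \<Gamma>" shows "normalised_iso.slot_aut \<Gamma> \<theta>' x (slot_aut x g) = g"
proof -
  interpret R: normalised_iso \<Gamma> \<theta>' \<theta> g0 by (rule swap_normalised)
  have "(single x (R.slot_aut x (slot_aut x g)), id) = (single x g, id :: cantor \<Rightarrow> cantor)"
    using left_inv[of "(single x g, id)"] assms by (simp add: image_single R.image_single)
  then show ?thesis by (metis fst_conv single_same)
qed

lemma slot_aut_surj: assumes "x \<in> Q2" "h \<in> carrier \<Gamma>" obtains g where "g \<in> carrier \<Gamma>" "slot_aut x g = h"
proof -
  interpret R: normalised_iso \<Gamma> \<theta>' \<theta> g0 by (rule swap_normalised)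
  show ?thesis using that[of "R.slot_aut x h"] R.slot_aut_inverse[OF assms] R.slot_aut_closed[OF assms] by simp
qed

text \<open>\<theta> is applied to the relation that v carries \<Gamma>_x to the copy of \<Gamma> at
  \<open>v x\<close>, and the result is evaluated at \<open>v x\<close>.\<close>

lemma slot_aut_equivariant:
  assumes x: "x \<in> Q2" and g: "g \<in> carrier \<Gamma>" and v: "v \<in> ThompsonV"
  shows "cocycle v (v x) \<otimes> slot_aut x g = slot_aut (v x) g \<otimes> cocycle v (v x)"
proof -
  have "single x g (the_inv v y) = single (v x) g y" for y
    using v by (auto simp: single_def the_inv_eq_iff)
  then have "(kone \<Gamma>, v) \<otimes>\<^bsub>G\<^esub> (single x g, id) = (single (v x) g, id) \<otimes>\<^bsub>G\<^esub> (kone \<Gamma>, v)"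
    using g by (simp add: kone_def single_def)
  then have "\<theta> (kone \<Gamma>, v) \<otimes>\<^bsub>G\<^esub> \<theta> (single x g, id) = \<theta> (single (v x) g, id) \<otimes>\<^bsub>G\<^esub> \<theta> (kone \<Gamma>, v)"
    using mult[of "(kone \<Gamma>, v)" "(single x g, id)"] mult[of "(single (v x) g, id)" "(kone \<Gamma>, v)"] x g v by simp
  from arg_cong[OF this, of "\<lambda>p. fst p (v x)"]
  have "cocycle v (v x) \<otimes> single x (slot_aut x g) (the_inv v (v x)) = single (v x) (slot_aut (v x) g) (v x) \<otimes> cocycle v (the_inv id (v x))"
    using x g v by (simp only: image_V image_single V_Q2 mult_G fst_conv)
  then show ?thesis using v by simp
qed

text \<open>By \<open>slot_aut_equivariant\<close> the value commutes with the image of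
  \<open>slot_aut x\<close>, which is all of \<Gamma>.\<close>

lemma cocycle_fix_centre:
  assumes x: "x \<in> Q2" and v: "v \<in> ThompsonV" "v x = x"
  shows "cocycle v x \<in> centre \<Gamma>"
proof (rule centreI)
  fix h assume "h \<in> carrier \<Gamma>"
  then obtain g where g: "g \<in> carrier \<Gamma>" "slot_aut x g = h" using slot_aut_surj[OF x] by blast
  show "cocycle v x \<otimes> h = h \<otimes> cocycle v x" using slot_aut_equivariant[OF x g(1) v(1)] g(2) v(2) by simp
qed (use v in simp)

text \<open>Near \<open>x\<close> there is a point \<open>y\<close> outside the finite support of \<open>cocycle u\<close>, and an element of \<open>V\<close>
  that maps \<open>x\<close> to \<open>y\<close> and commutes with \<open>u\<close>.\<close>

lemma cocycle_trivial_germ: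
  assumes x: "x \<in> Q2" and u: "u \<in> ThompsonV" "u x = x" "log_slope u x = 0"
  shows "cocycle u x = \<one>"
proof -
  obtain n where n: "\<And>y. pre n y = pre n x \<Longrightarrow> u y = y" using id_near u by blast
  have "\<not> {y \<in> Q2. pre n y = pre n x} \<subseteq> {y. cocycle u y \<noteq> \<one>}"
    using infinite_Q2_near[of n x] finite_subset Kfin_finite[OF cocycle_Kfin[OF u(1)]] by blast
  then obtain y where y: "y \<in> Q2" "pre n y = pre n x" "cocycle u y = \<one>" by blast
  obtain v where v: "v \<in> ThompsonV" "v x = y" "\<And>z. pre n z \<noteq> pre n x \<Longrightarrow> v z = z"
    using swap_near[OF x y(1,2)] by blast
  have u_inj: "u y = u z \<longleftrightarrow> y = z" for y z using bij_is_inj[OF V_bij[OF u(1)]] by (simp add: inj_eq)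
  have v_inj: "v y = v z \<longleftrightarrow> y = z" for y z using bij_is_inj[OF V_bij[OF v(1)]] by (simp add: inj_eq)
  \<comment> \<open>v moves points only within the cylinder of x, on which u is the
    identity.\<close>
  have "v (u z) = u (v z)" for z
  proof (cases "pre n z = pre n x")
    case True
    then have "pre n (v z) = pre n x" using v(3)[of "v z"] v_inj by metis
    then show ?thesis using n True by simp
  next
    case False
    then have "pre n (u z) \<noteq> pre n x" using n[of "u z"] u_inj by metis
    then show ?thesis using v(3) False by simp
  qed
  then have "v \<circ> u = u \<circ> v" by (intro ext) simp
  then have "cocycle v y \<otimes> cocycle u (the_inv v y) = cocycle u y \<otimes> cocycle v (the_inv u y)"
    using cocycle_comp[OF v(1) u(1), of y] cocycle_comp[OF u(1) v(1), of y] by simp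
  moreover have "the_inv v y = x" "the_inv u y = y" using v(1,2) u(1) n[OF y(2)] by (simp_all add: the_inv_eq)
  ultimately have "cocycle v y \<otimes> cocycle u x = cocycle v y" using y(3) v(1) by simp
  then show ?thesis using u v by simp
qed

section \<open>Germs at 0 and the central element \<open>zeta\<close>\<close>

definition zeta :: 'a where "zeta = inv (cocycle contr zero_seq)"

lemma zeta_centre [simp]: "zeta \<in> centre \<Gamma>"
  unfolding zeta_def using cocycle_fix_centre[OF zero_Q2 contr_V contr_zero(1)] by simp

lemma cocycle_stabiliser_comp:
  assumes "v \<in> ThompsonV" "v zero_seq = zero_seq" "w \<in> ThompsonV"
  shows "cocycle (v \<circ> w) zero_seq = cocycle v zero_seq \<otimes> cocycle w zero_seq"
  using cocycle_comp[OF assms(1,3), of zero_seq] assms by (simp add: the_inv_eq)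

lemma cocycle_contr_pow: "cocycle (contr ^^ n) zero_seq = zeta [^] (- int n)"
proof (induction n)
  case 0
  show ?case unfolding funpow.simps(1) cocycle_id by simp
next
  case (Suc n)
  have "cocycle (contr ^^ Suc n) zero_seq = cocycle contr zero_seq \<otimes> zeta [^] (- int n)"
    unfolding funpow.simps(2) Suc.IH[symmetric]
    by (rule cocycle_stabiliser_comp) (use contr_V contr_zero log_slope_funpow(1) in auto)
  \<comment> \<open>\<open>contr\<close> has logarithmic slope -1; the inverse in the definition of
    \<open>zeta\<close> makes the exponent agree with the slope.\<close>
  also have "cocycle contr zero_seq = zeta [^] (-1 :: int)"
    using contr_V by (simp add: zeta_def int_pow_neg)
  also have "zeta [^] (-1 :: int) \<otimes> zeta [^] (- int n) = zeta [^] (- int (Suc n))"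
    by (subst int_pow_mult[symmetric]) simp_all
  finally show ?case .
qed

text \<open>Composing u with a power of \<open>contr\<close> of opposite slope gives a trivial germ
  at 0. Only natural powers occur, so negative slopes go through the inverse of u.\<close>

lemma cocycle_stabiliser:
  assumes u: "u \<in> ThompsonV" "u zero_seq = zero_seq"
  shows "cocycle u zero_seq = zeta [^] log_slope u zero_seq"
proof -
  have pos: "cocycle u zero_seq = zeta [^] log_slope u zero_seq"
    if u: "u \<in> ThompsonV" "u zero_seq = zero_seq" "log_slope u zero_seq \<ge> 0" for u
  proof -
    define n where "n = nat (log_slope u zero_seq)"
    note cn = log_slope_funpow[OF contr_V contr_zero(1), of n]
    have "log_slope (u \<circ> contr ^^ n) zero_seq = 0"
      using log_slope_comp[OF u(1) cn(1), of zero_seq] cn(2,3) contr_zero(2) u(3) by (simp add: n_def)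
    then have "cocycle (u \<circ> contr ^^ n) zero_seq = \<one>"
      using u cn(1,2) by (intro cocycle_trivial_germ V_comp zero_Q2) simp_all
    then have "cocycle u zero_seq \<otimes> zeta [^] (- int n) = \<one>"
      using cocycle_stabiliser_comp[OF u(1,2) cn(1)] by (simp add: cocycle_contr_pow)
    then have "cocycle u zero_seq = zeta [^] int n"
      using u(1) by (simp add: int_pow_neg mult_inv_eq_one)
    then show ?thesis using u(3) by (simp add: n_def)
  qed
  show ?thesis
  proof (cases "log_slope u zero_seq \<ge> 0")
    case False
    have i: "the_inv u zero_seq = zero_seq" using u by (simp add: the_inv_eq)
    then have s: "log_slope (the_inv u) zero_seq = - log_slope u zero_seq" using log_slope_inv[OF u(1)] by simp
    have "cocycle (u \<circ> the_inv u) zero_seq = \<one>" using u(1) cocycle_id by simp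
    then have "cocycle u zero_seq \<otimes> zeta [^] (- log_slope u zero_seq) = \<one>"
      using cocycle_stabiliser_comp[OF u V_inv[OF u(1)]] pos[of "the_inv u"] i s False u(1) by simp
    then show ?thesis using u(1) by (simp add: int_pow_neg mult_inv_eq_one)
  qed (use pos u in blast)
qed

text \<open>The cocycle divided by the power of \<open>zeta\<close> with exponent p is trivial on
  the stabiliser of 0, so its value at x is the same for all v taking 0 to x. This is the usual
  primitive of a cocycle on a transitive set, with value 1 at 0.\<close>

definition potential :: "cantor \<Rightarrow> 'a" where
  "potential x = (if x \<in> Q2 then let v = SOME v. v \<in> ThompsonV \<and> v zero_seq = x
     in cocycle v x \<otimes> zeta [^] (- p_cocycle v x) else \<one>)"

lemma potential_eq:
  assumes v: "v \<in> ThompsonV" "v zero_seq = x"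
  shows "potential x = cocycle v x \<otimes> zeta [^] (- p_cocycle v x)"
proof -
  have x: "x \<in> Q2" using v zero_Q2 by (metis V_Q2)
  define w where "w = (SOME v. v \<in> ThompsonV \<and> v zero_seq = x)"
  have w: "w \<in> ThompsonV" "w zero_seq = x" using someI[of "\<lambda>v. v \<in> ThompsonV \<and> v zero_seq = x"] v
    by (auto simp: w_def)
  define u where "u = the_inv w \<circ> v"
  have u: "u \<in> ThompsonV" "u zero_seq = zero_seq" and vw: "v = w \<circ> u"
    using v w by (auto simp: u_def the_inv_eq V_comp_assoc_inv)
  have iw: "the_inv w x = zero_seq" using w by (simp add: the_inv_eq)
  have p: "- p_cocycle v x = - log_slope u zero_seq + - p_cocycle w x"
    unfolding vw using p_cocycle_comp[OF w(1) u(1), of x] iw u by (simp add: p_cocycle_fix)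
  have "cocycle v x = cocycle w x \<otimes> zeta [^] log_slope u zero_seq"
    unfolding vw using cocycle_comp[OF w(1) u(1), of x] iw cocycle_stabiliser[OF u] by simp
  then have "cocycle v x \<otimes> zeta [^] (- p_cocycle v x) = cocycle w x \<otimes> zeta [^] (- p_cocycle w x)"
    unfolding p using w(1) by (subst int_pow_mult) (simp_all add: int_pow_neg m_assoc)
  then show ?thesis using x by (simp add: potential_def Let_def w_def)
qed

lemma potential_Kbar: "potential \<in> Kbar \<Gamma>"
proof (rule KbarI)
  fix x assume "x \<in> Q2"
  then obtain v where "v \<in> ThompsonV" "v zero_seq = x" using V_transitive[OF zero_Q2] by blast
  then show "potential x \<in> carrier \<Gamma>" by (simp add: potential_eq)
qed (simp add: potential_def)

lemma potential_closed [simp]: "potential x \<in> carrier \<Gamma>"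
  using potential_Kbar by simp

text \<open>If w takes 0 to \<open>the_inv v x\<close>, then v o w takes 0 to x; evaluating the
  primitive with these two elements leaves the cocycle of v as the quotient, up to a central
  power.\<close>

lemma cocycle_eq:
  assumes v: "v \<in> ThompsonV" and x: "x \<in> Q2"
  shows "cocycle v x = potential x \<otimes> inv (potential (the_inv v x)) \<otimes> zeta [^] p_cocycle v x"
proof -
  obtain w where w: "w \<in> ThompsonV" "w zero_seq = the_inv v x"
    using V_transitive[of zero_seq "the_inv v x"] v x by auto
  have vw: "v \<circ> w \<in> ThompsonV" "(v \<circ> w) zero_seq = x" using v w by auto
  define y where "y = the_inv v x"
  have fx: "potential x = cocycle v x \<otimes> cocycle w y \<otimes> zeta [^] (- p_cocycle w y + - p_cocycle v x)"
    unfolding potential_eq[OF vw] cocycle_comp[OF v w(1)] p_cocycle_comp[OF v w(1)] y_def by (simp add: add.commute)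
  also have "zeta [^] (- p_cocycle w y + - p_cocycle v x) = zeta [^] (- p_cocycle w y) \<otimes> inv (zeta [^] p_cocycle v x)"
    by (subst int_pow_mult) (simp_all add: int_pow_neg)
  also have "cocycle v x \<otimes> cocycle w y \<otimes> (zeta [^] (- p_cocycle w y) \<otimes> inv (zeta [^] p_cocycle v x))
    = cocycle v x \<otimes> (cocycle w y \<otimes> zeta [^] (- p_cocycle w y)) \<otimes> inv (zeta [^] p_cocycle v x)"
    using v w(1) by (simp add: m_assoc)
  also have "cocycle w y \<otimes> zeta [^] (- p_cocycle w y) = potential y" using potential_eq[OF w] by (simp add: y_def)
  finally have fx: "potential x = cocycle v x \<otimes> potential y \<otimes> inv (zeta [^] p_cocycle v x)" .
  define z where "z = zeta [^] p_cocycle v x"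
  have z: "z \<in> centre \<Gamma>" by (simp add: z_def)
  have "potential x \<otimes> inv (potential y) \<otimes> z = cocycle v x \<otimes> (potential y \<otimes> (inv z \<otimes> (inv (potential y) \<otimes> z)))"
    unfolding fx z_def[symmetric] using v z by (simp add: m_assoc)
  also have "inv (potential y) \<otimes> z = z \<otimes> inv (potential y)" by (rule centre_comm[OF z, symmetric]) simp
  also have "cocycle v x \<otimes> (potential y \<otimes> (inv z \<otimes> (z \<otimes> inv (potential y)))) = cocycle v x" using z v by simp
  finally show ?thesis by (simp add: z_def y_def)
qed

text \<open>By \<open>cocycle_eq\<close>, the potential differs from its translate only where
  \<open>cocycle v\<close> or p is nontrivial, and both have finite support.\<close>

lemma potential_NKbar: "potential \<in> NKbar \<Gamma>"
  unfolding NKbar_iff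
proof (intro conjI ballI potential_Kbar)
  fix v assume v: "v \<in> ThompsonV"
  have "finite ({x. cocycle v x \<noteq> \<one>} \<union> {x \<in> Q2. p_cocycle v x \<noteq> 0})"
    using Kfin_finite[OF cocycle_Kfin[OF v]] p_cocycle_finite[OF v] by simp
  then show "finite {x \<in> Q2. potential x \<noteq> potential (the_inv v x)}"
    by (rule rev_finite_subset) (use cocycle_eq[OF v] in \<open>auto simp: mult_inv_eq_one\<close>)
qed

text \<open>An element w taking 0 to x links the two slots through \<open>cocycle w x\<close>, which
  equals the potential up to a central factor and so conjugates in the same way.\<close>

lemma slot_aut_eq:
  assumes x: "x \<in> Q2" and g: "g \<in> carrier \<Gamma>"
  shows "slot_aut x g = potential x \<otimes> slot_aut zero_seq g \<otimes> inv (potential x)"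
proof -
  obtain w where w: "w \<in> ThompsonV" "w zero_seq = x" using V_transitive[OF zero_Q2 x] by blast
  define z where "z = zeta [^] (- p_cocycle w x)"
  have z: "z \<in> centre \<Gamma>" by (simp add: z_def)
  have "potential x \<otimes> slot_aut zero_seq g = cocycle w x \<otimes> slot_aut zero_seq g \<otimes> z"
    using z w(1) g centre_comm[OF z, of "slot_aut zero_seq g"] by (simp add: potential_eq[OF w] m_assoc flip: z_def)
  also have "cocycle w x \<otimes> slot_aut zero_seq g = slot_aut x g \<otimes> cocycle w x"
    using slot_aut_equivariant[OF zero_Q2 g w(1)] by (simp add: w(2))
  also have "slot_aut x g \<otimes> cocycle w x \<otimes> z = slot_aut x g \<otimes> potential x"
    using z w(1) g x by (simp add: potential_eq[OF w] m_assoc flip: z_def)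
  finally show ?thesis using g x by (simp add: m_assoc)
qed

definition base_aut :: "'a \<Rightarrow> 'a" where "base_aut = restrict (slot_aut zero_seq) (carrier \<Gamma>)"

lemma base_aut_auto: "base_aut \<in> auto \<Gamma>"
proof -
  have "base_aut \<in> hom \<Gamma> \<Gamma>" by (rule homI) (simp_all add: base_aut_def slot_aut_mult)
  moreover have "inj_on base_aut (carrier \<Gamma>)"
    by (rule inj_on_inverseI[of _ "normalised_iso.slot_aut \<Gamma> \<theta>' zero_seq"]) (simp add: base_aut_def slot_aut_inverse)
  moreover have "base_aut ` carrier \<Gamma> = carrier \<Gamma>"
  proof
    show "base_aut ` carrier \<Gamma> \<subseteq> carrier \<Gamma>" by (auto simp: base_aut_def)
    show "carrier \<Gamma> \<subseteq> base_aut ` carrier \<Gamma>"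
    proof
      fix h assume "h \<in> carrier \<Gamma>"
      then obtain g where "g \<in> carrier \<Gamma>" "slot_aut zero_seq g = h" using slot_aut_surj[OF zero_Q2] by blast
      then show "h \<in> base_aut ` carrier \<Gamma>" by (intro image_eqI[of _ _ g]) (simp_all add: base_aut_def)
    qed
  qed
  ultimately show ?thesis by (simp add: auto_def Bij_def bij_betw_def base_aut_def)
qed

text \<open>Both sides are multiplicative, and they agree on V and on every \<Gamma>_y, which
  together generate G.\<close>

lemma Xmap_normalised:
  assumes "g \<in> carrier G" shows "\<theta> g = Xmap zeta potential id base_aut g"
proof -
  note q = zeta_centre potential_NKbar StabN_id base_aut_auto
  have V: "\<theta> (kone \<Gamma>, v) = Xmap zeta potential id base_aut (kone \<Gamma>, v)" if v: "v \<in> ThompsonV" for v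
  proof -
    have "cocycle v x = (if x \<in> Q2 then potential x \<otimes> base_aut \<one> \<otimes> inv (potential (the_inv v x)) \<otimes> zeta [^] p_cocycle v x else \<one>)" for x
      using v cocycle_eq[OF v, of x] base_aut_auto by simp
    then have "cocycle v = (\<lambda>x. if x \<in> Q2 then potential x \<otimes> base_aut \<one> \<otimes> inv (potential (the_inv v x)) \<otimes> zeta [^] p_cocycle v x else \<one>)"
      by (rule ext)
    then show ?thesis unfolding image_V[OF v] by (simp add: Xmap_def Let_def) (simp only: kone_def)
  qed
  have S: "\<theta> (single y g, id) = Xmap zeta potential id base_aut (single y g, id)" if y: "y \<in> Q2" "g \<in> carrier \<Gamma>" for y g
  proof -
    have "single y (slot_aut y g) x = (if x \<in> Q2 then potential x \<otimes> base_aut (single y g x) \<otimes> inv (potential x) \<otimes> zeta [^] (0 :: int) else \<one>)" for x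
    proof -
      have "base_aut g = slot_aut zero_seq g" using y by (simp add: base_aut_def)
      then show ?thesis using y auto_one[OF base_aut_auto] slot_aut_eq[OF y] by (auto simp: single_def)
    qed
    then show ?thesis using y unfolding image_single[OF y] Xmap_def Let_def by (auto simp: fun_eq_iff)
  qed
  have K: "\<theta> (a, id) = Xmap zeta potential id base_aut (a, id)" if a: "a \<in> Kfin \<Gamma>" for a
  proof (rule Kfin_induct[OF a, where P = "\<lambda>a. \<theta> (a, id) = Xmap zeta potential id base_aut (a, id)"])
    fix x g a assume h: "x \<in> Q2" "g \<in> carrier \<Gamma>" "a \<in> Kfin \<Gamma>" and IH: "\<theta> (a, id) = Xmap zeta potential id base_aut (a, id)"
    have e: "(\<lambda>y. single x g y \<otimes> a y, id :: cantor \<Rightarrow> cantor) = (single x g, id) \<otimes>\<^bsub>G\<^esub> (a, id)" by simp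
    have "\<theta> ((single x g, id) \<otimes>\<^bsub>G\<^esub> (a, id)) = \<theta> (single x g, id) \<otimes>\<^bsub>G\<^esub> \<theta> (a, id)"
      using h by (intro mult) simp_all
    also have "\<dots> = Xmap zeta potential id base_aut (single x g, id) \<otimes>\<^bsub>G\<^esub> Xmap zeta potential id base_aut (a, id)"
      unfolding IH S[OF h(1,2)] ..
    also have "\<dots> = Xmap zeta potential id base_aut ((single x g, id) \<otimes>\<^bsub>G\<^esub> (a, id))"
      using h by (intro Xmap_hom[OF q, symmetric]) simp_all
    finally show "\<theta> (\<lambda>y. single x g y \<otimes> a y, id) = Xmap zeta potential id base_aut (\<lambda>y. single x g y \<otimes> a y, id)"
      unfolding e .
  qed (rule V[OF V_id])
  obtain a v where e: "g = (a, v)" "a \<in> Kfin \<Gamma>" "v \<in> ThompsonV" using assms by (cases g) auto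
  have "\<theta> g = \<theta> (a, id) \<otimes>\<^bsub>G\<^esub> \<theta> (kone \<Gamma>, v)"
    unfolding e(1) split_G[OF e(2), of v] using e by (intro mult) simp_all
  also have "\<dots> = Xmap zeta potential id base_aut (a, id) \<otimes>\<^bsub>G\<^esub> Xmap zeta potential id base_aut (kone \<Gamma>, v)"
    unfolding K[OF e(2)] V[OF e(3)] ..
  also have "\<dots> = Xmap zeta potential id base_aut ((a, id) \<otimes>\<^bsub>G\<^esub> (kone \<Gamma>, v))"
    using e by (intro Xmap_hom[OF q, symmetric]) simp_all
  also have "\<dots> = Xmap zeta potential id base_aut g" unfolding e(1) split_G[OF e(2), of v, symmetric] ..
  finally show ?thesis .
qed

end

section \<open>Factorisation of an arbitrary automorphism\<close>

context coeff_group
begin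

lemma Q_closed:
  assumes "q1 \<in> carrier (Qgrp \<Gamma>)" "q2 \<in> carrier (Qgrp \<Gamma>)"
  shows "q1 \<otimes>\<^bsub>Qgrp \<Gamma>\<^esub> q2 \<in> carrier (Qgrp \<Gamma>)"
proof -
  obtain \<zeta>1 F1 \<phi>1 \<beta>1 where q1: "q1 = (\<zeta>1, F1, \<phi>1, \<beta>1)" by (cases q1)
  obtain \<zeta>2 F2 \<phi>2 \<beta>2 where q2: "q2 = (\<zeta>2, F2, \<phi>2, \<beta>2)" by (cases q2)
  from assms have h1: "\<zeta>1 \<in> centre \<Gamma>" "F1 \<in> zcls \<Gamma> ` NKbar \<Gamma>" "\<phi>1 \<in> StabN" "\<beta>1 \<in> auto \<Gamma>"
    and h2: "\<zeta>2 \<in> centre \<Gamma>" "F2 \<in> zcls \<Gamma> ` NKbar \<Gamma>" "\<phi>2 \<in> StabN" "\<beta>2 \<in> auto \<Gamma>"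
    by (simp_all add: q1 q2 in_Q)
  have "kmul \<Gamma> (rep F1) (sigma2 \<Gamma> \<phi>1 \<beta>1 \<zeta>2 (rep F2)) \<in> NKbar \<Gamma>"
    using NKbar_mult rep_NKbar h1 h2 sigma2_NKbar by simp
  moreover have "q1 \<otimes>\<^bsub>Qgrp \<Gamma>\<^esub> q2 = (\<zeta>1 \<otimes> \<beta>1 \<zeta>2, zcls \<Gamma> (kmul \<Gamma> (rep F1) (sigma2 \<Gamma> \<phi>1 \<beta>1 \<zeta>2 (rep F2))), \<phi>1 \<circ> \<phi>2, compose (carrier \<Gamma>) \<beta>1 \<beta>2)"
    by (simp add: q1 q2 Qgrp_def)
  ultimately show ?thesis using h1 h2 auto_compose by (simp add: in_Q)
qed

lemma auto_G_iso:
  assumes \<theta>: "\<theta> \<in> auto G" and g0: "g0 \<in> carrier \<Gamma>" "g0 \<noteq> \<one>"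
  shows "wreath_iso \<Gamma> \<theta> (inv_into (carrier G) \<theta>) g0"
proof -
  have bij: "bij_betw \<theta> (carrier G) (carrier G)" and hom: "\<theta> \<in> hom G G" using \<theta> by (auto simp: auto_def Bij_def)
  show ?thesis
  proof
    fix g h assume g: "g \<in> carrier G"
    show "\<theta> g \<in> carrier G" using hom g by (simp add: hom_def Pi_iff)
    show "inv_into (carrier G) \<theta> g \<in> carrier G" using bij g by (simp add: bij_betw_def inv_into_into)
    show "inv_into (carrier G) \<theta> (\<theta> g) = g" using bij g by (simp add: bij_betw_inv_into_left)
    show "\<theta> (inv_into (carrier G) \<theta> g) = g" using bij g by (simp add: bij_betw_inv_into_right)
    show "\<theta> (g \<otimes>\<^bsub>G\<^esub> h) = \<theta> g \<otimes>\<^bsub>G\<^esub> \<theta> h" if "h \<in> carrier G"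
      using hom g that by (simp add: hom_def)
  qed (use g0 in auto)
qed

lemma Xi_surj:
  assumes g0: "g0 \<in> carrier \<Gamma>" "g0 \<noteq> \<one>" and \<theta>: "\<theta> \<in> auto G"
  shows "\<theta> \<in> Xi \<Gamma> ` carrier (Qgrp \<Gamma>)"
proof -
  interpret AG: group "AutoGroup G" by (rule group.AutoGroup[OF group_G])
  have cAG: "carrier (AutoGroup G) = auto G" by (simp add: AutoGroup_def)
  interpret T: wreath_iso \<Gamma> \<theta> "inv_into (carrier G) \<theta>" g0 by (rule auto_G_iso[OF \<theta> g0])
  obtain \<phi> where \<phi>: "\<phi> \<in> StabN" "\<And>v. v \<in> ThompsonV \<Longrightarrow> \<phi> \<circ> v \<circ> the_inv \<phi> = T.induced v"
    using T.point_extends by blast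
  have idA: "(\<lambda>x\<in>carrier \<Gamma>. x) \<in> auto \<Gamma>" by (rule id_in_auto)
  define q2 where "q2 = (\<one>, zcls \<Gamma> (kconst \<Gamma> \<one>), \<phi>, \<lambda>x\<in>carrier \<Gamma>. x)"
  have q2: "q2 \<in> carrier (Qgrp \<Gamma>)" using \<phi>(1) idA kconst_NKbar by (simp add: q2_def in_Q)
  define A where "A = Xi \<Gamma> q2"
  have A: "A \<in> auto G" using Xi_auto[OF q2] by (simp add: A_def)
  have Aeq: "A = restrict (Xmap \<one> (kconst \<Gamma> \<one>) \<phi> (\<lambda>x\<in>carrier \<Gamma>. x)) (carrier G)"
    unfolding A_def q2_def by (rule Xi_zcls) (use \<phi>(1) idA kconst_NKbar in auto)
  \<comment> \<open>Dividing by the automorphism attached to \<phi> on the right removes the induced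
    action on V.\<close>
  define \<theta>1 where "\<theta>1 = \<theta> \<otimes>\<^bsub>AutoGroup G\<^esub> inv\<^bsub>AutoGroup G\<^esub> A"
  have \<theta>1: "\<theta>1 \<in> auto G" using AG.m_closed AG.inv_closed \<theta> A by (simp add: \<theta>1_def cAG)
  have "\<theta> \<in> carrier (AutoGroup G)" "A \<in> carrier (AutoGroup G)" using \<theta> A cAG by blast+
  then have "\<theta> = \<theta>1 \<otimes>\<^bsub>AutoGroup G\<^esub> A" by (simp add: \<theta>1_def AG.m_assoc)
  then have \<theta>eq: "\<theta> = compose (carrier G) \<theta>1 A" using \<theta>1 A by (simp add: AutoGroup_mult)
  interpret N: wreath_iso \<Gamma> \<theta>1 "inv_into (carrier G) \<theta>1" g0 by (rule auto_G_iso[OF \<theta>1 g0])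
  interpret N: normalised_iso \<Gamma> \<theta>1 "inv_into (carrier G) \<theta>1" g0
  proof
    fix w assume w: "w \<in> ThompsonV"
    \<comment> \<open>Writing (1, w) as the image under A of some (a, v) avoids computing the
      inverse of A: \<theta>1 sends it to the image of (a, v) under \<theta>, whose V-part is the
      conjugate of v by \<phi>, that is, w.\<close>
    have "A ` carrier G = carrier G" using A by (simp add: auto_def Bij_def bij_betw_def)
    moreover have "(kone \<Gamma>, w) \<in> carrier G" using w by simp
    ultimately have "(kone \<Gamma>, w) \<in> A ` carrier G" by blast
    then obtain g where g: "g \<in> carrier G" "A g = (kone \<Gamma>, w)" by force
    obtain a v where e: "g = (a, v)" "a \<in> Kfin \<Gamma>" "v \<in> ThompsonV" using g(1) by (cases g) auto
    have "w = snd (A g)" using g(2) by simp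
    also have "\<dots> = \<phi> \<circ> v \<circ> the_inv \<phi>" using g(1) unfolding Aeq e(1) by (simp add: Xmap_pt(3))
    finally have "w = T.induced v" using \<phi>(2)[OF e(3)] by simp
    moreover have "\<theta> g = \<theta>1 (kone \<Gamma>, w)" using fun_cong[OF \<theta>eq, of g] g by (simp add: compose_def)
    ultimately show "N.induced w = w" using T.snd_hom[OF e(2,3)] by (simp add: N.induced_def e(1))
  qed
  define q1 where "q1 = (N.zeta, zcls \<Gamma> N.potential, id :: cantor \<Rightarrow> cantor, N.base_aut)"
  have q1: "q1 \<in> carrier (Qgrp \<Gamma>)" using N.potential_NKbar N.base_aut_auto by (simp add: q1_def in_Q)
  have "Xi \<Gamma> q1 = restrict (Xmap N.zeta N.potential id N.base_aut) (carrier G)"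
    unfolding q1_def by (rule Xi_zcls) (use N.potential_NKbar N.base_aut_auto in auto)
  also have "\<dots> = restrict \<theta>1 (carrier G)" by (rule restrict_ext) (simp add: N.Xmap_normalised)
  also have "\<dots> = \<theta>1" using \<theta>1 by (simp add: auto_def Bij_def extensional_restrict)
  finally have "\<theta> = compose (carrier G) (Xi \<Gamma> q1) (Xi \<Gamma> q2)" using \<theta>eq by (simp add: A_def)
  then have "\<theta> = Xi \<Gamma> (q1 \<otimes>\<^bsub>Qgrp \<Gamma>\<^esub> q2)" using Xi_mult[OF q1 q2] by simp
  then show ?thesis using Q_closed[OF q1 q2] by blast
qed

end

theorem theoremB:
  fixes \<Gamma> :: "'g monoid"
  assumes "group \<Gamma>" and "carrier \<Gamma> \<noteq> {\<one>\<^bsub>\<Gamma>\<^esub>}"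
  shows "Xi \<Gamma> \<in> hom (Qgrp \<Gamma>) (AutoGroup (Gw \<Gamma>))
       \<and> Xi \<Gamma> ` carrier (Qgrp \<Gamma>) = carrier (AutoGroup (Gw \<Gamma>))
       \<and> kernel (Qgrp \<Gamma>) (AutoGroup (Gw \<Gamma>)) (Xi \<Gamma>)
           = {(\<one>\<^bsub>\<Gamma>\<^esub>, zcls \<Gamma> (kconst \<Gamma> g), id, (\<lambda>h \<in> carrier \<Gamma>. inv\<^bsub>\<Gamma>\<^esub> g \<otimes>\<^bsub>\<Gamma>\<^esub> h \<otimes>\<^bsub>\<Gamma>\<^esub> g)) | g. g \<in> carrier \<Gamma>}"
proof -
  interpret coeff_group \<Gamma> using assms(1) by (simp add: coeff_group_def)
  obtain g0 where "g0 \<in> carrier \<Gamma>" "g0 \<noteq> \<one>\<^bsub>\<Gamma>\<^esub>" using assms(2) by (metis insertI1 one_closed subsetI subset_antisym singletonD singletonI)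
  then have "Xi \<Gamma> ` carrier (Qgrp \<Gamma>) = carrier (AutoGroup (Gw \<Gamma>))"
    using Xi_surj Xi_auto by (auto simp: AutoGroup_def)
  then show ?thesis using Xi_hom Xi_kernel by blast
qed

end
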